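(* Over $\mathsf{RCA}_0$, the system $\mathsf{ACA}_0$ is equivalent to $\mathsf{RKL}$; that is, $\mathsf{RCA}_0 \vdash \mathsf{ACA}_0 \leftrightarrow \mathsf{RKL}$, where $\mathsf{RKL}$ is the statement "for every infinite, finitely branching tree $T \subseteq \mathbb{N}^{<\mathbb{N}}$, there is an infinite partial function that is homogeneous for $T$."
   Context: $\mathsf{RCA}_0$ is the subsystem of second-order arithmetic axiomatized by the basic axioms of arithmetic, $\Sigma^0_1$ induction and $\Delta^0_1$ comprehension; $\mathsf{ACA}_0$ is $\mathsf{RCA}_0$ together with the arithmetical comprehension scheme. $\mathbb{N}$ denotes the first-order part of a possibly nonstandard model. $\mathbb{N}^{<\mathbb{N}}$ is the set of finite strings over $\mathbb{N}$; a tree is a subset of $\mathbb{N}^{<\mathbb{N}}$ closed under initial segments; $|\sigma|$ is the length of $\sigma$. A partial function $h \colon \subseteq \mathbb{N} \to \mathbb{N}$ (whose domain $\mathrm{dom}(h)$ is always assumed to exist as a set) is homogeneous for a string $\sigma \in \mathbb{N}^{<\mathbb{N}}$ if $(\forall n \in \mathrm{dom}(h))(n < |\sigma| \rightarrow \sigma(n) = h(n))$. If $T$ is an infinite, finitely branching tree, then $h$ is homogeneous for $T$ if the tree $\{\sigma \in T : h \text{ is homogeneous for } \sigma\}$ is infinite. The partial function $h$ is infinite if $\mathrm{dom}(h)$ is infinite. *)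

theory Defs
  imports Main
begin

section \<open>The two-sorted language of second-order arithmetic\<close>

text \<open>
  Number variables and set variables are two separate families of de Bruijn indices:
  \<open>AllN\<close> binds the number index 0 of its body and leaves the set indices alone, \<open>AllS\<close> binds
  the set index 0 of its body and leaves the number indices alone.
\<close>

datatype tm =
    V nat
  | Zero
  | One
  | Add tm tm  (infixl "\<^bold>+" 75)
  | Mul tm tm  (infixl "\<^bold>*" 80)

datatype fm =
    Eq tm tm   (infix "\<^bold>=" 65)
  | Less tm tm (infix "\<^bold><" 65)
  | Mem tm nat (infix "\<^bold>\<in>" 65)
  | Falsum     ("\<^bold>\<bottom>")
  | Imp fm fm  (infixr "\<^bold>\<longrightarrow>" 40)
  | AllN fm
  | AllS fm

abbreviation Neg :: "fm \<Rightarrow> fm" ("\<^bold>\<not> _" [60] 60)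
  where "\<^bold>\<not> p \<equiv> p \<^bold>\<longrightarrow> \<^bold>\<bottom>"

abbreviation Con :: "fm \<Rightarrow> fm \<Rightarrow> fm" (infixr "\<^bold>\<and>" 50)
  where "p \<^bold>\<and> q \<equiv> \<^bold>\<not> (p \<^bold>\<longrightarrow> \<^bold>\<not> q)"

abbreviation Dis :: "fm \<Rightarrow> fm \<Rightarrow> fm" (infixr "\<^bold>\<or>" 45)
  where "p \<^bold>\<or> q \<equiv> \<^bold>\<not> p \<^bold>\<longrightarrow> q"

abbreviation Iff :: "fm \<Rightarrow> fm \<Rightarrow> fm" (infix "\<^bold>\<longleftrightarrow>" 42)
  where "p \<^bold>\<longleftrightarrow> q \<equiv> (p \<^bold>\<longrightarrow> q) \<^bold>\<and> (q \<^bold>\<longrightarrow> p)"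

abbreviation ExN :: "fm \<Rightarrow> fm"
  where "ExN p \<equiv> \<^bold>\<not> AllN (\<^bold>\<not> p)"

abbreviation ExS :: "fm \<Rightarrow> fm"
  where "ExS p \<equiv> \<^bold>\<not> AllS (\<^bold>\<not> p)"


section \<open>Substitution\<close>

text \<open>
  \<open>subst \<sigma> \<rho> p\<close> simultaneously replaces each free number variable \<open>V n\<close> by the term \<open>\<sigma> n\<close> and each
  free set variable \<open>X\<close> by the set variable \<open>\<rho> X\<close> (there are no other set terms).
\<close>

primrec subst_tm :: "(nat \<Rightarrow> tm) \<Rightarrow> tm \<Rightarrow> tm" where
  "subst_tm \<sigma> (V n) = \<sigma> n"
| "subst_tm \<sigma> Zero = Zero"
| "subst_tm \<sigma> One = One"
| "subst_tm \<sigma> (s \<^bold>+ t) = subst_tm \<sigma> s \<^bold>+ subst_tm \<sigma> t"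
| "subst_tm \<sigma> (s \<^bold>* t) = subst_tm \<sigma> s \<^bold>* subst_tm \<sigma> t"

definition lift_tm :: "tm \<Rightarrow> tm" where
  "lift_tm = subst_tm (\<lambda>n. V (Suc n))"

primrec subst :: "(nat \<Rightarrow> tm) \<Rightarrow> (nat \<Rightarrow> nat) \<Rightarrow> fm \<Rightarrow> fm" where
  "subst \<sigma> \<rho> (s \<^bold>= t) = (subst_tm \<sigma> s \<^bold>= subst_tm \<sigma> t)"
| "subst \<sigma> \<rho> (s \<^bold>< t) = (subst_tm \<sigma> s \<^bold>< subst_tm \<sigma> t)"
| "subst \<sigma> \<rho> (t \<^bold>\<in> X) = (subst_tm \<sigma> t \<^bold>\<in> \<rho> X)"
| "subst \<sigma> \<rho> \<^bold>\<bottom> = \<^bold>\<bottom>"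
| "subst \<sigma> \<rho> (p \<^bold>\<longrightarrow> q) = (subst \<sigma> \<rho> p \<^bold>\<longrightarrow> subst \<sigma> \<rho> q)"
| "subst \<sigma> \<rho> (AllN p) = AllN (subst (case_nat (V 0) (\<lambda>n. lift_tm (\<sigma> n))) \<rho> p)"
| "subst \<sigma> \<rho> (AllS p) = AllS (subst \<sigma> (case_nat 0 (\<lambda>X. Suc (\<rho> X))) p)"

definition liftN :: "fm \<Rightarrow> fm" where
  "liftN = subst (\<lambda>n. V (Suc n)) id"

definition liftS :: "fm \<Rightarrow> fm" where
  "liftS = subst V Suc"

text \<open>Instantiation of the variable bound by \<open>AllN p\<close>, respectively \<open>AllS p\<close>.\<close>

definition instN :: "tm \<Rightarrow> fm \<Rightarrow> fm" where
  "instN t = subst (case_nat t V) id"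

definition instS :: "nat \<Rightarrow> fm \<Rightarrow> fm" where
  "instS X = subst V (case_nat X id)"


section \<open>Provability\<close>

text \<open>
  Classical natural deduction with equality. \<open>prov T G p\<close>: the formula \<open>p\<close> is derivable
  from the axioms \<open>T\<close> and the local hypotheses \<open>G\<close>.  Free variables of an axiom are understood
  as universally quantified, so every substitution instance of an axiom may be used; free
  variables of hypotheses are parameters, and the lifting of \<open>G\<close> in \<open>AllNI\<close> and \<open>AllSI\<close> is the
  eigenvariable condition.
\<close>

inductive prov :: "fm set \<Rightarrow> fm set \<Rightarrow> fm \<Rightarrow> bool" for T :: "fm set" where
  Ax:    "p \<in> T \<Longrightarrow> prov T G (subst \<sigma> \<rho> p)"
| Hyp:   "p \<in> G \<Longrightarrow> prov T G p"
| ImpI:  "prov T (insert p G) q \<Longrightarrow> prov T G (p \<^bold>\<longrightarrow> q)"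
| ImpE:  "prov T G (p \<^bold>\<longrightarrow> q) \<Longrightarrow> prov T G p \<Longrightarrow> prov T G q"
| Raa:   "prov T (insert (\<^bold>\<not> p) G) \<^bold>\<bottom> \<Longrightarrow> prov T G p"
| AllNI: "prov T (liftN ` G) p \<Longrightarrow> prov T G (AllN p)"
| AllNE: "prov T G (AllN p) \<Longrightarrow> prov T G (instN t p)"
| AllSI: "prov T (liftS ` G) p \<Longrightarrow> prov T G (AllS p)"
| AllSE: "prov T G (AllS p) \<Longrightarrow> prov T G (instS X p)"
| EqI:   "prov T G (t \<^bold>= t)"
| EqE:   "prov T G (s \<^bold>= t) \<Longrightarrow> prov T G (instN s p) \<Longrightarrow> prov T G (instN t p)"

definition proves :: "fm set \<Rightarrow> fm \<Rightarrow> bool" (infix "\<turnstile>" 35) where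
  "T \<turnstile> p \<longleftrightarrow> prov T {} p"

definition equivalent_over :: "fm set \<Rightarrow> fm set \<Rightarrow> fm set \<Rightarrow> bool" where
  "equivalent_over B S S' \<longleftrightarrow>
     (\<forall>p\<in>S'. B \<union> S \<turnstile> p) \<and> (\<forall>p\<in>S. B \<union> S' \<turnstile> p)"


section \<open>Formula classes\<close>

text \<open>
  \<open>Sigma00\<close>: all quantifiers are bounded number quantifiers. The bound is lifted, so that it does
  not mention the bound variable. The bounded existential quantifier is the dual of
  the bounded universal one.
\<close>

inductive Sigma00 :: "fm \<Rightarrow> bool" where
  "Sigma00 (s \<^bold>= t)"
| "Sigma00 (s \<^bold>< t)"
| "Sigma00 (t \<^bold>\<in> X)"
| "Sigma00 \<^bold>\<bottom>"
| "Sigma00 p \<Longrightarrow> Sigma00 q \<Longrightarrow> Sigma00 (p \<^bold>\<longrightarrow> q)"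
| "Sigma00 p \<Longrightarrow> Sigma00 (AllN (V 0 \<^bold>< lift_tm t \<^bold>\<longrightarrow> p))"

definition Sigma01 :: "fm \<Rightarrow> bool" where
  "Sigma01 p \<longleftrightarrow> (\<exists>q. Sigma00 q \<and> p = ExN q)"

definition Pi01 :: "fm \<Rightarrow> bool" where
  "Pi01 p \<longleftrightarrow> (\<exists>q. Sigma00 q \<and> p = AllN q)"

primrec arithmetical :: "fm \<Rightarrow> bool" where
  "arithmetical (s \<^bold>= t) = True"
| "arithmetical (s \<^bold>< t) = True"
| "arithmetical (t \<^bold>\<in> X) = True"
| "arithmetical \<^bold>\<bottom> = True"
| "arithmetical (p \<^bold>\<longrightarrow> q) = (arithmetical p \<and> arithmetical q)"
| "arithmetical (AllN p) = arithmetical p"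
| "arithmetical (AllS p) = False"


section \<open>The systems RCA0 and ACA0\<close>

definition basic_axioms :: "fm set" where
  "basic_axioms =
    {\<^bold>\<not> (V 0 \<^bold>+ One \<^bold>= Zero),
     V 0 \<^bold>+ One \<^bold>= V 1 \<^bold>+ One \<^bold>\<longrightarrow> V 0 \<^bold>= V 1,
     V 0 \<^bold>+ Zero \<^bold>= V 0,
     V 0 \<^bold>+ (V 1 \<^bold>+ One) \<^bold>= (V 0 \<^bold>+ V 1) \<^bold>+ One,
     V 0 \<^bold>* Zero \<^bold>= Zero,
     V 0 \<^bold>* (V 1 \<^bold>+ One) \<^bold>= V 0 \<^bold>* V 1 \<^bold>+ V 0,
     \<^bold>\<not> (V 0 \<^bold>< Zero),
     V 0 \<^bold>< V 1 \<^bold>+ One \<^bold>\<longleftrightarrow> (V 0 \<^bold>< V 1 \<^bold>\<or> V 0 \<^bold>= V 1)}"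

text \<open>
  In the schemes the distinguished number variable of \<open>p\<close> is index 0, and all other free
  variables of \<open>p\<close> are parameters.  In the comprehension schemes \<open>liftS\<close> makes
  room for the new set, which therefore does not occur in \<open>p\<close>.
\<close>

definition induction_axiom :: "fm \<Rightarrow> fm" where
  "induction_axiom p =
     (instN Zero p \<^bold>\<and>
      AllN (p \<^bold>\<longrightarrow> subst (case_nat (V 0 \<^bold>+ One) (\<lambda>n. V (Suc n))) id p)
      \<^bold>\<longrightarrow> AllN p)"

definition comprehension_axiom :: "fm \<Rightarrow> fm" where
  "comprehension_axiom p = ExS (AllN (V 0 \<^bold>\<in> 0 \<^bold>\<longleftrightarrow> liftS p))"

definition RCA0 :: "fm set" where
  "RCA0 = basic_axioms
     \<union> {induction_axiom p | p. Sigma01 p}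
     \<union> {AllN (p \<^bold>\<longleftrightarrow> q) \<^bold>\<longrightarrow> comprehension_axiom p | p q. Sigma01 p \<and> Pi01 q}"

definition ACA0 :: "fm set" where
  "ACA0 = RCA0 \<union> {comprehension_axiom p | p. arithmetical p}"


section \<open>Finite strings of numbers\<close>

abbreviation Leq :: "tm \<Rightarrow> tm \<Rightarrow> fm" (infix "\<^bold>\<le>" 65)
  where "s \<^bold>\<le> t \<equiv> s \<^bold>< t \<^bold>+ One"

abbreviation lift2 :: "tm \<Rightarrow> tm"
  where "lift2 t \<equiv> lift_tm (lift_tm t)"

abbreviation lift3 :: "tm \<Rightarrow> tm"
  where "lift3 t \<equiv> lift_tm (lift2 t)"

abbreviation lift4 :: "tm \<Rightarrow> tm"
  where "lift4 t \<equiv> lift_tm (lift3 t)"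

text \<open>The injection \<open>(i, j) \<mapsto> (i + j)\<^sup>2 + i\<close>.\<close>

definition pair :: "tm \<Rightarrow> tm \<Rightarrow> tm" where
  "pair s t = (s \<^bold>+ t) \<^bold>* (s \<^bold>+ t) \<^bold>+ s"

text \<open>
  Strings are coded by Goedel's beta function: a number \<open>s = (l, (a, b))\<close> describes the string of
  length \<open>l\<close> whose \<open>i\<close>-th entry (\<open>i < l\<close>) is the remainder of \<open>a\<close> modulo \<open>1 + (i + 1) b\<close>. Only
  the least number describing a given string counts as its code, so that strings and codes
  correspond one to one; a set of strings is infinite iff its set of codes is.

  All arguments below are terms or set variables living outside of the quantifiers introduced by
  the definition, whence the lifting of terms.
\<close>

text \<open>\<open>str_len s l\<close>: for some \<open>a, b\<close> we have \<open>s = (l, (a, b))\<close>.\<close>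

definition str_len :: "tm \<Rightarrow> tm \<Rightarrow> fm" where
  "str_len s l = ExN (ExN (lift2 s \<^bold>= pair (lift2 l) (pair (V 1) (V 0))))"

text \<open>
  \<open>str_nth s i v\<close>: for some \<open>l, a, b, q\<close> (indices 3, 2, 1, 0) we have \<open>s = (l, (a, b))\<close>,
  \<open>a = q (1 + (i + 1) b) + v\<close> and \<open>v < 1 + (i + 1) b\<close>.
\<close>

definition str_nth :: "tm \<Rightarrow> tm \<Rightarrow> tm \<Rightarrow> fm" where
  "str_nth s i v = ExN (ExN (ExN (ExN
     (lift4 s \<^bold>= pair (V 3) (pair (V 2) (V 1)) \<^bold>\<and>
      V 2 \<^bold>= V 0 \<^bold>* (One \<^bold>+ (lift4 i \<^bold>+ One) \<^bold>* V 1) \<^bold>+ lift4 v \<^bold>\<and>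
      lift4 v \<^bold>< One \<^bold>+ (lift4 i \<^bold>+ One) \<^bold>* V 1))))"

text \<open>\<open>agree s t k\<close>: \<open>s\<close> and \<open>t\<close> have the same \<open>i\<close>-th entry for each \<open>i < k\<close>.\<close>

definition agree :: "tm \<Rightarrow> tm \<Rightarrow> tm \<Rightarrow> fm" where
  "agree s t k = AllN (V 0 \<^bold>< lift_tm k \<^bold>\<longrightarrow>
     AllN (str_nth (lift2 s) (V 1) (V 0) \<^bold>\<longleftrightarrow> str_nth (lift2 t) (V 1) (V 0)))"

definition is_str :: "tm \<Rightarrow> fm" where
  "is_str s = ExN (str_len (lift_tm s) (V 0) \<^bold>\<and>
     \<^bold>\<not> ExN (V 0 \<^bold>< lift2 s \<^bold>\<and> str_len (V 0) (V 1) \<^bold>\<and> agree (V 0) (lift2 s) (V 1)))"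

text \<open>\<open>initial_segment s t\<close>: the string \<open>s\<close> is an initial segment of the string \<open>t\<close>.\<close>

definition initial_segment :: "tm \<Rightarrow> tm \<Rightarrow> fm" where
  "initial_segment s t = (is_str s \<^bold>\<and> is_str t \<^bold>\<and>
     ExN (ExN (str_len (lift2 s) (V 1) \<^bold>\<and> str_len (lift2 t) (V 0) \<^bold>\<and> V 1 \<^bold>\<le> V 0 \<^bold>\<and>
       agree (lift2 s) (lift2 t) (V 1))))"

text \<open>\<open>is_snoc s n t\<close>: the string \<open>t\<close> is the string \<open>s\<close> followed by the single entry \<open>n\<close>.\<close>

definition is_snoc :: "tm \<Rightarrow> tm \<Rightarrow> tm \<Rightarrow> fm" where
  "is_snoc s n t = (is_str s \<^bold>\<and> is_str t \<^bold>\<and>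
     ExN (str_len (lift_tm s) (V 0) \<^bold>\<and> str_len (lift_tm t) (V 0 \<^bold>+ One) \<^bold>\<and>
       agree (lift_tm s) (lift_tm t) (V 0) \<^bold>\<and> str_nth (lift_tm t) (V 0) (lift_tm n)))"


section \<open>Ramsey-type Koenig's lemma\<close>

text \<open>
  \<open>finitely_many p\<close>: there is \<open>k\<close> such that every number \<open>x\<close> with \<open>p x\<close> is below \<open>k\<close>. Here \<open>p\<close> has
  \<open>x\<close> as index 0 and is written without knowledge of \<open>k\<close>; the substitution skips the index of \<open>k\<close>.
\<close>

definition finitely_many :: "fm \<Rightarrow> fm" where
  "finitely_many p =
     ExN (AllN (subst (case_nat (V 0) (\<lambda>n. V (Suc (Suc n)))) id p \<^bold>\<longrightarrow> V 0 \<^bold>< V 1))"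

definition infinitely_many :: "fm \<Rightarrow> fm" where
  "infinitely_many p = (\<^bold>\<not> finitely_many p)"

definition is_tree :: "nat \<Rightarrow> fm" where
  "is_tree T = AllN (V 0 \<^bold>\<in> T \<^bold>\<longrightarrow>
     is_str (V 0) \<^bold>\<and> AllN (initial_segment (V 0) (V 1) \<^bold>\<longrightarrow> V 0 \<^bold>\<in> T))"

text \<open>For each \<open>s\<close> in \<open>T\<close> there are only finitely many \<open>n\<close> such that \<open>s\<close> followed by \<open>n\<close> is in \<open>T\<close>.\<close>

definition finitely_branching :: "nat \<Rightarrow> fm" where
  "finitely_branching T = AllN (V 0 \<^bold>\<in> T \<^bold>\<longrightarrow>
     finitely_many (ExN (V 0 \<^bold>\<in> T \<^bold>\<and> is_snoc (V 2) (V 1) (V 0))))"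

text \<open>
  \<open>is_partial_function H D\<close>: \<open>H\<close> is (the set of pairs forming the graph of) a partial function with
  domain \<open>D\<close>. That \<open>D\<close> is a set variable reflects the convention that domains exist as sets.
\<close>

definition is_partial_function :: "nat \<Rightarrow> nat \<Rightarrow> fm" where
  "is_partial_function H D =
     (AllN (V 0 \<^bold>\<in> H \<^bold>\<longrightarrow> ExN (ExN (V 2 \<^bold>= pair (V 1) (V 0)))) \<^bold>\<and>
      AllN (AllN (AllN (pair (V 2) (V 1) \<^bold>\<in> H \<^bold>\<and> pair (V 2) (V 0) \<^bold>\<in> H \<^bold>\<longrightarrow> V 1 \<^bold>= V 0))) \<^bold>\<and>
      AllN (V 0 \<^bold>\<in> D \<^bold>\<longleftrightarrow> ExN (pair (V 1) (V 0) \<^bold>\<in> H)))"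

text \<open>
  For all \<open>n\<close> in the domain \<open>D\<close> of \<open>H\<close>: if \<open>n\<close> is less than the length of \<open>s\<close>, then \<open>s\<close> and \<open>H\<close> have
  a common value at \<open>n\<close>.
\<close>

definition homogeneous_for_str :: "nat \<Rightarrow> nat \<Rightarrow> tm \<Rightarrow> fm" where
  "homogeneous_for_str H D s = AllN (V 0 \<^bold>\<in> D \<^bold>\<longrightarrow>
     ExN (str_len (lift2 s) (V 0) \<^bold>\<and> V 1 \<^bold>< V 0) \<^bold>\<longrightarrow>
     ExN (str_nth (lift2 s) (V 1) (V 0) \<^bold>\<and> pair (V 1) (V 0) \<^bold>\<in> H))"

definition homogeneous_for_tree :: "nat \<Rightarrow> nat \<Rightarrow> nat \<Rightarrow> fm" where
  "homogeneous_for_tree H D T =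
     infinitely_many (V 0 \<^bold>\<in> T \<^bold>\<and> homogeneous_for_str H D (V 0))"

text \<open>Below the two \<open>ExS\<close>, the tree, the function and its domain are the set indices 2, 1 and 0.\<close>

definition RKL :: fm where
  "RKL = AllS
     (is_tree 0 \<^bold>\<and> infinitely_many (V 0 \<^bold>\<in> 0) \<^bold>\<and> finitely_branching 0 \<^bold>\<longrightarrow>
      ExS (ExS (is_partial_function 1 0 \<^bold>\<and> infinitely_many (V 0 \<^bold>\<in> 0) \<^bold>\<and>
        homogeneous_for_tree 1 0 2)))"

end

theory Submission
  imports Defs "HOL-Library.Countable_Set" "HOL-Library.Nat_Bijection"
begin

text \<open>
  By the completeness theorem it suffices to show that ACA0 and RKL hold in the same models of
  RCA0, where a model consists of possibly nonstandard numbers and a collection of sets of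
  them, over which the set quantifiers range. Completeness (\<open>completeness\<close>) is proved with
  Henkin's construction.

  In a model, formulas are replaced by the relations that they define. Induction and
  comprehension then become statements about HOL predicates, and that a predicate is definable
  by a bounded formula is shown by resolution along its syntactic shape.

  The arithmetic that is needed is Goedel's beta function (\<open>chinese_remainder\<close>), so that every
  bounded function defined by a bounded formula has strings of each length as initial segments
  (\<open>ex_string\<close>), and strong bounding (\<open>strong_bounding\<close>): the elements \<open>x < n\<close> for which there
  is a \<open>y\<close> with \<open>Q x y\<close> have such witnesses below a common bound.

  With arithmetical comprehension, the strings of an infinite, finitely branching tree that
  have infinitely many extensions in the tree form a set. The leftmost path through it is
  definable, and it is a total homogeneous function (\<open>RKL_of_arithmetical_comprehension\<close>).

  Conversely, let \<open>Q\<close> be a relation that is defined by a bounded formula. Consider the tree of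
  those strings \<open>s\<close> whose entry at each \<open>i\<close> is a bound on the least witnesses of the elements
  \<open>x < i\<close> that have a witness below the length of \<open>s\<close>. If the bounds are required to be
  minimal for what is below them, then they are themselves bounded by strong bounding, so that
  the tree is finitely branching and has only finitely many strings of length at most \<open>n\<close>. A
  homogeneous function \<open>h\<close> is met by arbitrarily long strings of the tree, whence \<open>h n\<close> bounds
  the least witness of each \<open>x < n\<close> that has a witness at all. Although the domain of \<open>h\<close> may
  be sparse, it is infinite, and so \<open>h\<close> decides which \<open>x\<close> have a witness
  (\<open>sigma1_comprehension_of_RKL\<close>). Comprehension for existential formulas with set parameters
  yields arithmetical comprehension by induction on the formula, if its variables are coded
  into one number (\<open>arithmetical_comprehension_of_sigma1\<close>).
\<close>


section \<open>Calculus of substitutions\<close>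

abbreviation up :: "(nat \<Rightarrow> tm) \<Rightarrow> nat \<Rightarrow> tm" where
  "up \<sigma> \<equiv> case_nat (V 0) (\<lambda>n. lift_tm (\<sigma> n))"

abbreviation upS :: "(nat \<Rightarrow> nat) \<Rightarrow> nat \<Rightarrow> nat" where
  "upS \<rho> \<equiv> case_nat 0 (\<lambda>X. Suc (\<rho> X))"

lemma subst_tm_subst_tm: "subst_tm \<sigma>' (subst_tm \<sigma> t) = subst_tm (\<lambda>n. subst_tm \<sigma>' (\<sigma> n)) t"
  by (induction t) auto

lemma subst_tm_V [simp]: "subst_tm V t = t"
  by (induction t) auto

lemma subst_tm_up_lift: "subst_tm (up \<sigma>) (lift_tm t) = lift_tm (subst_tm \<sigma> t)"
  by (simp add: lift_tm_def subst_tm_subst_tm)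

lemma subst_subst: "subst \<sigma>' \<rho>' (subst \<sigma> \<rho> p) = subst (\<lambda>n. subst_tm \<sigma>' (\<sigma> n)) (\<lambda>X. \<rho>' (\<rho> X)) p"
proof (induction p arbitrary: \<sigma> \<rho> \<sigma>' \<rho>')
  case (AllN p)
  have "(\<lambda>n. subst_tm (up \<sigma>') (up \<sigma> n)) = up (\<lambda>n. subst_tm \<sigma>' (\<sigma> n))"
    by (auto simp: fun_eq_iff subst_tm_up_lift split: nat.split)
  with AllN show ?case by simp
next
  case (AllS p)
  have "(\<lambda>X. upS \<rho>' (upS \<rho> X)) = upS (\<lambda>X. \<rho>' (\<rho> X))"
    by (auto simp: fun_eq_iff split: nat.split)
  with AllS show ?case by simp
qed (auto simp: subst_tm_subst_tm)

lemma up_V [simp]: "up V = V"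
  by (auto simp: fun_eq_iff lift_tm_def split: nat.split)

lemma upS_id [simp]: "upS (\<lambda>X. X) = (\<lambda>X. X)" "upS id = id"
  by (auto simp: fun_eq_iff split: nat.split)

lemma subst_V_id [simp]: "subst V id p = p"
  by (induction p) auto

lemma subst_instN: "subst \<sigma> \<rho> (instN t p) = instN (subst_tm \<sigma> t) (subst (up \<sigma>) \<rho> p)"
  unfolding instN_def subst_subst
  by (rule arg_cong[where f = "\<lambda>\<sigma>. subst \<sigma> _ p", THEN trans])
    (auto simp: fun_eq_iff lift_tm_def subst_tm_subst_tm split: nat.split)

lemma subst_instS: "subst \<sigma> \<rho> (instS X p) = instS (\<rho> X) (subst \<sigma> (upS \<rho>) p)"
  unfolding instS_def subst_subst
  by (rule arg_cong[where f = "\<lambda>\<rho>. subst _ \<rho> p", THEN trans])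
    (auto simp: fun_eq_iff split: nat.split)

lemma subst_liftN: "subst (up \<sigma>) \<rho> (liftN p) = liftN (subst \<sigma> \<rho> p)"
  by (simp add: liftN_def subst_subst lift_tm_def)

lemma subst_liftS: "subst \<sigma> (upS \<rho>) (liftS p) = liftS (subst \<sigma> \<rho> p)"
  by (simp add: liftS_def subst_subst)

text \<open>Bounds on the free variables: the bound itself is then a fresh variable of either sort.\<close>

primrec tm_below :: "nat \<Rightarrow> tm \<Rightarrow> bool" where
  "tm_below k (V n) = (n < k)"
| "tm_below k Zero = True"
| "tm_below k One = True"
| "tm_below k (s \<^bold>+ t) = (tm_below k s \<and> tm_below k t)"
| "tm_below k (s \<^bold>* t) = (tm_below k s \<and> tm_below k t)"

primrec below :: "nat \<Rightarrow> nat \<Rightarrow> fm \<Rightarrow> bool" where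
  "below k j (s \<^bold>= t) = (tm_below k s \<and> tm_below k t)"
| "below k j (s \<^bold>< t) = (tm_below k s \<and> tm_below k t)"
| "below k j (t \<^bold>\<in> X) = (tm_below k t \<and> X < j)"
| "below k j \<^bold>\<bottom> = True"
| "below k j (p \<^bold>\<longrightarrow> q) = (below k j p \<and> below k j q)"
| "below k j (AllN p) = below (Suc k) j p"
| "below k j (AllS p) = below k (Suc j) p"

lemma tm_below_mono: "tm_below k t \<Longrightarrow> k \<le> k' \<Longrightarrow> tm_below k' t"
  by (induction t) auto

lemma below_mono: "below k j p \<Longrightarrow> k \<le> k' \<Longrightarrow> j \<le> j' \<Longrightarrow> below k' j' p"
proof (induction p arbitrary: k j k' j')
  case (AllN p)
  then show ?case using AllN.IH[of "Suc k" j "Suc k'" j'] by simp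
next
  case (AllS p)
  then show ?case using AllS.IH[of k "Suc j" k' "Suc j'"] by simp
next
  case (Imp p q)
  then show ?case using Imp.IH(1)[of k j k' j'] Imp.IH(2)[of k j k' j'] by simp
qed (auto intro: tm_below_mono)

lemma ex_tm_below: "\<exists>k. tm_below k t"
proof (induction t)
  case (Add s t)
  then obtain k k' where "tm_below k s" "tm_below k' t" by blast
  then have "tm_below (max k k') (s \<^bold>+ t)" by (auto intro: tm_below_mono)
  then show ?case by blast
next
  case (Mul s t)
  then obtain k k' where "tm_below k s" "tm_below k' t" by blast
  then have "tm_below (max k k') (s \<^bold>* t)" by (auto intro: tm_below_mono)
  then show ?case by blast
qed auto

lemma ex_below: "\<exists>k. below k k p"
proof (induction p)
  case (Eq s t)
  obtain k k' where "tm_below k s" "tm_below k' t" using ex_tm_below by meson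
  then show ?case by (intro exI[of _ "max k k'"]) (auto intro: tm_below_mono)
next
  case (Less s t)
  obtain k k' where "tm_below k s" "tm_below k' t" using ex_tm_below by meson
  then show ?case by (intro exI[of _ "max k k'"]) (auto intro: tm_below_mono)
next
  case (Mem t X)
  obtain k where "tm_below k t" using ex_tm_below by meson
  then show ?case by (intro exI[of _ "max k (Suc X)"]) (auto intro: tm_below_mono)
next
  case (Imp p q)
  then obtain k k' where "below k k p" "below k' k' q" by blast
  then show ?case by (intro exI[of _ "max k k'"]) (auto intro: below_mono)
next
  case (AllN p)
  then show ?case by (meson below.simps(6) below_mono le_SucI order_refl)
next
  case (AllS p)
  then show ?case by (meson below.simps(7) below_mono le_SucI order_refl)
qed auto

lemma subst_tm_cong: "tm_below k t \<Longrightarrow> (\<And>n. n < k \<Longrightarrow> \<sigma> n = \<sigma>' n) \<Longrightarrow> subst_tm \<sigma> t = subst_tm \<sigma>' t"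
  by (induction t) auto

lemma subst_cong:
  "below k j p \<Longrightarrow> (\<And>n. n < k \<Longrightarrow> \<sigma> n = \<sigma>' n) \<Longrightarrow> (\<And>X. X < j \<Longrightarrow> \<rho> X = \<rho>' X)
    \<Longrightarrow> subst \<sigma> \<rho> p = subst \<sigma>' \<rho>' p"
proof (induction p arbitrary: k j \<sigma> \<sigma>' \<rho> \<rho>')
  case (AllN p)
  show ?case
    by simp (rule AllN.IH[of "Suc k" j], use AllN.prems in \<open>auto split: nat.split\<close>)
next
  case (AllS p)
  show ?case
    by simp (rule AllS.IH[of k "Suc j"], use AllS.prems in \<open>auto split: nat.split\<close>)
next
  case (Imp p q)
  show ?case
    using Imp.IH[of k j \<sigma> \<sigma>' \<rho> \<rho>'] Imp.prems by auto
qed (auto intro: subst_tm_cong)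


section \<open>Derivations\<close>

lemma prov_mono: "prov T G p \<Longrightarrow> G \<subseteq> G' \<Longrightarrow> prov T G' p"
proof (induction arbitrary: G' rule: prov.induct)
  case (AllNI G p)
  then show ?case by (meson image_mono prov.AllNI)
next
  case (AllSI G p)
  then show ?case by (meson image_mono prov.AllSI)
next
  case (ImpI p G q)
  then show ?case by (meson insert_mono prov.ImpI)
next
  case (Raa p G)
  then show ?case by (meson insert_mono prov.Raa)
next
  case (ImpE G p q)
  then show ?case using prov.ImpE by metis
next
  case (EqE G s t p)
  then show ?case using prov.EqE by metis
next
  case (AllNE G p t)
  then show ?case using prov.AllNE by metis
next
  case (AllSE G p X)
  then show ?case using prov.AllSE by metis
next
  case (Ax p G \<sigma> \<rho>)
  then show ?case by (simp add: prov.Ax)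
next
  case (Hyp p G)
  then show ?case using prov.Hyp by (metis subsetD)
next
  case (EqI G t)
  show ?case by (rule prov.EqI)
qed

text \<open>
  Needed for renaming variables in a derivation. The substitution has to be arbitrary in the
  induction, because it is lifted under each generalization.
\<close>

lemma prov_subst: "prov T G p \<Longrightarrow> prov T (subst \<sigma> \<rho> ` G) (subst \<sigma> \<rho> p)"
proof (induction arbitrary: \<sigma> \<rho> rule: prov.induct)
  case (Ax p G \<sigma>' \<rho>')
  then show ?case by (simp add: subst_subst prov.Ax)
next
  case (Hyp p G)
  then show ?case by (simp add: prov.Hyp)
next
  case (ImpI p G q)
  then show ?case by (simp add: prov.ImpI)
next
  case (ImpE G p q)
  then show ?case unfolding subst.simps using prov.ImpE by metis
next
  case (Raa p G)
  from Raa.IH[of \<sigma> \<rho>] show ?case by (simp add: prov.Raa)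
next
  case (AllNI G p)
  have "subst (up \<sigma>) \<rho> ` liftN ` G = liftN ` subst \<sigma> \<rho> ` G"
    by (simp add: image_image subst_liftN)
  with AllNI.IH[of "up \<sigma>" \<rho>] show ?case by (simp add: prov.AllNI)
next
  case (AllNE G p t)
  then show ?case by (simp add: subst_instN prov.AllNE)
next
  case (AllSI G p)
  have "subst \<sigma> (upS \<rho>) ` liftS ` G = liftS ` subst \<sigma> \<rho> ` G"
    by (simp add: image_image subst_liftS)
  with AllSI.IH[of \<sigma> "upS \<rho>"] show ?case by (simp add: prov.AllSI)
next
  case (AllSE G p X)
  then show ?case by (simp add: subst_instS prov.AllSE)
next
  case (EqI G t)
  then show ?case by (simp add: prov.EqI)
next
  case (EqE G s t p)
  from EqE.IH(1)[of \<sigma> \<rho>] EqE.IH(2)[of \<sigma> \<rho>] show ?case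
    unfolding subst_instN subst.simps by (rule prov.EqE)
qed

lemma prov_finite: "prov T G p \<Longrightarrow> \<exists>F. finite F \<and> F \<subseteq> G \<and> prov T F p"
proof (induction rule: prov.induct)
  case (Ax p G \<sigma> \<rho>)
  then show ?case by (meson empty_subsetI finite.emptyI prov.Ax)
next
  case (Hyp p G)
  then show ?case by (intro exI[of _ "{p}"]) (auto intro: prov.Hyp)
next
  case (ImpI p G q)
  then obtain F where "finite F" "F \<subseteq> insert p G" "prov T F q" by blast
  moreover from this have "prov T (insert p (F - {p})) q" by (auto elim: prov_mono)
  then have "prov T (F - {p}) (p \<^bold>\<longrightarrow> q)" by (rule prov.ImpI)
  ultimately show ?case by (intro exI[of _ "F - {p}"]) auto
next
  case (Raa p G)
  then obtain F where "finite F" "F \<subseteq> insert (\<^bold>\<not> p) G" "prov T F \<^bold>\<bottom>" by blast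
  moreover from this have "prov T (insert (\<^bold>\<not> p) (F - {\<^bold>\<not> p})) \<^bold>\<bottom>" by (auto elim: prov_mono)
  then have "prov T (F - {\<^bold>\<not> p}) p" by (rule prov.Raa)
  ultimately show ?case by (intro exI[of _ "F - {\<^bold>\<not> p}"]) auto
next
  case (ImpE G p q)
  then obtain F F' where F: "finite F" "F \<subseteq> G" "prov T F (p \<^bold>\<longrightarrow> q)"
    and F': "finite F'" "F' \<subseteq> G" "prov T F' p" by blast
  have "prov T (F \<union> F') (p \<^bold>\<longrightarrow> q)" "prov T (F \<union> F') p"
    using F(3) F'(3) by (auto elim: prov_mono)
  then have "prov T (F \<union> F') q" by (rule prov.ImpE)
  with F F' show ?case by (intro exI[of _ "F \<union> F'"]) auto
next
  case (EqE G s t p)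
  then obtain F F' where F: "finite F" "F \<subseteq> G" "prov T F (s \<^bold>= t)"
    and F': "finite F'" "F' \<subseteq> G" "prov T F' (instN s p)" by blast
  have "prov T (F \<union> F') (s \<^bold>= t)" "prov T (F \<union> F') (instN s p)"
    using F(3) F'(3) by (auto elim: prov_mono)
  then have "prov T (F \<union> F') (instN t p)" by (rule prov.EqE)
  with F F' show ?case by (intro exI[of _ "F \<union> F'"]) auto
next
  case (AllNI G p)
  then obtain F where "finite F" "F \<subseteq> liftN ` G" "prov T F p" by blast
  then show ?case by (metis finite_subset_image prov.AllNI)
next
  case (AllSI G p)
  then obtain F where "finite F" "F \<subseteq> liftS ` G" "prov T F p" by blast
  then show ?case by (metis finite_subset_image prov.AllSI)
next
  case (AllNE G p t)
  then show ?case using prov.AllNE by metis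
next
  case (AllSE G p X)
  then show ?case using prov.AllSE by metis
next
  case (EqI G t)
  show ?case by (rule exI[of _ "{}"]) (simp add: prov.EqI)
qed

lemma prov_cut: "prov T G p \<Longrightarrow> prov T (insert p G) q \<Longrightarrow> prov T G q"
  by (meson prov.ImpI prov.ImpE)

lemma prov_ex_falso: "prov T G \<^bold>\<bottom> \<Longrightarrow> prov T G p"
  by (meson prov.Raa prov_mono subset_insertI)

text \<open>
  Generalization over a variable that is fresh for the hypotheses: renaming this variable to
  the index 0 and shifting all others turns the derivation into a premise of the introduction
  rule.
\<close>

lemma prov_AllN_fresh:
  assumes pr: "prov T G (instN (V x) q)"
    and G: "\<And>g. g \<in> G \<Longrightarrow> below x x g" and q: "below (Suc x) x q"
  shows "prov T G (AllN q)"
proof (rule prov.AllNI)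
  define \<sigma> where "\<sigma> n = (if n = x then V 0 else V (Suc n))" for n
  have "subst \<sigma> id ` G = liftN ` G"
    unfolding liftN_def
    by (intro image_cong refl) (rule subst_cong, use G in \<open>auto simp: \<sigma>_def\<close>)
  moreover have "subst \<sigma> id (instN (V x) q) = subst V id q"
    unfolding instN_def subst_subst
    by (rule subst_cong[OF q]) (auto simp: \<sigma>_def split: nat.split)
  ultimately show "prov T (liftN ` G) q"
    using prov_subst[OF pr, of \<sigma> id] by simp
qed

lemma prov_AllS_fresh:
  assumes pr: "prov T G (instS x q)"
    and G: "\<And>g. g \<in> G \<Longrightarrow> below x x g" and q: "below x (Suc x) q"
  shows "prov T G (AllS q)"
proof (rule prov.AllSI)
  define \<rho> where "\<rho> n = (if n = x then 0 else Suc n)" for n :: nat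
  have "subst V \<rho> ` G = liftS ` G"
    unfolding liftS_def
    by (intro image_cong refl) (rule subst_cong, use G in \<open>auto simp: \<rho>_def\<close>)
  moreover have "subst V \<rho> (instS x q) = subst V id q"
    unfolding instS_def subst_subst
    by (rule subst_cong[OF q]) (auto simp: \<rho>_def split: nat.split)
  ultimately show "prov T (liftS ` G) q"
    using prov_subst[OF pr, of V \<rho>] by simp
qed


section \<open>Henkin theories\<close>

instance tm :: countable by countable_datatype
instance fm :: countable by countable_datatype

text \<open>
  Membership in such a theory commutes with all connectives and quantifiers. The witnesses of
  failing universal formulas are terms and set variables, so that the language does not have
  to be extended by constants.
\<close>

locale henkin =
  fixes T \<Gamma> :: "fm set"
  assumes deduct: "prov T \<Gamma> p \<Longrightarrow> p \<in> \<Gamma>"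
    and consistent: "\<^bold>\<bottom> \<notin> \<Gamma>"
    and complete: "p \<notin> \<Gamma> \<Longrightarrow> \<^bold>\<not> p \<in> \<Gamma>"
    and witnessN: "\<^bold>\<not> AllN q \<in> \<Gamma> \<Longrightarrow> \<exists>t. \<^bold>\<not> instN t q \<in> \<Gamma>"
    and witnessS: "\<^bold>\<not> AllS q \<in> \<Gamma> \<Longrightarrow> \<exists>X. \<^bold>\<not> instS X q \<in> \<Gamma>"

text \<open>
  One step of the construction of a Henkin theory. The set of hypotheses is kept finite, since
  only then a variable that is fresh for it can serve as witness; the axioms \<open>T\<close> are exempt,
  as all their substitution instances may be used.
\<close>

lemma henkin_step:
  assumes "finite G" and cons: "\<not> prov T G \<^bold>\<bottom>"
  shows "\<exists>G'. finite G' \<and> \<not> prov T G' \<^bold>\<bottom> \<and> G \<subseteq> G' \<and> (\<phi> \<in> G' \<or> prov T (insert \<phi> G) \<^bold>\<bottom>) \<and>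
    (\<forall>q. \<phi> = \<^bold>\<not> AllN q \<and> \<phi> \<in> G' \<longrightarrow> (\<exists>t. \<^bold>\<not> instN t q \<in> G')) \<and>
    (\<forall>q. \<phi> = \<^bold>\<not> AllS q \<and> \<phi> \<in> G' \<longrightarrow> (\<exists>X. \<^bold>\<not> instS X q \<in> G'))"
proof (cases "prov T (insert \<phi> G) \<^bold>\<bottom>")
  case True
  with assms show ?thesis
    by (intro exI[of _ G]) (auto dest: prov.Hyp simp: insert_absorb)
next
  case False
  \<comment> \<open>A variable that is fresh for the finitely many hypotheses collected so far.\<close>
  have "\<exists>x. \<forall>g\<in>insert \<phi> G. below x x g"
  proof -
    obtain b where b: "\<And>g. below (b g) (b g) g" using ex_below by metis
    have "below (Max (b ` insert \<phi> G)) (Max (b ` insert \<phi> G)) g" if "g \<in> insert \<phi> G" for g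
      using that \<open>finite G\<close> by (intro below_mono[OF b]) (auto intro!: Max_ge)
    then show ?thesis by blast
  qed
  then obtain x where x: "\<And>g. g \<in> insert \<phi> G \<Longrightarrow> below x x g" by blast
  consider q where "\<phi> = \<^bold>\<not> AllN q" | q where "\<phi> = \<^bold>\<not> AllS q"
    | "\<nexists>q. \<phi> = \<^bold>\<not> AllN q" "\<nexists>q. \<phi> = \<^bold>\<not> AllS q" by blast
  then show ?thesis
  proof cases
    case (1 q)
    have "\<not> prov T (insert (\<^bold>\<not> instN (V x) q) (insert \<phi> G)) \<^bold>\<bottom>"
    proof
      assume "prov T (insert (\<^bold>\<not> instN (V x) q) (insert \<phi> G)) \<^bold>\<bottom>"
      then have "prov T (insert \<phi> G) (instN (V x) q)" by (rule prov.Raa)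
      then have "prov T (insert \<phi> G) (AllN q)"
        by (rule prov_AllN_fresh) (use x[of \<phi>] x 1 in auto)
      moreover have "prov T (insert \<phi> G) (\<^bold>\<not> AllN q)" using 1 by (simp add: prov.Hyp)
      ultimately show False using False prov.ImpE by blast
    qed
    with 1 \<open>finite G\<close> show ?thesis
      by (intro exI[of _ "insert (\<^bold>\<not> instN (V x) q) (insert \<phi> G)"]) auto
  next
    case (2 q)
    have "\<not> prov T (insert (\<^bold>\<not> instS x q) (insert \<phi> G)) \<^bold>\<bottom>"
    proof
      assume "prov T (insert (\<^bold>\<not> instS x q) (insert \<phi> G)) \<^bold>\<bottom>"
      then have "prov T (insert \<phi> G) (instS x q)" by (rule prov.Raa)
      then have "prov T (insert \<phi> G) (AllS q)"
        by (rule prov_AllS_fresh) (use x[of \<phi>] x 2 in auto)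
      moreover have "prov T (insert \<phi> G) (\<^bold>\<not> AllS q)" using 2 by (simp add: prov.Hyp)
      ultimately show False using False prov.ImpE by blast
    qed
    with 2 \<open>finite G\<close> show ?thesis
      by (intro exI[of _ "insert (\<^bold>\<not> instS x q) (insert \<phi> G)"]) auto
  next
    case 3
    with False \<open>finite G\<close> show ?thesis by (intro exI[of _ "insert \<phi> G"]) auto
  qed
qed

lemma henkin_extension:
  assumes "finite G" "\<not> prov T G \<^bold>\<bottom>"
  shows "\<exists>\<Gamma>. G \<subseteq> \<Gamma> \<and> henkin T \<Gamma>"
proof -
  define P where "P G \<longleftrightarrow> finite G \<and> \<not> prov T G \<^bold>\<bottom>" for G
  define Q where "Q n G G' \<longleftrightarrow> G \<subseteq> G' \<and> (from_nat n \<in> G' \<or> prov T (insert (from_nat n) G) \<^bold>\<bottom>) \<and>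
    (\<forall>q. from_nat n = \<^bold>\<not> AllN q \<and> from_nat n \<in> G' \<longrightarrow> (\<exists>t. \<^bold>\<not> instN t q \<in> G')) \<and>
    (\<forall>q. from_nat n = \<^bold>\<not> AllS q \<and> from_nat n \<in> G' \<longrightarrow> (\<exists>X. \<^bold>\<not> instS X q \<in> G'))"
    for n and G G' :: "fm set"
  have "\<exists>F. F 0 = G \<and> (\<forall>n. P (F n) \<and> Q n (F n) (F (Suc n)))"
  proof -
    define nxt where "nxt n G = (SOME G'. P G' \<and> Q n G G')" for n G
    have nxt: "P (nxt n G) \<and> Q n G (nxt n G)" if "P G" for n G
      unfolding nxt_def
      using someI_ex[of "\<lambda>G'. P G' \<and> Q n G G'"] henkin_step[of G T "from_nat n"] that
      unfolding P_def Q_def by blast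
    define F where "F = rec_nat G nxt"
    have F: "F 0 = G" "\<And>n. F (Suc n) = nxt n (F n)" by (auto simp: F_def)
    have "P (F n)" for n
      by (induction n) (use assms nxt in \<open>auto simp: F P_def\<close>)
    with nxt F show ?thesis by metis
  qed
  then obtain F where F0: "F 0 = G" and P: "\<And>n. P (F n)" and Q: "\<And>n. Q n (F n) (F (Suc n))"
    by blast
  have mono: "F m \<subseteq> F n" if "m \<le> n" for m n
    using Q lift_Suc_mono_le[of F, OF _ that] unfolding Q_def by blast
  define \<Gamma> where "\<Gamma> = (\<Union>n. F n)"
  have fin: "\<exists>n. H \<subseteq> F n" if "finite H" "H \<subseteq> \<Gamma>" for H
    using that
  proof (induction H rule: finite_induct)
    case (insert h H)
    then obtain n m where "H \<subseteq> F n" "h \<in> F m" unfolding \<Gamma>_def by auto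
    then have "insert h H \<subseteq> F (max n m)" using mono[of n "max n m"] mono[of m "max n m"] by auto
    then show ?case by blast
  qed auto
  have cons: "\<not> prov T \<Gamma> \<^bold>\<bottom>"
    using prov_finite fin P prov_mono unfolding P_def by metis
  have compl: "p \<in> \<Gamma> \<or> prov T (insert p \<Gamma>) \<^bold>\<bottom>" for p
  proof -
    have "p \<in> F (Suc (to_nat p)) \<or> prov T (insert p (F (to_nat p))) \<^bold>\<bottom>"
      using Q[of "to_nat p"] unfolding Q_def by simp
    moreover have "insert p (F (to_nat p)) \<subseteq> insert p \<Gamma>" unfolding \<Gamma>_def by auto
    moreover have "p \<in> \<Gamma>" if "p \<in> F (Suc (to_nat p))" using that unfolding \<Gamma>_def by blast
    ultimately show ?thesis by (blast intro: prov_mono)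
  qed
  have deduct: "p \<in> \<Gamma>" if "prov T \<Gamma> p" for p
    using compl[of p] cons prov_cut[OF that] by blast
  have stage: "q \<in> F (Suc (to_nat q))" if q: "q \<in> \<Gamma>" for q
  proof -
    have "\<not> prov T (insert q (F (to_nat q))) \<^bold>\<bottom>"
    proof
      assume "prov T (insert q (F (to_nat q))) \<^bold>\<bottom>"
      then have "prov T \<Gamma> \<^bold>\<bottom>" by (rule prov_mono) (use q in \<open>auto simp: \<Gamma>_def\<close>)
      with cons show False ..
    qed
    then show ?thesis using Q[of "to_nat q"] unfolding Q_def by simp
  qed
  have "henkin T \<Gamma>"
  proof
    show "\<^bold>\<bottom> \<notin> \<Gamma>" using cons prov.Hyp by blast
    show "p \<in> \<Gamma>" if "prov T \<Gamma> p" for p using deduct that .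
    show "\<^bold>\<not> p \<in> \<Gamma>" if "p \<notin> \<Gamma>" for p
      using compl[of p] that by (auto intro: deduct prov.ImpI)
    show "\<exists>t. \<^bold>\<not> instN t q \<in> \<Gamma>" if "\<^bold>\<not> AllN q \<in> \<Gamma>" for q
      using stage[OF that] Q[of "to_nat (\<^bold>\<not> AllN q)"] unfolding Q_def \<Gamma>_def by auto
    show "\<exists>X. \<^bold>\<not> instS X q \<in> \<Gamma>" if "\<^bold>\<not> AllS q \<in> \<Gamma>" for q
      using stage[OF that] Q[of "to_nat (\<^bold>\<not> AllS q)"] unfolding Q_def \<Gamma>_def by auto
  qed
  moreover have "G \<subseteq> \<Gamma>" using F0 unfolding \<Gamma>_def by auto
  ultimately show ?thesis by blast
qed

section \<open>General models and completeness\<close>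

text \<open>
  General (Henkin) models: the set quantifiers range over the given collection \<open>sets\<close> only.
  The collection consists of genuine sets, so that membership needs no interpretation.
\<close>

record 'a interp =
  zr :: 'a
  un :: 'a
  ad :: "'a \<Rightarrow> 'a \<Rightarrow> 'a"
  mu :: "'a \<Rightarrow> 'a \<Rightarrow> 'a"
  ls :: "'a \<Rightarrow> 'a \<Rightarrow> bool"
  sets :: "'a set set"

primrec tval :: "('a, 'b) interp_scheme \<Rightarrow> (nat \<Rightarrow> 'a) \<Rightarrow> tm \<Rightarrow> 'a" where
  "tval M e (V n) = e n"
| "tval M e Zero = zr M"
| "tval M e One = un M"
| "tval M e (s \<^bold>+ t) = ad M (tval M e s) (tval M e t)"
| "tval M e (s \<^bold>* t) = mu M (tval M e s) (tval M e t)"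

primrec eval :: "('a, 'b) interp_scheme \<Rightarrow> (nat \<Rightarrow> 'a) \<Rightarrow> (nat \<Rightarrow> 'a set) \<Rightarrow> fm \<Rightarrow> bool" where
  "eval M e s (t \<^bold>= u) \<longleftrightarrow> tval M e t = tval M e u"
| "eval M e s (t \<^bold>< u) \<longleftrightarrow> ls M (tval M e t) (tval M e u)"
| "eval M e s (t \<^bold>\<in> X) \<longleftrightarrow> tval M e t \<in> s X"
| "eval M e s \<^bold>\<bottom> \<longleftrightarrow> False"
| "eval M e s (p \<^bold>\<longrightarrow> q) \<longleftrightarrow> (eval M e s p \<longrightarrow> eval M e s q)"
| "eval M e s (AllN p) \<longleftrightarrow> (\<forall>x. eval M (case_nat x e) s p)"
| "eval M e s (AllS p) \<longleftrightarrow> (\<forall>X\<in>sets M. eval M e (case_nat X s) p)"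

definition valid :: "('a, 'b) interp_scheme \<Rightarrow> fm \<Rightarrow> bool" where
  "valid M p \<longleftrightarrow> (\<forall>e s. range s \<subseteq> sets M \<longrightarrow> eval M e s p)"

text \<open>
  The defined connectives have to be rewritten before the primitive ones that they are made
  of.
\<close>

lemma eval_abbreviations:
  "eval M e s (p \<^bold>\<and> q) \<longleftrightarrow> eval M e s p \<and> eval M e s q"
  "eval M e s (p \<^bold>\<or> q) \<longleftrightarrow> eval M e s p \<or> eval M e s q"
  "eval M e s (p \<^bold>\<longleftrightarrow> q) \<longleftrightarrow> (eval M e s p \<longleftrightarrow> eval M e s q)"
  "eval M e s (ExN p) \<longleftrightarrow> (\<exists>x. eval M (case_nat x e) s p)"
  "eval M e s (ExS p) \<longleftrightarrow> (\<exists>X\<in>sets M. eval M e (case_nat X s) p)"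
  by auto

lemma tval_subst: "tval M e (subst_tm \<sigma> t) = tval M (\<lambda>n. tval M e (\<sigma> n)) t"
  by (induction t) auto

lemma tval_lift [simp]: "tval M (case_nat x e) (lift_tm t) = tval M e t"
  by (simp add: lift_tm_def tval_subst)

lemma eval_subst: "eval M e s (subst \<sigma> \<rho> p) = eval M (\<lambda>n. tval M e (\<sigma> n)) (\<lambda>X. s (\<rho> X)) p"
proof (induction p arbitrary: e s \<sigma> \<rho>)
  case (AllN p)
  have "(\<lambda>n. tval M (case_nat x e) (up \<sigma> n)) = case_nat x (\<lambda>n. tval M e (\<sigma> n))" for x
    by (auto simp: fun_eq_iff split: nat.split)
  with AllN show ?case by simp
next
  case (AllS p)
  have "(\<lambda>Y. case_nat X s (upS \<rho> Y)) = case_nat X (\<lambda>Y. s (\<rho> Y))" for X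
    by (auto simp: fun_eq_iff split: nat.split)
  with AllS show ?case by simp
qed (auto simp: tval_subst)

lemma eval_instN [simp]: "eval M e s (instN t p) = eval M (case_nat (tval M e t) e) s p"
  unfolding instN_def eval_subst
  by (rule arg_cong[where f = "\<lambda>e. eval M e s p", THEN trans[rotated]])
    (auto simp: fun_eq_iff split: nat.split)

lemma eval_liftS [simp]: "eval M e (case_nat X s) (liftS p) = eval M e s p"
  by (simp add: liftS_def eval_subst)

lemma eval_finitely_many [simp]:
  "eval M e s (finitely_many p) \<longleftrightarrow> (\<exists>k. \<forall>x. eval M (case_nat x e) s p \<longrightarrow> ls M x k)"
proof -
  have "(\<lambda>n. tval M (case_nat x (case_nat k e)) (case_nat (V 0) (\<lambda>n. V (Suc (Suc n))) n)) = case_nat x e"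
    for x k by (auto simp: fun_eq_iff split: nat.split)
  then show ?thesis by (simp add: finitely_many_def eval_subst)
qed

lemma eval_infinitely_many [simp]:
  "eval M e s (infinitely_many p) \<longleftrightarrow> (\<forall>k. \<exists>x. eval M (case_nat x e) s p \<and> \<not> ls M x k)"
  by (simp add: infinitely_many_def)

lemma eval_induction_axiom:
  "eval M e s (induction_axiom p) \<longleftrightarrow>
     (eval M (case_nat (zr M) e) s p \<and>
      (\<forall>x. eval M (case_nat x e) s p \<longrightarrow> eval M (case_nat (ad M x (un M)) e) s p) \<longrightarrow>
      (\<forall>x. eval M (case_nat x e) s p))"
proof -
  have "(\<lambda>n. tval M (case_nat x e) (case_nat (V 0 \<^bold>+ One) (\<lambda>n. V (Suc n)) n))
      = case_nat (ad M x (un M)) e" for x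
    by (auto simp: fun_eq_iff split: nat.split)
  then show ?thesis
    unfolding induction_axiom_def eval_abbreviations by (simp add: eval_subst flip: id_def) blast
qed

lemma eval_comprehension_axiom:
  "eval M e s (comprehension_axiom p) \<longleftrightarrow> (\<exists>X\<in>sets M. X = {x. eval M (case_nat x e) s p})"
  unfolding comprehension_axiom_def eval_abbreviations(5) eval.simps(6) eval_abbreviations(3)
  by (simp add: set_eq_iff)

context henkin
begin

lemma mem_imp [simp]: "(p \<^bold>\<longrightarrow> q) \<in> \<Gamma> \<longleftrightarrow> (p \<in> \<Gamma> \<longrightarrow> q \<in> \<Gamma>)"
proof
  assume "(p \<^bold>\<longrightarrow> q) \<in> \<Gamma>"
  then show "p \<in> \<Gamma> \<longrightarrow> q \<in> \<Gamma>" by (meson deduct prov.Hyp prov.ImpE)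
next
  assume *: "p \<in> \<Gamma> \<longrightarrow> q \<in> \<Gamma>"
  show "(p \<^bold>\<longrightarrow> q) \<in> \<Gamma>"
  proof (cases "p \<in> \<Gamma>")
    case True
    with * have "prov T (insert p \<Gamma>) q" by (simp add: prov.Hyp)
    then show ?thesis by (simp add: deduct prov.ImpI)
  next
    case False
    then have "(\<^bold>\<not> p) \<in> \<Gamma>" by (rule complete)
    then have "prov T (insert p \<Gamma>) \<^bold>\<bottom>" by (meson insertI1 insertI2 prov.Hyp prov.ImpE)
    then show ?thesis by (simp add: deduct prov.ImpI prov_ex_falso)
  qed
qed

lemma mem_bot [simp]: "\<^bold>\<bottom> \<notin> \<Gamma>"
  by (rule consistent)

lemma mem_AllN [simp]: "AllN p \<in> \<Gamma> \<longleftrightarrow> (\<forall>t. instN t p \<in> \<Gamma>)"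
proof
  show "\<forall>t. instN t p \<in> \<Gamma>" if "AllN p \<in> \<Gamma>" using that by (meson deduct prov.Hyp prov.AllNE)
  show "AllN p \<in> \<Gamma>" if *: "\<forall>t. instN t p \<in> \<Gamma>"
    using witnessN[of p] * complete[of "AllN p"] by auto
qed

lemma mem_AllS [simp]: "AllS p \<in> \<Gamma> \<longleftrightarrow> (\<forall>X. instS X p \<in> \<Gamma>)"
proof
  show "\<forall>X. instS X p \<in> \<Gamma>" if "AllS p \<in> \<Gamma>" using that by (meson deduct prov.Hyp prov.AllSE)
  show "AllS p \<in> \<Gamma>" if *: "\<forall>X. instS X p \<in> \<Gamma>"
    using witnessS[of p] * complete[of "AllS p"] by auto
qed

lemma mem_axiom: "p \<in> T \<Longrightarrow> subst \<sigma> \<rho> p \<in> \<Gamma>"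
  by (simp add: deduct prov.Ax)

lemma eq_refl: "(t \<^bold>= t) \<in> \<Gamma>"
  by (simp add: deduct prov.EqI)

lemma eq_replace: "(s \<^bold>= t) \<in> \<Gamma> \<Longrightarrow> instN s p \<in> \<Gamma> \<Longrightarrow> instN t p \<in> \<Gamma>"
  by (meson deduct prov.Hyp prov.EqE)

lemma instN_lift [simp]: "subst_tm (case_nat t V) (lift_tm u) = u"
  by (simp add: lift_tm_def subst_tm_subst_tm)

lemma eq_sym: "(s \<^bold>= t) \<in> \<Gamma> \<Longrightarrow> (t \<^bold>= s) \<in> \<Gamma>"
  using eq_replace[of s t "V 0 \<^bold>= lift_tm s"] by (simp add: instN_def eq_refl)

lemma eq_trans: "(s \<^bold>= t) \<in> \<Gamma> \<Longrightarrow> (t \<^bold>= u) \<in> \<Gamma> \<Longrightarrow> (s \<^bold>= u) \<in> \<Gamma>"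
  using eq_replace[of t u "lift_tm s \<^bold>= V 0"] by (simp add: instN_def)

lemma eq_add:
  assumes "(s \<^bold>= s') \<in> \<Gamma>" "(t \<^bold>= t') \<in> \<Gamma>"
  shows "(s \<^bold>+ t \<^bold>= s' \<^bold>+ t') \<in> \<Gamma>"
  using eq_replace[OF assms(1), of "lift_tm (s \<^bold>+ t) \<^bold>= V 0 \<^bold>+ lift_tm t"]
    eq_replace[OF assms(2), of "lift_tm (s \<^bold>+ t) \<^bold>= lift_tm s' \<^bold>+ V 0"]
  by (simp add: instN_def eq_refl)

lemma eq_mult:
  assumes "(s \<^bold>= s') \<in> \<Gamma>" "(t \<^bold>= t') \<in> \<Gamma>"
  shows "(s \<^bold>* t \<^bold>= s' \<^bold>* t') \<in> \<Gamma>"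
  using eq_replace[OF assms(1), of "lift_tm (s \<^bold>* t) \<^bold>= V 0 \<^bold>* lift_tm t"]
    eq_replace[OF assms(2), of "lift_tm (s \<^bold>* t) \<^bold>= lift_tm s' \<^bold>* V 0"]
  by (simp add: instN_def eq_refl)

lemma eq_less:
  assumes "(s \<^bold>= s') \<in> \<Gamma>" "(t \<^bold>= t') \<in> \<Gamma>" "(s \<^bold>< t) \<in> \<Gamma>"
  shows "(s' \<^bold>< t') \<in> \<Gamma>"
  using eq_replace[OF assms(1), of "V 0 \<^bold>< lift_tm t"]
    eq_replace[OF assms(2), of "lift_tm s' \<^bold>< V 0"] assms(3)
  by (simp add: instN_def)

lemma eq_mem:
  assumes "(s \<^bold>= s') \<in> \<Gamma>" "(s \<^bold>\<in> X) \<in> \<Gamma>"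
  shows "(s' \<^bold>\<in> X) \<in> \<Gamma>"
  using eq_replace[OF assms(1), of "V 0 \<^bold>\<in> X"] assms(2)
  by (simp add: instN_def)

text \<open>
  The basic axioms make the successor an injection that misses zero, so that there are
  infinitely many classes of provably equal terms; they can be indexed by any countably
  infinite type.
\<close>

lemma ex_class_map:
  assumes T: "basic_axioms \<subseteq> T" and inf: "infinite (UNIV :: 'a::countable set)"
  shows "\<exists>c :: tm \<Rightarrow> 'a. surj c \<and> (\<forall>s t. c s = c t \<longleftrightarrow> (s \<^bold>= t) \<in> \<Gamma>)"
proof -
  define rep where "rep t = (SOME s. (t \<^bold>= s) \<in> \<Gamma>)" for t
  have rep: "(t \<^bold>= rep t) \<in> \<Gamma>" for t
    unfolding rep_def by (rule someI[of _ t]) (rule eq_refl)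
  have rep_eq: "rep s = rep t \<longleftrightarrow> (s \<^bold>= t) \<in> \<Gamma>" for s t
  proof
    show "(s \<^bold>= t) \<in> \<Gamma>" if "rep s = rep t" using eq_trans[OF rep[of s]] eq_sym[OF rep[of t]] that by simp
    show "rep s = rep t" if "(s \<^bold>= t) \<in> \<Gamma>"
    proof -
      have "(s \<^bold>= u) \<in> \<Gamma> \<longleftrightarrow> (t \<^bold>= u) \<in> \<Gamma>" for u
        using eq_trans[OF that] eq_trans[OF eq_sym[OF that]] by blast
      then show ?thesis by (simp add: rep_def)
    qed
  qed
  have suc_inj: "(s \<^bold>= t) \<in> \<Gamma>" if "(s \<^bold>+ One \<^bold>= t \<^bold>+ One) \<in> \<Gamma>" for s t
  proof -
    have "(V 0 \<^bold>+ One \<^bold>= V 1 \<^bold>+ One \<^bold>\<longrightarrow> V 0 \<^bold>= V 1) \<in> T"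
      using T by (simp add: basic_axioms_def)
    from mem_axiom[OF this, of "case_nat s (\<lambda>_. t)" id] that show ?thesis by simp
  qed
  have suc_zero: "(s \<^bold>+ One \<^bold>= Zero) \<notin> \<Gamma>" for s
  proof -
    have "(\<^bold>\<not> (V 0 \<^bold>+ One \<^bold>= Zero)) \<in> T"
      using T by (simp add: basic_axioms_def)
    from mem_axiom[OF this, of "\<lambda>_. s" id] show ?thesis by simp
  qed
  have "infinite (range rep)"
  proof
    assume fin: "finite (range rep)"
    define f where "f t = rep (t \<^bold>+ One)" for t
    have "inj_on f (range rep)"
    proof (rule inj_onI)
      fix s t assume st: "s \<in> range rep" "t \<in> range rep" "f s = f t"
      then have "(s \<^bold>= t) \<in> \<Gamma>" by (simp add: f_def rep_eq suc_inj)
      moreover obtain s' t' where s't': "s = rep s'" "t = rep t'" using st by blast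
      ultimately have "(s' \<^bold>= t') \<in> \<Gamma>"
        using eq_trans[OF eq_trans[OF rep[of s']] eq_sym[OF rep[of t']]] by simp
      with s't' show "s = t" by (simp add: rep_eq)
    qed
    moreover have "f ` range rep \<subseteq> range rep" by (auto simp: f_def)
    ultimately have "f ` range rep = range rep" using fin by (intro endo_inj_surj)
    then obtain t where "rep Zero = f t" by blast
    then have "(t \<^bold>+ One \<^bold>= Zero) \<in> \<Gamma>" by (metis f_def rep_eq)
    with suc_zero show False by blast
  qed
  then obtain h where h: "bij_betw h (range rep) (UNIV :: nat set)"
    using to_nat_on_infinite[of "range rep"] by (auto intro: countable_image)
  obtain g where g: "bij_betw g (UNIV :: nat set) (UNIV :: 'a set)"
    using bij_betw_from_nat_into[OF countableI_type inf] by blast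
  define c where "c t = g (h (rep t))" for t
  have "c s = c t \<longleftrightarrow> (s \<^bold>= t) \<in> \<Gamma>" for s t
  proof -
    have "c s = c t \<longleftrightarrow> h (rep s) = h (rep t)"
      using g unfolding c_def bij_betw_def inj_on_def by auto
    also have "\<dots> \<longleftrightarrow> rep s = rep t"
      using h unfolding bij_betw_def inj_on_def by auto
    finally show ?thesis by (simp add: rep_eq)
  qed
  moreover have "surj c"
  proof -
    have "range c = g ` h ` range rep" by (auto simp: c_def)
    also have "\<dots> = UNIV" using g h by (simp add: bij_betw_def)
    finally show ?thesis .
  qed
  ultimately show ?thesis by blast
qed

text \<open>
  The term model. Sets are interpreted by the sets of (classes of) terms that the theory puts
  into a set variable, so that the set quantifiers range over what the set variables denote.
\<close>

lemma ex_term_model: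
  assumes T: "basic_axioms \<subseteq> T" and inf: "infinite (UNIV :: 'a::countable set)"
  shows "\<exists>M :: 'a interp. sets M \<noteq> {} \<and> (\<forall>p\<in>T. valid M p) \<and>
    (\<forall>p\<in>\<Gamma>. \<exists>e s. range s \<subseteq> sets M \<and> eval M e s p)"
proof -
  from ex_class_map[OF assms] obtain c :: "tm \<Rightarrow> 'a"
    where surj: "surj c" and c: "\<And>s t. c s = c t \<longleftrightarrow> (s \<^bold>= t) \<in> \<Gamma>" by blast
  define r where "r = inv c"
  have cr: "c (r x) = x" for x using surj by (simp add: r_def surj_f_inv_f)
  have rc: "(r (c t) \<^bold>= t) \<in> \<Gamma>" for t using c cr by blast
  define ext where "ext X = {c t | t. (t \<^bold>\<in> X) \<in> \<Gamma>}" for X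
  define M where "M = \<lparr>zr = c Zero, un = c One, ad = \<lambda>x y. c (r x \<^bold>+ r y), mu = \<lambda>x y. c (r x \<^bold>* r y),
    ls = \<lambda>x y. (r x \<^bold>< r y) \<in> \<Gamma>, sets = range ext\<rparr>"
  have M: "zr M = c Zero" "un M = c One" "ad M (c s) (c t) = c (s \<^bold>+ t)"
    "mu M (c s) (c t) = c (s \<^bold>* t)" "ls M (c s) (c t) \<longleftrightarrow> (s \<^bold>< t) \<in> \<Gamma>" "sets M = range ext" for s t
    using rc[of s] rc[of t] by (auto simp: M_def c eq_add eq_mult intro: eq_less dest: eq_sym)
  have mem: "c t \<in> ext X \<longleftrightarrow> (t \<^bold>\<in> X) \<in> \<Gamma>" for t X
  proof
    assume "c t \<in> ext X"
    then obtain u where "(t \<^bold>= u) \<in> \<Gamma>" "(u \<^bold>\<in> X) \<in> \<Gamma>" by (auto simp: ext_def c)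
    then show "(t \<^bold>\<in> X) \<in> \<Gamma>" by (blast intro: eq_mem eq_sym)
  qed (auto simp: ext_def)
  have tv: "tval M (\<lambda>n. c (\<sigma> n)) t = c (subst_tm \<sigma> t)" for \<sigma> t
    by (induction t) (auto simp: M)
  have truth: "eval M (\<lambda>n. c (\<sigma> n)) (\<lambda>X. ext (\<rho> X)) p \<longleftrightarrow> subst \<sigma> \<rho> p \<in> \<Gamma>" for \<sigma> \<rho> p
  proof (induction p arbitrary: \<sigma> \<rho>)
    case (AllN p)
    have "eval M (\<lambda>n. c (\<sigma> n)) (\<lambda>X. ext (\<rho> X)) (AllN p) \<longleftrightarrow>
        (\<forall>t. eval M (case_nat (c t) (\<lambda>n. c (\<sigma> n))) (\<lambda>X. ext (\<rho> X)) p)"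
      using surj by (simp add: surj_def) metis
    also have "\<dots> \<longleftrightarrow> (\<forall>t. eval M (\<lambda>n. c (case_nat t \<sigma> n)) (\<lambda>X. ext (\<rho> X)) p)"
    proof -
      have "case_nat (c t) (\<lambda>n. c (\<sigma> n)) = (\<lambda>n. c (case_nat t \<sigma> n))" for t
        by (auto simp: fun_eq_iff split: nat.split)
      then show ?thesis by simp
    qed
    also have "\<dots> \<longleftrightarrow> (\<forall>t. subst (case_nat t \<sigma>) \<rho> p \<in> \<Gamma>)" using AllN by blast
    also have "\<dots> \<longleftrightarrow> (\<forall>t. instN t (subst (up \<sigma>) \<rho> p) \<in> \<Gamma>)"
    proof -
      have "(\<lambda>n. subst_tm (case_nat t V) (up \<sigma> n)) = case_nat t \<sigma>" for t
        by (auto simp: fun_eq_iff split: nat.split)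
      then show ?thesis by (simp add: instN_def subst_subst)
    qed
    finally show ?case by simp
  next
    case (AllS p)
    have "eval M (\<lambda>n. c (\<sigma> n)) (\<lambda>X. ext (\<rho> X)) (AllS p) \<longleftrightarrow>
        (\<forall>Y. eval M (\<lambda>n. c (\<sigma> n)) (case_nat (ext Y) (\<lambda>X. ext (\<rho> X))) p)"
      by (simp add: M)
    also have "\<dots> \<longleftrightarrow> (\<forall>Y. eval M (\<lambda>n. c (\<sigma> n)) (\<lambda>X. ext (case_nat Y \<rho> X)) p)"
    proof -
      have "case_nat (ext Y) (\<lambda>X. ext (\<rho> X)) = (\<lambda>X. ext (case_nat Y \<rho> X))" for Y
        by (auto simp: fun_eq_iff split: nat.split)
      then show ?thesis by simp
    qed
    also have "\<dots> \<longleftrightarrow> (\<forall>Y. subst \<sigma> (case_nat Y \<rho>) p \<in> \<Gamma>)" using AllS by blast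
    also have "\<dots> \<longleftrightarrow> (\<forall>Y. instS Y (subst \<sigma> (upS \<rho>) p) \<in> \<Gamma>)"
    proof -
      have "(\<lambda>X. case_nat Y id (upS \<rho> X)) = case_nat Y \<rho>" for Y
        by (auto simp: fun_eq_iff split: nat.split)
      then show ?thesis by (simp add: instS_def subst_subst)
    qed
    finally show ?case by simp
  qed (auto simp: tv c M mem)
  have "valid M p" if "p \<in> T" for p
    unfolding valid_def
  proof (intro allI impI)
    fix e :: "nat \<Rightarrow> 'a" and s :: "nat \<Rightarrow> 'a set" assume "range s \<subseteq> sets M"
    then have "\<forall>X. \<exists>Y. s X = ext Y" by (auto simp: M)
    then obtain \<rho> where "s = (\<lambda>X. ext (\<rho> X))" by metis
    moreover have "e = (\<lambda>n. c (r (e n)))" by (simp add: cr)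
    ultimately show "eval M e s p" using truth mem_axiom[OF that] by metis
  qed
  moreover have "\<exists>e s. range s \<subseteq> sets M \<and> eval M e s p" if "p \<in> \<Gamma>" for p
    by (rule exI[of _ "\<lambda>n. c (V n)"], rule exI[of _ "\<lambda>X. ext (id X)"])
      (use that in \<open>auto simp: truth M simp del: id_apply\<close>)
  moreover have "sets M \<noteq> {}" by (simp add: M)
  ultimately show ?thesis by blast
qed

end

text \<open>
  The type \<open>'a\<close> is arbitrary: models on one countably infinite type suffice for theories that
  contain the basic axioms.
\<close>

theorem completeness:
  assumes "basic_axioms \<subseteq> T" "infinite (UNIV :: 'a::countable set)"
    and "\<And>M :: 'a interp. sets M \<noteq> {} \<Longrightarrow> (\<And>q. q \<in> T \<Longrightarrow> valid M q) \<Longrightarrow> valid M p"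
  shows "T \<turnstile> p"
proof (rule ccontr)
  assume "\<not> (T \<turnstile> p)"
  then have "\<not> prov T {\<^bold>\<not> p} \<^bold>\<bottom>" unfolding proves_def by (meson prov.Raa)
  then obtain \<Gamma> where \<Gamma>: "{\<^bold>\<not> p} \<subseteq> \<Gamma>" "henkin T \<Gamma>"
    using henkin_extension[of "{\<^bold>\<not> p}" T] by blast
  obtain M :: "'a interp" where "sets M \<noteq> {}" "\<And>q. q \<in> T \<Longrightarrow> valid M q"
    and "\<exists>e s. range s \<subseteq> sets M \<and> eval M e s (\<^bold>\<not> p)"
    using henkin.ex_term_model[OF \<Gamma>(2) assms(1,2)] \<Gamma>(1) by blast
  with assms(3)[of M] show False by (auto simp: valid_def)
qed

section \<open>Definable predicates\<close>

text \<open>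
  A predicate on environments is definable by a class of formulas if it is the truth of such a
  formula whose number variables are filled either with entries of the environment or with
  parameters, and whose set variables are filled with sets of the model. Environments stand
  for the bound variables of a formula, so that definability of a concrete relation can be
  shown by resolution with closure rules that follow the shape of its HOL definition.
\<close>

definition fill :: "(nat \<Rightarrow> 'a + nat) \<Rightarrow> (nat \<Rightarrow> 'a) \<Rightarrow> nat \<Rightarrow> 'a" where
  "fill f e n = (case f n of Inl a \<Rightarrow> a | Inr k \<Rightarrow> e k)"

definition definable :: "(fm \<Rightarrow> bool) \<Rightarrow> 'a interp \<Rightarrow> ((nat \<Rightarrow> 'a) \<Rightarrow> bool) \<Rightarrow> bool" where
  "definable \<Phi> M R \<longleftrightarrow>
     (\<exists>p f s. \<Phi> p \<and> range s \<subseteq> sets M \<and> (\<forall>e. R e \<longleftrightarrow> eval M (fill f e) s p))"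

definition term_definable :: "'a interp \<Rightarrow> ((nat \<Rightarrow> 'a) \<Rightarrow> 'a) \<Rightarrow> bool" where
  "term_definable M T \<longleftrightarrow> (\<exists>t f. \<forall>e. T e = tval M (fill f e) t)"

abbreviation rename :: "(nat \<Rightarrow> nat) \<Rightarrow> (nat \<Rightarrow> nat) \<Rightarrow> fm \<Rightarrow> fm" where
  "rename g h \<equiv> subst (\<lambda>n. V (g n)) h"

lemma eval_rename: "eval M e s (rename g h p) \<longleftrightarrow> eval M (\<lambda>n. e (g n)) (\<lambda>X. s (h X)) p"
  by (simp add: eval_subst)

lemma tval_rename: "tval M e (subst_tm (\<lambda>n. V (g n)) t) = tval M (\<lambda>n. e (g n)) t"
  by (simp add: tval_subst)

definition interleave :: "(nat \<Rightarrow> 'b) \<Rightarrow> (nat \<Rightarrow> 'b) \<Rightarrow> nat \<Rightarrow> 'b" where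
  "interleave f g n = (if even n then f (n div 2) else g (n div 2))"

lemma interleave_simps [simp]: "interleave f g (2 * n) = f n" "interleave f g (Suc (2 * n)) = g n"
  by (simp_all add: interleave_def)

lemma fill_interleave [simp]:
  "fill (interleave f g) e (2 * n) = fill f e n"
  "fill (interleave f g) e (Suc (2 * n)) = fill g e n"
  by (simp_all add: fill_def)

lemma range_interleave: "range (interleave f g) \<subseteq> A \<longleftrightarrow> range f \<subseteq> A \<and> range g \<subseteq> A"
proof
  assume *: "range (interleave f g) \<subseteq> A"
  have "f n \<in> A" "g n \<in> A" for n
    using *[THEN subsetD, OF rangeI, of "2 * n"] *[THEN subsetD, OF rangeI, of "Suc (2 * n)"] by simp_all
  then show "range f \<subseteq> A \<and> range g \<subseteq> A" by blast
qed (auto simp: interleave_def)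

lemma term_definable_const: "term_definable M (\<lambda>e. a)"
  unfolding term_definable_def
  by (intro exI[of _ "V 0"] exI[of _ "\<lambda>_. Inl a"]) (simp add: fill_def)

lemma term_definable_var: "term_definable M (\<lambda>e. e k)"
  unfolding term_definable_def
  by (intro exI[of _ "V 0"] exI[of _ "\<lambda>_. Inr k"]) (simp add: fill_def)

lemma term_definable_ad:
  assumes "term_definable M S" "term_definable M T"
  shows "term_definable M (\<lambda>e. ad M (S e) (T e))"
proof -
  from assms obtain s f t g where "\<And>e. S e = tval M (fill f e) s" "\<And>e. T e = tval M (fill g e) t"
    unfolding term_definable_def by metis
  then show ?thesis
    unfolding term_definable_def
    by (intro exI[of _ "subst_tm (\<lambda>n. V (2 * n)) s \<^bold>+ subst_tm (\<lambda>n. V (Suc (2 * n))) t"]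
        exI[of _ "interleave f g"]) (simp add: tval_rename)
qed

lemma term_definable_mu:
  assumes "term_definable M S" "term_definable M T"
  shows "term_definable M (\<lambda>e. mu M (S e) (T e))"
proof -
  from assms obtain s f t g where "\<And>e. S e = tval M (fill f e) s" "\<And>e. T e = tval M (fill g e) t"
    unfolding term_definable_def by metis
  then show ?thesis
    unfolding term_definable_def
    by (intro exI[of _ "subst_tm (\<lambda>n. V (2 * n)) s \<^bold>* subst_tm (\<lambda>n. V (Suc (2 * n))) t"]
        exI[of _ "interleave f g"]) (simp add: tval_rename)
qed

text \<open>Entries of the environment that become bound by a quantifier are moved to index 0.\<close>

lemma eval_bind:
  "eval M (fill f (case_nat x e)) s p \<longleftrightarrow>
   eval M (case_nat x (fill (\<lambda>n. case f n of Inl a \<Rightarrow> Inl a | Inr k \<Rightarrow> Inr (k - 1)) e)) s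
     (rename (\<lambda>n. if f n = Inr 0 then 0 else Suc n) id p)"
proof -
  have "fill f (case_nat x e) = (\<lambda>n. case_nat x (fill (\<lambda>n. case f n of Inl a \<Rightarrow> Inl a | Inr k \<Rightarrow> Inr (k - 1)) e)
      (if f n = Inr 0 then 0 else Suc n))"
    by (auto simp: fun_eq_iff fill_def split: sum.split nat.split)
  then show ?thesis by (simp add: eval_rename)
qed

locale formula_class =
  fixes \<Phi> :: "fm \<Rightarrow> bool"
  assumes subst: "\<Phi> p \<Longrightarrow> \<Phi> (subst \<sigma> \<rho> p)"
    and atoms: "\<Phi> (t \<^bold>= u)" "\<Phi> (t \<^bold>< u)" "\<Phi> (t \<^bold>\<in> X)" "\<Phi> \<^bold>\<bottom>"
    and imp: "\<Phi> p \<Longrightarrow> \<Phi> q \<Longrightarrow> \<Phi> (p \<^bold>\<longrightarrow> q)"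
    and bounded: "\<Phi> p \<Longrightarrow> \<Phi> (AllN (V 0 \<^bold>< lift_tm t \<^bold>\<longrightarrow> p))"
begin

lemma definable_pair:
  assumes "definable \<Phi> M R" "definable \<Phi> M S"
  obtains p q f s where "\<Phi> p" "\<Phi> q" "range s \<subseteq> sets M"
    "\<And>e. R e \<longleftrightarrow> eval M (fill f e) s p" "\<And>e. S e \<longleftrightarrow> eval M (fill f e) s q"
proof -
  from assms obtain p f s q g r where *: "\<Phi> p" "\<Phi> q" "range s \<subseteq> sets M" "range r \<subseteq> sets M"
    "\<And>e. R e \<longleftrightarrow> eval M (fill f e) s p" "\<And>e. S e \<longleftrightarrow> eval M (fill g e) r q"
    unfolding definable_def by metis
  show thesis
    by (rule that[of "rename (\<lambda>n. 2 * n) (\<lambda>n. 2 * n) p" "rename (\<lambda>n. Suc (2 * n)) (\<lambda>n. Suc (2 * n)) q"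
          "interleave s r" "interleave f g"])
      (use * in \<open>auto simp: eval_rename range_interleave subst\<close>)
qed

lemma definable_imp:
  assumes "definable \<Phi> M R" "definable \<Phi> M S"
  shows "definable \<Phi> M (\<lambda>e. R e \<longrightarrow> S e)"
proof -
  obtain p q f s where "\<Phi> p" "\<Phi> q" "range s \<subseteq> sets M"
    "\<And>e. R e \<longleftrightarrow> eval M (fill f e) s p" "\<And>e. S e \<longleftrightarrow> eval M (fill f e) s q"
    using definable_pair[OF assms] by metis
  then show ?thesis
    unfolding definable_def
    by (intro exI[of _ "p \<^bold>\<longrightarrow> q"] exI[of _ f] exI[of _ s]) (auto simp: imp)
qed

lemma definable_const:
  assumes "sets M \<noteq> {}"
  shows "definable \<Phi> M (\<lambda>e. P)"
proof -
  from assms obtain X where "X \<in> sets M" by blast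
  then show ?thesis
    unfolding definable_def
    by (intro exI[of _ "if P then \<^bold>\<bottom> \<^bold>\<longrightarrow> \<^bold>\<bottom> else \<^bold>\<bottom>"] exI[of _ "\<lambda>_. Inr 0"] exI[of _ "\<lambda>_. X"])
      (auto simp: atoms imp)
qed

lemma definable_eq:
  assumes "sets M \<noteq> {}" "term_definable M S" "term_definable M T"
  shows "definable \<Phi> M (\<lambda>e. S e = T e)"
proof -
  from assms obtain s f t g X where "X \<in> sets M"
    "\<And>e. S e = tval M (fill f e) s" "\<And>e. T e = tval M (fill g e) t"
    unfolding term_definable_def by blast
  then show ?thesis
    unfolding definable_def
    by (intro exI[of _ "subst_tm (\<lambda>n. V (2 * n)) s \<^bold>= subst_tm (\<lambda>n. V (Suc (2 * n))) t"]
        exI[of _ "interleave f g"] exI[of _ "\<lambda>_. X"]) (auto simp: tval_rename atoms)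
qed

lemma definable_ls:
  assumes "sets M \<noteq> {}" "term_definable M S" "term_definable M T"
  shows "definable \<Phi> M (\<lambda>e. ls M (S e) (T e))"
proof -
  from assms obtain s f t g X where "X \<in> sets M"
    "\<And>e. S e = tval M (fill f e) s" "\<And>e. T e = tval M (fill g e) t"
    unfolding term_definable_def by blast
  then show ?thesis
    unfolding definable_def
    by (intro exI[of _ "subst_tm (\<lambda>n. V (2 * n)) s \<^bold>< subst_tm (\<lambda>n. V (Suc (2 * n))) t"]
        exI[of _ "interleave f g"] exI[of _ "\<lambda>_. X"]) (auto simp: tval_rename atoms)
qed

lemma definable_mem:
  assumes "X \<in> sets M" "term_definable M T"
  shows "definable \<Phi> M (\<lambda>e. T e \<in> X)"
proof -
  from assms obtain t f where "\<And>e. T e = tval M (fill f e) t"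
    unfolding term_definable_def by blast
  with assms show ?thesis
    unfolding definable_def
    by (intro exI[of _ "t \<^bold>\<in> 0"] exI[of _ f] exI[of _ "\<lambda>_. X"]) (auto simp: atoms)
qed

lemma definable_not: "definable \<Phi> M R \<Longrightarrow> definable \<Phi> M (\<lambda>e. \<not> R e)"
proof -
  assume R: "definable \<Phi> M R"
  then have "sets M \<noteq> {}" unfolding definable_def by blast
  from definable_imp[OF R definable_const[OF this, of False]] show ?thesis by simp
qed

lemma definable_conj:
  "definable \<Phi> M R \<Longrightarrow> definable \<Phi> M S \<Longrightarrow> definable \<Phi> M (\<lambda>e. R e \<and> S e)"
  using definable_not[OF definable_imp[OF _ definable_not], of M R S] by simp

lemma definable_disj:
  "definable \<Phi> M R \<Longrightarrow> definable \<Phi> M S \<Longrightarrow> definable \<Phi> M (\<lambda>e. R e \<or> S e)"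
  using definable_imp[OF definable_not, of M R S] by (simp add: disj_imp)

lemma definable_iff:
  "definable \<Phi> M R \<Longrightarrow> definable \<Phi> M S \<Longrightarrow> definable \<Phi> M (\<lambda>e. R e \<longleftrightarrow> S e)"
  using definable_conj[OF definable_imp[of M R S] definable_imp[of M S R]]
  by (simp add: iff_conv_conj_imp)

text \<open>The parameters of the formula and of all the terms share the number variables by pairing.\<close>

lemma definable_subst:
  assumes "definable \<Phi> M R" "\<And>k. term_definable M (T k)"
  shows "definable \<Phi> M (\<lambda>e. R (\<lambda>k. T k e))"
proof -
  from assms(1) obtain p f s where *: "\<Phi> p" "range s \<subseteq> sets M" "\<And>e. R e \<longleftrightarrow> eval M (fill f e) s p"
    unfolding definable_def by blast
  from assms(2) have "\<forall>k. \<exists>t g. \<forall>e. T k e = tval M (fill g e) t"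
    unfolding term_definable_def by blast
  then obtain t g where t: "\<And>k e. T k e = tval M (fill (g k) e) (t k)" by metis
  define h where "h m = (case prod_decode m of (k, n) \<Rightarrow> case_nat f g k n)" for m
  define \<sigma> where "\<sigma> n = (case f n of Inl a \<Rightarrow> V (prod_encode (0, n))
    | Inr k \<Rightarrow> subst_tm (\<lambda>j. V (prod_encode (Suc k, j))) (t k))" for n
  have h: "fill h e (prod_encode (0, n)) = fill f e n" "fill h e (prod_encode (Suc k, n)) = fill (g k) e n"
    for e k n by (simp_all add: fill_def h_def)
  have "tval M (fill h e) (\<sigma> n) = fill f (\<lambda>k. T k e) n" for e n
  proof (cases "f n")
    case (Inl a)
    then have "fill h e (prod_encode (0, n)) = a" unfolding h by (simp add: fill_def)
    with Inl show ?thesis by (simp add: \<sigma>_def fill_def[of f])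
  next
    case (Inr k)
    then show ?thesis by (simp add: \<sigma>_def tval_rename h t fill_def[of f])
  qed
  then have "R (\<lambda>k. T k e) \<longleftrightarrow> eval M (fill h e) s (subst \<sigma> id p)" for e
    by (simp add: eval_subst *(3))
  with * show ?thesis unfolding definable_def by (blast intro: subst)
qed

lemma definable_reindex: "definable \<Phi> M R \<Longrightarrow> definable \<Phi> M (\<lambda>e. R (\<lambda>n. e (g n)))"
  using definable_subst[of M R "\<lambda>n e. e (g n)"] by (simp add: term_definable_var)

lemma definable_subst2:
  assumes "definable \<Phi> M (\<lambda>e. P (e 0) (e 1))" "term_definable M S" "term_definable M T"
  shows "definable \<Phi> M (\<lambda>e. P (S e) (T e))"
  using definable_subst[OF assms(1), of "case_nat S (\<lambda>_. T)"] assms(2,3)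
  by (simp split: nat.split)

lemma definable_subst3:
  assumes "definable \<Phi> M (\<lambda>e. P (e 0) (e 1) (e 2))"
    "term_definable M S" "term_definable M T" "term_definable M U"
  shows "definable \<Phi> M (\<lambda>e. P (S e) (T e) (U e))"
  using definable_subst[OF assms(1), of "case_nat S (case_nat T (\<lambda>_. U))"] assms(2-4)
  by (simp add: numeral_2_eq_2 split: nat.split)

text \<open>
  In the environment of the body the bound variable is entry 0. The premise is stated with the
  shifted environment, so that it unifies with the body as a higher-order pattern.
\<close>

lemma definable_ball:
  assumes T: "term_definable M T" and R: "definable \<Phi> M (\<lambda>e. R (\<lambda>n. e (Suc n)) (e 0))"
  shows "definable \<Phi> M (\<lambda>e. \<forall>x. ls M x (T e) \<longrightarrow> R e x)"
proof -
  from T obtain t g where t: "\<And>e. T e = tval M (fill g e) t"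
    unfolding term_definable_def by blast
  from R obtain p f s where p: "\<Phi> p" "range s \<subseteq> sets M"
    and R: "\<And>e. R (\<lambda>n. e (Suc n)) (e 0) \<longleftrightarrow> eval M (fill f e) s p"
    unfolding definable_def by blast
  define f' where "f' = (\<lambda>n. case f n of Inl a \<Rightarrow> Inl a | Inr k \<Rightarrow> Inr (k - 1))"
  define p' where "p' = rename (\<lambda>n. if f n = Inr 0 then 0 else Suc n) id p"
  have R': "R e x \<longleftrightarrow> eval M (case_nat x (fill f' e)) s p'" for e x
    using R[of "case_nat x e"] eval_bind[of M f x e s p] by (simp add: f'_def p'_def)
  have *: "(\<lambda>n. case_nat x (fill (interleave g f') e) (case_nat 0 (\<lambda>n. Suc (Suc (2 * n))) n))
      = case_nat x (fill f' e)" for x e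
    by (auto simp: fun_eq_iff split: nat.split)
  have "(\<forall>x. ls M x (T e) \<longrightarrow> R e x) \<longleftrightarrow> eval M (fill (interleave g f') e) s
      (AllN (V 0 \<^bold>< lift_tm (subst_tm (\<lambda>n. V (2 * n)) t) \<^bold>\<longrightarrow>
        rename (case_nat 0 (\<lambda>n. Suc (Suc (2 * n)))) id p'))" for e
    by (simp add: tval_rename eval_rename R' t *)
  moreover have "\<Phi> (AllN (V 0 \<^bold>< lift_tm (subst_tm (\<lambda>n. V (2 * n)) t) \<^bold>\<longrightarrow>
        rename (case_nat 0 (\<lambda>n. Suc (Suc (2 * n)))) id p'))"
    by (intro bounded subst) (simp add: p'_def subst p)
  ultimately show ?thesis using p(2) unfolding definable_def by blast
qed

lemma definable_bex:
  assumes T: "term_definable M T" and R: "definable \<Phi> M (\<lambda>e. R (\<lambda>n. e (Suc n)) (e 0))"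
  shows "definable \<Phi> M (\<lambda>e. \<exists>x. ls M x (T e) \<and> R e x)"
  using definable_not[OF definable_ball[OF T, of "\<lambda>e x. \<not> R e x"]] definable_not[OF R] by simp

text \<open>
  Two relations are treated at once, because the two formulas of a comprehension axiom for
  \<open>Delta01\<close> properties have their parameters in common.
\<close>

lemma definable_binary:
  assumes "definable \<Phi> M (\<lambda>e. Q (e 0) (e 1))" "definable \<Phi> M (\<lambda>e. R (e 0) (e 1))"
  obtains q r e s where "\<Phi> q" "\<Phi> r" "range s \<subseteq> sets M"
    "\<And>x y. eval M (case_nat x (case_nat y e)) s q \<longleftrightarrow> Q x y"
    "\<And>x y. eval M (case_nat x (case_nat y e)) s r \<longleftrightarrow> R x y"
proof -
  obtain p q f s where *: "\<Phi> p" "\<Phi> q" "range s \<subseteq> sets M"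
    "\<And>e. Q (e 0) (e 1) \<longleftrightarrow> eval M (fill f e) s p" "\<And>e. R (e 0) (e 1) \<longleftrightarrow> eval M (fill f e) s q"
    using definable_pair[OF assms] by metis
  define g where "g n = (if f n = Inr 0 then 0 else if f n = Inr 1 then 1 else Suc (Suc n))" for n
  define d where "d = (\<lambda>n. case f n of Inl a \<Rightarrow> a | Inr k \<Rightarrow> undefined)"
  have "(\<lambda>n. case_nat x (case_nat y d) (g n)) = fill f (case_nat x (case_nat y (\<lambda>_. undefined)))" for x y
    by (auto simp: fun_eq_iff fill_def d_def g_def split: sum.split nat.split)
  then have "eval M (case_nat x (case_nat y d)) s (rename g id p) \<longleftrightarrow> Q x y"
    "eval M (case_nat x (case_nat y d)) s (rename g id q) \<longleftrightarrow> R x y" for x y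
    using *(4,5)[of "case_nat x (case_nat y (\<lambda>_. undefined))"] by (simp_all add: eval_rename)
  with * subst show thesis
    by (intro that[of "rename g id p" "rename g id q" s d]) auto
qed

end

lemma Sigma00_subst: "Sigma00 p \<Longrightarrow> Sigma00 (subst \<sigma> \<rho> p)"
  by (induction arbitrary: \<sigma> rule: Sigma00.induct) (auto simp: subst_tm_up_lift intro: Sigma00.intros)

lemma arithmetical_subst: "arithmetical p \<Longrightarrow> arithmetical (subst \<sigma> \<rho> p)"
  by (induction p arbitrary: \<sigma>) auto

interpretation s00: formula_class Sigma00
  by standard (auto intro: Sigma00.intros Sigma00_subst)

interpretation arith: formula_class arithmetical
  by standard (auto intro: arithmetical_subst)

lemma definable_all:
  assumes R: "definable arithmetical M (\<lambda>e. R (\<lambda>n. e (Suc n)) (e 0))"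
  shows "definable arithmetical M (\<lambda>e. \<forall>x. R e x)"
proof -
  from R obtain p f s where p: "arithmetical p" "range s \<subseteq> sets M"
    and R: "\<And>e. R (\<lambda>n. e (Suc n)) (e 0) \<longleftrightarrow> eval M (fill f e) s p"
    unfolding definable_def by blast
  define f' where "f' = (\<lambda>n. case f n of Inl a \<Rightarrow> Inl a | Inr k \<Rightarrow> Inr (k - 1))"
  define p' where "p' = rename (\<lambda>n. if f n = Inr 0 then 0 else Suc n) id p"
  have "R e x \<longleftrightarrow> eval M (case_nat x (fill f' e)) s p'" for e x
    using R[of "case_nat x e"] eval_bind[of M f x e s p] by (simp add: f'_def p'_def)
  then have "(\<forall>x. R e x) \<longleftrightarrow> eval M (fill f' e) s (AllN p')" for e by simp
  moreover have "arithmetical (AllN p')" by (simp add: p'_def arithmetical_subst p)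
  ultimately show ?thesis using p(2) unfolding definable_def by blast
qed

lemma definable_ex:
  assumes R: "definable arithmetical M (\<lambda>e. R (\<lambda>n. e (Suc n)) (e 0))"
  shows "definable arithmetical M (\<lambda>e. \<exists>x. R e x)"
  using arith.definable_not[OF definable_all[of M "\<lambda>e x. \<not> R e x"]] arith.definable_not[OF R] by simp

text \<open>The semantic counterpart of a formula with one unbounded existential quantifier.\<close>

definition sigma1 :: "'a interp \<Rightarrow> ((nat \<Rightarrow> 'a) \<Rightarrow> bool) \<Rightarrow> bool" where
  "sigma1 M R \<longleftrightarrow> (\<exists>Q. definable Sigma00 M Q \<and> (\<forall>e. R e \<longleftrightarrow> (\<exists>y. Q (case_nat y e))))"

lemma sigma1I: "definable Sigma00 M (\<lambda>e. R (\<lambda>n. e (Suc n)) (e 0)) \<Longrightarrow> sigma1 M (\<lambda>e. \<exists>y. R e y)"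
  unfolding sigma1_def by (intro exI conjI allI, assumption) simp

lemma sigma1_delta0: "definable Sigma00 M R \<Longrightarrow> sigma1 M R"
  using sigma1I[of M "\<lambda>e y. R e"] s00.definable_reindex[of M R Suc] by simp

text \<open>
  The witness comes first, as the outermost bound variable of the existential formula has
  index 0.
\<close>

lemma sigma1_unary:
  assumes "sigma1 M (\<lambda>e. P (e 0))"
  obtains Q where "definable Sigma00 M (\<lambda>e. Q (e 0) (e 1))" "\<And>x. P x \<longleftrightarrow> (\<exists>y. Q y x)"
proof -
  from assms obtain Q where Q: "definable Sigma00 M Q" "\<And>e. P (e 0) \<longleftrightarrow> (\<exists>y. Q (case_nat y e))"
    unfolding sigma1_def by blast
  have "(\<lambda>n. e (case_nat 0 (\<lambda>_. 1) n)) = case_nat (e 0) (\<lambda>_. e 1)" for e :: "nat \<Rightarrow> 'a"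
    by (auto simp: fun_eq_iff split: nat.split)
  with s00.definable_reindex[OF Q(1), of "case_nat 0 (\<lambda>_. 1)"]
  have "definable Sigma00 M (\<lambda>e. Q (case_nat (e 0) (\<lambda>_. e 1)))" by (simp only:)
  moreover have "P x \<longleftrightarrow> (\<exists>y. Q (case_nat y (\<lambda>_. x)))" for x using Q(2)[of "\<lambda>_. x"] by simp
  ultimately show thesis by (rule that[of "\<lambda>y x. Q (case_nat y (\<lambda>_. x))"])
qed


section \<open>Arithmetic in models of RCA0\<close>

locale rca0_interp =
  fixes M :: "'a interp"
  assumes sets_nonempty: "sets M \<noteq> {}"
    and rca0: "p \<in> RCA0 \<Longrightarrow> valid M p"
begin

lemma sigma1_induct:
  assumes P: "sigma1 M (\<lambda>e. P (e 0))"
    and zero: "P (zr M)" and step: "\<And>x. P x \<Longrightarrow> P (ad M x (un M))"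
  shows "P x"
proof -
  obtain Q where Q: "definable Sigma00 M (\<lambda>e. Q (e 0) (e 1))" "\<And>x. P x \<longleftrightarrow> (\<exists>y. Q y x)"
    using sigma1_unary[OF P] by metis
  obtain q e s where q: "Sigma00 q" "range s \<subseteq> sets M"
    "\<And>x y. eval M (case_nat x (case_nat y e)) s q \<longleftrightarrow> Q x y"
    using s00.definable_binary[OF Q(1) Q(1)] by metis
  define p where "p = ExN q"
  have "eval M e s (induction_axiom p)"
    using rca0[of "induction_axiom p"] q(1,2) unfolding RCA0_def Sigma01_def valid_def p_def by blast
  moreover have "eval M (case_nat x e) s p \<longleftrightarrow> P x" for x
    by (simp add: p_def q(3) Q(2))
  ultimately have "P (zr M) \<and> (\<forall>x. P x \<longrightarrow> P (ad M x (un M))) \<longrightarrow> (\<forall>x. P x)"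
    unfolding eval_induction_axiom by blast
  then show ?thesis using zero step by blast
qed

lemma delta0_induct:
  assumes "definable Sigma00 M (\<lambda>e. P (e 0))" "P (zr M)" "\<And>x. P x \<Longrightarrow> P (ad M x (un M))"
  shows "P x"
  using sigma1_induct[OF sigma1_delta0[OF assms(1)]] assms(2,3) by blast

lemma delta1_comprehension:
  assumes "sigma1 M (\<lambda>e. P (e 0))" "sigma1 M (\<lambda>e. \<not> P (e 0))"
  shows "{x. P x} \<in> sets M"
proof -
  obtain Q where Q: "definable Sigma00 M (\<lambda>e. Q (e 0) (e 1))" "\<And>x. P x \<longleftrightarrow> (\<exists>y. Q y x)"
    using sigma1_unary[OF assms(1)] by metis
  obtain R where R: "definable Sigma00 M (\<lambda>e. R (e 0) (e 1))" "\<And>x. \<not> P x \<longleftrightarrow> (\<exists>y. R y x)"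
    using sigma1_unary[of M "\<lambda>x. \<not> P x"] assms(2) by metis
  obtain q r e s where qr: "Sigma00 q" "Sigma00 r" "range s \<subseteq> sets M"
    "\<And>x y. eval M (case_nat x (case_nat y e)) s q \<longleftrightarrow> Q x y"
    "\<And>x y. eval M (case_nat x (case_nat y e)) s r \<longleftrightarrow> R x y"
    using s00.definable_binary[OF Q(1) R(1)] by metis
  let ?ax = "AllN (ExN q \<^bold>\<longleftrightarrow> AllN (\<^bold>\<not> r)) \<^bold>\<longrightarrow> comprehension_axiom (ExN q)"
  have "Sigma01 (ExN q)" "Pi01 (AllN (\<^bold>\<not> r))"
    using qr(1,2) unfolding Sigma01_def Pi01_def by (auto intro: Sigma00.intros)
  then have "?ax \<in> RCA0" unfolding RCA0_def by blast
  then have "eval M e s ?ax" using rca0 qr(3) unfolding valid_def by blast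
  moreover have "eval M e s (AllN (ExN q \<^bold>\<longleftrightarrow> AllN (\<^bold>\<not> r)))"
    unfolding eval_abbreviations eval.simps using Q(2) R(2) by (simp add: qr)
  ultimately have "eval M e s (comprehension_axiom (ExN q))" unfolding eval.simps(5) by blast
  then show ?thesis by (simp add: eval_comprehension_axiom eval_abbreviations qr Q(2))
qed

end

context rca0_interp
begin

lemmas definable_rules =
  term_definable_const term_definable_var term_definable_ad term_definable_mu
  s00.definable_eq[OF sets_nonempty] s00.definable_ls[OF sets_nonempty]
  s00.definable_conj s00.definable_disj s00.definable_imp s00.definable_not

abbreviation plus_syntax (infixl "\<oplus>" 65) where "x \<oplus> y \<equiv> ad M x y"
abbreviation times_syntax (infixl "\<odot>" 70) where "x \<odot> y \<equiv> mu M x y"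
abbreviation less_syntax (infix "\<prec>" 50) where "x \<prec> y \<equiv> ls M x y"
abbreviation zero_syntax ("\<zero>") where "\<zero> \<equiv> zr M"
abbreviation one_syntax ("\<one>") where "\<one> \<equiv> un M"

text \<open>
  From here on the usual laws of arithmetic are derived from the basic axioms, by induction
  for equations, until the numbers form a discretely ordered semiring.
\<close>

lemma basic:
  "x \<oplus> \<one> \<noteq> \<zero>"
  "x \<oplus> \<one> = y \<oplus> \<one> \<longleftrightarrow> x = y"
  "x \<oplus> \<zero> = x"
  "x \<oplus> (y \<oplus> \<one>) = (x \<oplus> y) \<oplus> \<one>"
  "x \<odot> \<zero> = \<zero>"
  "x \<odot> (y \<oplus> \<one>) = x \<odot> y \<oplus> x"
  "\<not> x \<prec> \<zero>"
  "x \<prec> y \<oplus> \<one> \<longleftrightarrow> x \<prec> y \<or> x = y"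
proof -
  obtain X where "X \<in> sets M" using sets_nonempty by blast
  then have "eval M (case_nat x (\<lambda>_. y)) (\<lambda>_. X) p" if "p \<in> basic_axioms" for p
    using rca0[of p] that unfolding valid_def RCA0_def by auto
  then have "\<forall>p\<in>basic_axioms. eval M (case_nat x (\<lambda>_. y)) (\<lambda>_. X) p" by blast
  then show "x \<oplus> \<one> \<noteq> \<zero>" "x \<oplus> \<one> = y \<oplus> \<one> \<longleftrightarrow> x = y" "x \<oplus> \<zero> = x"
    "x \<oplus> (y \<oplus> \<one>) = (x \<oplus> y) \<oplus> \<one>" "x \<odot> \<zero> = \<zero>" "x \<odot> (y \<oplus> \<one>) = x \<odot> y \<oplus> x"
    "\<not> x \<prec> \<zero>" "x \<prec> y \<oplus> \<one> \<longleftrightarrow> x \<prec> y \<or> x = y"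
    by (auto simp: basic_axioms_def)
qed

lemma zero_plus: "\<zero> \<oplus> x = x"
  by (rule delta0_induct[where P = "\<lambda>x. \<zero> \<oplus> x = x"]) (intro definable_rules, simp_all add: basic)

lemma plus_assoc: "(x \<oplus> y) \<oplus> z = x \<oplus> (y \<oplus> z)"
  by (rule delta0_induct[where P = "\<lambda>z. (x \<oplus> y) \<oplus> z = x \<oplus> (y \<oplus> z)"])
    (intro definable_rules, simp_all add: basic)

lemma one_plus: "\<one> \<oplus> x = x \<oplus> \<one>"
  by (rule delta0_induct[where P = "\<lambda>x. \<one> \<oplus> x = x \<oplus> \<one>"])
    (intro definable_rules, simp_all add: basic zero_plus)

lemma plus_commute: "x \<oplus> y = y \<oplus> x"
proof (rule delta0_induct[where P = "\<lambda>y. x \<oplus> y = y \<oplus> x"])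
  show "x \<oplus> (y \<oplus> \<one>) = (y \<oplus> \<one>) \<oplus> x" if "x \<oplus> y = y \<oplus> x" for y
    using that by (metis one_plus plus_assoc)
qed (intro definable_rules, simp_all add: basic zero_plus)

lemma plus_left_commute: "x \<oplus> (y \<oplus> z) = y \<oplus> (x \<oplus> z)"
  by (metis plus_assoc plus_commute)

lemmas plus_ac = plus_assoc plus_commute plus_left_commute

lemma zero_times: "\<zero> \<odot> x = \<zero>"
  by (rule delta0_induct[where P = "\<lambda>x. \<zero> \<odot> x = \<zero>"]) (intro definable_rules, simp_all add: basic)

lemma one_times: "\<one> \<odot> x = x"
  by (rule delta0_induct[where P = "\<lambda>x. \<one> \<odot> x = x"]) (intro definable_rules, simp_all add: basic)

lemma plus_times: "(x \<oplus> y) \<odot> z = x \<odot> z \<oplus> y \<odot> z"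
  by (rule delta0_induct[where P = "\<lambda>z. (x \<oplus> y) \<odot> z = x \<odot> z \<oplus> y \<odot> z"])
    (intro definable_rules, simp_all add: basic(3,5,6) plus_ac)

lemma times_commute: "x \<odot> y = y \<odot> x"
  by (rule delta0_induct[where P = "\<lambda>y. x \<odot> y = y \<odot> x"])
    (intro definable_rules, simp_all add: basic zero_times one_times plus_times)

lemma times_assoc: "(x \<odot> y) \<odot> z = x \<odot> (y \<odot> z)"
proof (rule delta0_induct[where P = "\<lambda>z. (x \<odot> y) \<odot> z = x \<odot> (y \<odot> z)"])
  show "(x \<odot> y) \<odot> (z \<oplus> \<one>) = x \<odot> (y \<odot> (z \<oplus> \<one>))" if "(x \<odot> y) \<odot> z = x \<odot> (y \<odot> z)" for z
    using that by (metis basic(6) plus_times times_commute)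
qed (intro definable_rules, simp_all add: basic)

lemma plus_cancel: "x \<oplus> z = y \<oplus> z \<longleftrightarrow> x = y"
  by (rule delta0_induct[where P = "\<lambda>z. x \<oplus> z = y \<oplus> z \<longleftrightarrow> x = y"])
    (intro s00.definable_iff definable_rules, simp_all add: basic)

lemma zero_or_successor: "x = \<zero> \<or> (\<exists>y. x = y \<oplus> \<one>)"
proof -
  have "\<exists>y. x = \<zero> \<or> x = y \<oplus> \<one>"
    by (rule sigma1_induct[where P = "\<lambda>x. \<exists>y. x = \<zero> \<or> x = y \<oplus> \<one>"])
      (intro sigma1I definable_rules, auto)
  then show ?thesis by blast
qed

text \<open>
  The order is that of addition. From left to right this is induction for an existential
  formula.
\<close>

lemma less_iff: "x \<prec> y \<longleftrightarrow> (\<exists>z. y = x \<oplus> z \<oplus> \<one>)"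
proof
  have "\<exists>z. x \<prec> y \<longrightarrow> y = x \<oplus> z \<oplus> \<one>"
  proof (rule sigma1_induct[where P = "\<lambda>y. \<exists>z. x \<prec> y \<longrightarrow> y = x \<oplus> z \<oplus> \<one>"])
    show "sigma1 M (\<lambda>e. \<exists>z. x \<prec> e 0 \<longrightarrow> e 0 = x \<oplus> z \<oplus> \<one>)" by (intro sigma1I definable_rules)
    show "\<exists>z. x \<prec> y \<oplus> \<one> \<longrightarrow> y \<oplus> \<one> = x \<oplus> z \<oplus> \<one>" if "\<exists>z. x \<prec> y \<longrightarrow> y = x \<oplus> z \<oplus> \<one>" for y
    proof -
      from that obtain z where z: "x \<prec> y \<Longrightarrow> y = x \<oplus> z \<oplus> \<one>" by blast
      have "x \<prec> y \<Longrightarrow> y \<oplus> \<one> = x \<oplus> (z \<oplus> \<one>) \<oplus> \<one>" using z by (simp add: basic(4))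
      moreover have "x = y \<Longrightarrow> y \<oplus> \<one> = x \<oplus> \<zero> \<oplus> \<one>" by (simp add: basic(3))
      ultimately show ?thesis unfolding basic(8) by blast
    qed
  qed (simp add: basic)
  then show "x \<prec> y \<Longrightarrow> \<exists>z. y = x \<oplus> z \<oplus> \<one>" by blast
  have "x \<prec> x \<oplus> z \<oplus> \<one>" for z
    by (rule delta0_induct[where P = "\<lambda>z. x \<prec> x \<oplus> z \<oplus> \<one>"])
      (intro definable_rules, simp_all add: basic)
  then show "\<exists>z. y = x \<oplus> z \<oplus> \<one> \<Longrightarrow> x \<prec> y" by blast
qed

lemma less_total: "x \<prec> y \<or> x = y \<or> y \<prec> x"
proof (rule delta0_induct[where P = "\<lambda>y. x \<prec> y \<or> x = y \<or> y \<prec> x"])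
  show "definable Sigma00 M (\<lambda>e. x \<prec> e 0 \<or> x = e 0 \<or> e 0 \<prec> x)" by (intro definable_rules)
  show "x \<prec> \<zero> \<or> x = \<zero> \<or> \<zero> \<prec> x"
    using zero_or_successor[of x] less_iff[of \<zero> x] zero_plus by metis
  show "x \<prec> y \<oplus> \<one> \<or> x = y \<oplus> \<one> \<or> y \<oplus> \<one> \<prec> x" if "x \<prec> y \<or> x = y \<or> y \<prec> x" for y
  proof -
    have "x = y \<oplus> \<one> \<or> y \<oplus> \<one> \<prec> x" if "y \<prec> x"
    proof -
      from that obtain z where z: "x = y \<oplus> z \<oplus> \<one>" unfolding less_iff by blast
      consider "z = \<zero>" | w where "z = w \<oplus> \<one>" using zero_or_successor[of z] by blast
      then show ?thesis
      proof cases
        case 1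
        with z show ?thesis by (simp add: basic(3))
      next
        case (2 w)
        with z have "x = y \<oplus> \<one> \<oplus> w \<oplus> \<one>" by (simp add: plus_ac)
        then show ?thesis unfolding less_iff by blast
      qed
    qed
    with that show ?thesis by (auto simp: basic)
  qed
qed

lemma less_irrefl: "\<not> x \<prec> x"
proof
  assume "x \<prec> x"
  then obtain z where "x = x \<oplus> z \<oplus> \<one>" unfolding less_iff by blast
  then have "\<zero> \<oplus> x = (z \<oplus> \<one>) \<oplus> x" by (metis plus_assoc plus_commute zero_plus)
  then show False by (metis plus_cancel basic(1))
qed

lemma less_trans: "x \<prec> y \<Longrightarrow> y \<prec> z \<Longrightarrow> x \<prec> z"
  unfolding less_iff by (metis plus_assoc)

lemma times_less_mono:
  assumes "x \<prec> y" "\<zero> \<prec> z"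
  shows "z \<odot> x \<prec> z \<odot> y"
proof -
  from assms obtain u v where "y = x \<oplus> u \<oplus> \<one>" "z = \<zero> \<oplus> v \<oplus> \<one>"
    unfolding less_iff by blast
  then have "y = x \<oplus> (u \<oplus> \<one>)" "z = v \<oplus> \<one>" by (simp_all add: plus_assoc zero_plus)
  moreover have "z \<odot> (x \<oplus> w) = z \<odot> x \<oplus> z \<odot> w" for w by (metis plus_times times_commute)
  moreover have "(v \<oplus> \<one>) \<odot> (u \<oplus> \<one>) = ((v \<oplus> \<one>) \<odot> u \<oplus> v) \<oplus> \<one>" by (simp add: basic)
  ultimately show ?thesis unfolding less_iff by (metis plus_assoc)
qed

end


text \<open>
  Models whose arithmetic is given by the operations of a type, so that the algebraic and
  order facts of the type classes are available for their numbers.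
\<close>

class rca0_model = linordered_semidom +
  fixes Sets :: "'a set set"
  assumes rca0_interp: "rca0_interp \<lparr>zr = 0, un = 1, ad = (+), mu = (*), ls = (<), sets = Sets\<rparr>"

definition mdl :: "'a::rca0_model interp" where
  "mdl = \<lparr>zr = 0, un = 1, ad = (+), mu = (*), ls = (<), sets = Sets\<rparr>"

lemma mdl_simps [simp]: "zr mdl = 0" "un mdl = 1" "ad mdl = (+)" "mu mdl = (*)" "ls mdl = (<)"
  "sets mdl = Sets"
  by (simp_all add: mdl_def)

interpretation mdl: rca0_interp "mdl :: 'a::rca0_model interp"
  unfolding mdl_def by (rule rca0_interp)

section \<open>Reduction to one generic model\<close>

text \<open>A countably infinite type whose arithmetic is still to be chosen.\<close>

datatype generic = Generic (index: nat)

instance generic :: countable by countable_datatype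

lemma infinite_generic: "infinite (UNIV :: generic set)"
proof
  assume "finite (UNIV :: generic set)"
  then have "finite (range Generic)" by (rule finite_subset[rotated]) simp
  moreover have "inj Generic" by (rule injI) simp
  ultimately show False using finite_imageD by blast
qed

text \<open>
  The standard model with all sets of numbers witnesses that there is something to choose from
  below.
\<close>

lemma rca0_interp_standard:
  "rca0_interp \<lparr>zr = Generic 0, un = Generic 1, ad = \<lambda>x y. Generic (index x + index y),
     mu = \<lambda>x y. Generic (index x * index y), ls = \<lambda>x y. index x < index y, sets = UNIV\<rparr>"
    (is "rca0_interp ?M")
proof
  show "sets ?M \<noteq> {}" by simp
  fix p assume "p \<in> RCA0"
  then consider "p \<in> basic_axioms" | q where "p = induction_axiom q" | q r where "p = (r \<^bold>\<longrightarrow> comprehension_axiom q)"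
    unfolding RCA0_def by blast
  then show "valid ?M p"
  proof cases
    case 1
    then show ?thesis by (auto simp: basic_axioms_def valid_def generic.expand)
  next
    case (2 q)
    have ind: "P x" if "P (Generic 0)" "\<And>x. P x \<Longrightarrow> P (Generic (index x + 1))" for P x
    proof -
      have "P (Generic n)" for n by (induction n) (use that in force)+
      then show ?thesis by (cases x) simp
    qed
    have "eval ?M e s p" for e s
      using ind[of "\<lambda>x. eval ?M (case_nat x e) s q"] unfolding 2 eval_induction_axiom by simp
    then show ?thesis by (simp add: valid_def)
  next
    case (3 q r)
    then show ?thesis by (simp add: valid_def eval_comprehension_axiom)
  qed
qed

text \<open>
  The instance of a type class cannot depend on a model that is fixed within a proof.
  Therefore one model is chosen once and for all: a counterexample to the equivalence if there
  is one, and any model of RCA0 otherwise. Facts about the class apply to it and show that it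
  is no counterexample; hence there is none.
\<close>

definition separates :: "fm set \<Rightarrow> fm set \<Rightarrow> 'a interp \<Rightarrow> bool" where
  "separates S S' M \<longleftrightarrow> ((\<forall>p\<in>S. valid M p) \<noteq> (\<forall>p\<in>S'. valid M p))"

definition generic_model :: "generic interp" where
  "generic_model = (SOME M. rca0_interp M \<and>
     ((\<exists>N :: generic interp. rca0_interp N \<and> separates ACA0 {RKL} N) \<longrightarrow> separates ACA0 {RKL} M))"

lemma generic_model:
  "rca0_interp generic_model"
  "rca0_interp (N :: generic interp) \<Longrightarrow> separates ACA0 {RKL} N \<Longrightarrow> separates ACA0 {RKL} generic_model"
proof -
  have "\<exists>M :: generic interp. rca0_interp M \<and>
     ((\<exists>N :: generic interp. rca0_interp N \<and> separates ACA0 {RKL} N) \<longrightarrow> separates ACA0 {RKL} M)"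
    using rca0_interp_standard by blast
  note * = someI_ex[OF this, folded generic_model_def]
  show "rca0_interp generic_model" using * by blast
  show "rca0_interp N \<Longrightarrow> separates ACA0 {RKL} N \<Longrightarrow> separates ACA0 {RKL} generic_model"
    using * by blast
qed

interpretation gen: rca0_interp generic_model by (rule generic_model)

instantiation generic :: rca0_model
begin

definition zero_generic where "0 = zr generic_model"
definition one_generic where "1 = un generic_model"
definition plus_generic where "x + y = ad generic_model x y"
definition times_generic where "x * y = mu generic_model x y"
definition less_generic where "x < y = ls generic_model x y"
definition less_eq_generic where "x \<le> (y :: generic) \<longleftrightarrow> x < y \<or> x = y"
definition minus_generic where "x - y = (if y \<le> x then THE z. y + z = x else (0 :: generic))"
definition Sets_generic where "Sets = sets generic_model"

lemmas generic_defs = zero_generic_def one_generic_def plus_generic_def times_generic_def less_generic_def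

instance
proof
  fix a b c d :: generic
  show assoc: "a + b + c = a + (b + c)" for a b c :: generic by (simp add: generic_defs gen.plus_assoc)
  show comm: "a + b = b + a" for a b :: generic by (simp add: generic_defs gen.plus_commute)
  show zero_left: "0 + a = a" for a :: generic by (simp add: generic_defs gen.zero_plus)
  show mcomm: "a * b = b * a" for a b :: generic by (simp add: generic_defs gen.times_commute)
  show "a * b * c = a * (b * c)" by (simp add: generic_defs gen.times_assoc)
  show "1 * a = a" by (simp add: generic_defs gen.one_times)
  show mzero: "0 * a = 0" for a :: generic by (simp add: generic_defs gen.zero_times)
  show "a * 0 = 0" by (metis mcomm mzero)
  show distrib: "(a + b) * c = a * c + b * c" for a b c :: generic by (simp add: generic_defs gen.plus_times)
  have cancel: "a + c = b + c \<longleftrightarrow> a = b" for a b c :: generic by (simp add: generic_defs gen.plus_cancel)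
  have less: "a < b \<longleftrightarrow> (\<exists>z. b = a + z + 1)" for a b :: generic by (simp add: generic_defs gen.less_iff)
  have zero_or: "a = 0 \<or> (\<exists>z. a = z + 1)" for a :: generic by (simp add: generic_defs gen.zero_or_successor)
  have le: "a \<le> b \<longleftrightarrow> (\<exists>z. b = a + z)" for a b :: generic
    using zero_or unfolding less_eq_generic_def less by (metis assoc comm zero_left)
  have total: "a < b \<or> a = b \<or> b < a" for a b :: generic by (simp add: generic_defs gen.less_total)
  have irrefl: "\<not> a < a" for a :: generic by (simp add: generic_defs gen.less_irrefl)
  have trans: "a < b \<Longrightarrow> b < c \<Longrightarrow> a < c" for a b c :: generic
    unfolding generic_defs by (rule gen.less_trans)
  show "0 \<noteq> (1 :: generic)" by (metis irrefl less zero_left)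
  show "a < b \<longleftrightarrow> a \<le> b \<and> \<not> b \<le> a"
    unfolding less_eq_generic_def using irrefl[of a] irrefl[of b] trans[of a b a] by blast
  show "a \<le> a" unfolding less_eq_generic_def by blast
  show "a \<le> b \<or> b \<le> a" unfolding less_eq_generic_def using total by blast
  show "a \<le> b \<Longrightarrow> b \<le> c \<Longrightarrow> a \<le> c" unfolding less_eq_generic_def using trans by blast
  show "a \<le> b \<Longrightarrow> b \<le> a \<Longrightarrow> a = b" unfolding less_eq_generic_def using irrefl trans by blast
  show "a \<le> b \<Longrightarrow> c + a \<le> c + b" unfolding le by (metis assoc)
  show mono: "a < b \<Longrightarrow> 0 < c \<Longrightarrow> c * a < c * b" for a b c :: generic
    unfolding generic_defs by (rule gen.times_less_mono)
  show "0 < (1 :: generic)" unfolding less by (metis zero_left)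
  show diff: "(b + c) - b = c" for b c :: generic
  proof -
    have "(THE z. b + z = b + c) = c"
      by (rule the_equality) (use cancel comm in auto)
    then show ?thesis unfolding minus_generic_def le by auto
  qed
  show "b \<le> a \<Longrightarrow> a - b + b = a"
  proof -
    assume "b \<le> a"
    then obtain z where "a = b + z" unfolding le by blast
    then show ?thesis by (simp add: diff comm)
  qed
  have diff_else: "a - b = 0" if "\<not> b \<le> a" for a b :: generic
    using that by (simp add: minus_generic_def)
  show dist2: "a * (b + c) = a * b + a * c" for a b c :: generic by (metis distrib mcomm)
  show "a - b - c = a - (b + c)"
  proof (cases "\<exists>z. a = b + c + z")
    case True
    then obtain z where z: "a = b + c + z" by blast
    then have "a - (b + c) = z" by (simp only: diff)
    moreover have "a - b - c = z" unfolding z assoc diff ..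
    ultimately show ?thesis by simp
  next
    case False
    then have 1: "a - (b + c) = 0" by (simp add: diff_else le)
    show ?thesis
    proof (cases "b \<le> a")
      case True
      then obtain z where z: "a = b + z" unfolding le by blast
      with False have "\<not> c \<le> z" by (auto simp: le assoc)
      with z 1 show ?thesis by (simp add: diff diff_else)
    next
      case False
      moreover have "0 - c = 0"
      proof (cases "c \<le> 0")
        case True
        then have "c = 0" unfolding le by (metis zero_or less irrefl assoc zero_left comm)
        then show ?thesis using diff[of 0 0] by (simp add: zero_left)
      qed (simp add: diff_else)
      ultimately show ?thesis using 1 by (simp add: diff_else)
    qed
  qed
  show "a * (b - c) = a * b - a * c"
  proof (cases "c \<le> b")
    case True
    then obtain z where "b = c + z" unfolding le by blast
    then show ?thesis by (simp add: diff dist2)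
  next
    case False
    then have "b < c" using total unfolding less_eq_generic_def by blast
    consider "a = 0" | "0 < a" using zero_or[of a] less[of 0 a] zero_left by metis
    then have "a * b - a * c = 0"
    proof cases
      case 1
      then show ?thesis using diff[of 0 0] by (simp add: mzero zero_left)
    next
      case 2
      then have "a * b < a * c" using mono \<open>b < c\<close> by blast
      then show ?thesis using irrefl trans diff_else unfolding less_eq_generic_def by metis
    qed
    moreover have "a * 0 = 0" by (metis mcomm mzero)
    ultimately show ?thesis using False by (simp add: diff_else)
  qed
  show "a * b \<noteq> 0" if "a \<noteq> 0" "b \<noteq> 0"
    using that zero_or[of a] zero_or[of b] mono[of 0 b a] irrefl less zero_left mcomm mzero by metis
  show "rca0_interp \<lparr>zr = 0, un = 1, ad = (+), mu = (*), ls = (<), sets = Sets :: generic set set\<rparr>"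
  proof -
    have "\<lparr>zr = 0, un = 1, ad = (+), mu = (*), ls = (<), sets = Sets\<rparr> = generic_model"
      by (intro interp.equality) (auto simp: fun_eq_iff generic_defs Sets_generic_def)
    then show ?thesis using generic_model(1) by simp
  qed
qed

end

section \<open>Definability and induction for the numbers of a model\<close>

text \<open>
  Definability by a bounded formula, by a formula with one unbounded existential quantifier in
  front, and by a term, with parameters from the model.
\<close>

abbreviation delta0 :: "((nat \<Rightarrow> 'a::rca0_model) \<Rightarrow> bool) \<Rightarrow> bool" where
  "delta0 \<equiv> definable Sigma00 mdl"

abbreviation sig1 :: "((nat \<Rightarrow> 'a::rca0_model) \<Rightarrow> bool) \<Rightarrow> bool" where
  "sig1 \<equiv> sigma1 mdl"

abbreviation poly :: "((nat \<Rightarrow> 'a::rca0_model) \<Rightarrow> 'a) \<Rightarrow> bool" where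
  "poly \<equiv> term_definable mdl"

lemma less_add_one_iff: "x < y + 1 \<longleftrightarrow> x \<le> y" for x y :: "'a::rca0_model"
  using mdl.basic(8)[of x y] by (auto simp: order_le_less)

lemma zero_least: "0 \<le> x" for x :: "'a::rca0_model"
  using mdl.basic(7)[of x] by (simp add: not_less)

instance rca0_model \<subseteq> canonically_ordered_monoid_add
proof
  show "a \<le> b \<longleftrightarrow> (\<exists>c. b = a + c)" for a b :: 'a
    using zero_least by (metis add.commute add_increasing2 le_add_diff_inverse2 order_refl)
qed

lemma less_iff_add_one_le: "x < y \<longleftrightarrow> x + 1 \<le> y" for x y :: "'a::rca0_model"
  using less_add_one_iff[of y x] by (metis not_less)

lemma less_one_iff: "x < 1 \<longleftrightarrow> x = 0" for x :: "'a::rca0_model"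
  using less_add_one_iff[of x 0] by simp

lemma zero_or_add_one:
  obtains "x = 0" | y where "x = y + (1 :: 'a::rca0_model)"
  using mdl.zero_or_successor[of x] by auto

context formula_class
begin

lemma def_const: "definable \<Phi> (mdl :: 'a::rca0_model interp) (\<lambda>e. P)"
  by (rule definable_const[OF mdl.sets_nonempty])

lemma def_eq: "poly S \<Longrightarrow> poly T \<Longrightarrow> definable \<Phi> mdl (\<lambda>e. S e = T e)"
  by (rule definable_eq[OF mdl.sets_nonempty])

lemma def_less: "poly S \<Longrightarrow> poly T \<Longrightarrow> definable \<Phi> mdl (\<lambda>e. S e < T e)"
  using definable_ls[OF mdl.sets_nonempty, of S T] by simp

lemma def_mem: "X \<in> Sets \<Longrightarrow> poly T \<Longrightarrow> definable \<Phi> mdl (\<lambda>e. T e \<in> X)"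
  using definable_mem[of X mdl T] by simp

lemma poly_add_one: "poly T \<Longrightarrow> poly (\<lambda>e. T e + 1)"
  using term_definable_ad[OF _ term_definable_const, of mdl T 1] by simp

lemma def_le: "poly S \<Longrightarrow> poly T \<Longrightarrow> definable \<Phi> mdl (\<lambda>e. S e \<le> T e)"
  using def_less[OF _ poly_add_one, of S T] by (simp add: less_add_one_iff)

lemma def_ball_less:
  "poly T \<Longrightarrow> definable \<Phi> mdl (\<lambda>e. R (\<lambda>n. e (Suc n)) (e 0)) \<Longrightarrow> definable \<Phi> mdl (\<lambda>e. \<forall>x<T e. R e x)"
  using definable_ball[of mdl T R] by simp

lemma def_bex_less:
  "poly T \<Longrightarrow> definable \<Phi> mdl (\<lambda>e. R (\<lambda>n. e (Suc n)) (e 0)) \<Longrightarrow> definable \<Phi> mdl (\<lambda>e. \<exists>x<T e. R e x)"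
  using definable_bex[of mdl T R] by simp

lemma def_ball_le:
  "poly T \<Longrightarrow> definable \<Phi> mdl (\<lambda>e. R (\<lambda>n. e (Suc n)) (e 0)) \<Longrightarrow> definable \<Phi> mdl (\<lambda>e. \<forall>x\<le>T e. R e x)"
  using def_ball_less[OF poly_add_one, of T R] by (simp add: less_add_one_iff)

lemma def_bex_le:
  "poly T \<Longrightarrow> definable \<Phi> mdl (\<lambda>e. R (\<lambda>n. e (Suc n)) (e 0)) \<Longrightarrow> definable \<Phi> mdl (\<lambda>e. \<exists>x\<le>T e. R e x)"
  using def_bex_less[OF poly_add_one, of T R] by (simp add: less_add_one_iff)

end

lemma poly_add: "poly S \<Longrightarrow> poly T \<Longrightarrow> poly (\<lambda>e. S e + T e)"
  using term_definable_ad[of mdl S T] by simp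

lemma poly_mult: "poly S \<Longrightarrow> poly T \<Longrightarrow> poly (\<lambda>e. S e * T e)"
  using term_definable_mu[of mdl S T] by simp

lemmas poly_rules = term_definable_const term_definable_var poly_add poly_mult

lemmas delta0_rules = poly_rules s00.def_const s00.def_eq s00.def_less s00.def_le
  s00.def_ball_less s00.def_bex_less s00.def_ball_le s00.def_bex_le
  s00.definable_not s00.definable_conj s00.definable_disj s00.definable_imp s00.definable_iff

text \<open>Two existential quantifiers are contracted to one: its value bounds those of both.\<close>

lemma sig1_ex:
  fixes R :: "(nat \<Rightarrow> 'a::rca0_model) \<Rightarrow> 'a \<Rightarrow> bool"
  assumes "sig1 (\<lambda>e. R (\<lambda>n. e (Suc n)) (e 0))"
  shows "sig1 (\<lambda>e. \<exists>x. R e x)"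
proof -
  from assms obtain Q where Q: "delta0 Q"
    "\<And>e. R (\<lambda>n. e (Suc n)) (e 0) \<longleftrightarrow> (\<exists>y. Q (case_nat y e))"
    unfolding sigma1_def by blast
  have "delta0 (\<lambda>e. Q (\<lambda>n. e (case_nat 0 (case_nat 1 (\<lambda>n. n + 3)) n)))"
    by (rule s00.definable_reindex[OF Q(1)])
  moreover have "(\<lambda>n. e (case_nat 0 (case_nat 1 (\<lambda>n. n + 3)) n)) =
      case_nat (e 0) (case_nat (e (Suc 0)) (\<lambda>n. e (Suc (Suc (Suc n)))))" for e :: "nat \<Rightarrow> 'a"
    by (auto simp: fun_eq_iff numeral_3_eq_3 split: nat.split)
  ultimately have "delta0 (\<lambda>e. Q (case_nat (e 0) (case_nat (e (Suc 0)) (\<lambda>n. e (Suc (Suc (Suc n)))))))"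
    by (simp only:)
  then have "delta0 (\<lambda>e. \<exists>x\<le>e 0. \<exists>y\<le>e 0. Q (case_nat y (case_nat x (\<lambda>n. e (Suc n)))))"
    by (intro delta0_rules)
  then have "sig1 (\<lambda>e. \<exists>z. \<exists>x\<le>z. \<exists>y\<le>z. Q (case_nat y (case_nat x e)))"
    by (rule sigma1I)
  moreover have "(\<exists>z. \<exists>x\<le>z. \<exists>y\<le>z. Q (case_nat y (case_nat x e))) \<longleftrightarrow> (\<exists>x. R e x)" for e
  proof -
    have "R e x \<longleftrightarrow> (\<exists>y. Q (case_nat y (case_nat x e)))" for x using Q(2)[of "case_nat x e"] by simp
    moreover have "\<exists>z. x \<le> z \<and> y \<le> z" for x y :: 'a by (meson linear)
    ultimately show ?thesis by blast
  qed
  ultimately show ?thesis by simp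
qed

lemma sig1_conj:
  fixes R S :: "(nat \<Rightarrow> 'a::rca0_model) \<Rightarrow> bool"
  assumes "delta0 S" "sig1 R"
  shows "sig1 (\<lambda>e. S e \<and> R e)"
proof -
  from assms(2) obtain Q where Q: "delta0 Q" "\<And>e. R e \<longleftrightarrow> (\<exists>y. Q (case_nat y e))"
    unfolding sigma1_def by blast
  have "case_nat (e 0) (\<lambda>n. e (Suc n)) = e" for e :: "nat \<Rightarrow> 'a"
    by (auto simp: fun_eq_iff split: nat.split)
  then have "delta0 (\<lambda>e. S (\<lambda>n. e (Suc n)) \<and> Q (case_nat (e 0) (\<lambda>n. e (Suc n))))"
    using s00.definable_reindex[OF assms(1), of Suc] Q(1) by (simp add: s00.definable_conj)
  then have "sig1 (\<lambda>e. \<exists>y. S e \<and> Q (case_nat y e))" by (rule sigma1I)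
  then show ?thesis by (simp add: Q(2))
qed

lemmas sig1_delta0 = sigma1_delta0[where M = mdl]

lemma sig1_induct [case_names definable zero step]:
  fixes x :: "'a::rca0_model"
  assumes "sig1 (\<lambda>e. P (e 0))" "P 0" "\<And>x. P x \<Longrightarrow> P (x + 1)"
  shows "P x"
  by (rule mdl.sigma1_induct[where P = P]) (use assms in auto)

lemma delta0_induct [case_names definable zero step]:
  fixes x :: "'a::rca0_model"
  assumes "delta0 (\<lambda>e. P (e 0))" "P 0" "\<And>x. P x \<Longrightarrow> P (x + 1)"
  shows "P x"
  by (rule sig1_induct[where P = P]) (use assms in \<open>auto intro: sig1_delta0\<close>)

text \<open>
  The least number principle: if there is no least number with the property, then by induction
  on \<open>c\<close> such a number exists at least \<open>c\<close> below \<open>a\<close>.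
\<close>

lemma sig1_least:
  fixes a :: "'a::rca0_model"
  assumes P: "sig1 (\<lambda>e. P (e 0))" and "P a"
  shows "\<exists>d\<le>a. P d \<and> (\<forall>d'<d. \<not> P d')"
proof (rule ccontr)
  assume contr: "\<not> ?thesis"
  have "\<exists>d. d + c \<le> a \<and> P d" for c
  proof (induction c rule: sig1_induct)
    case definable
    obtain Q where Q: "delta0 (\<lambda>e. Q (e 0) (e 1))" "\<And>x. P x \<longleftrightarrow> (\<exists>y. Q y x)"
      using sigma1_unary[OF P] by metis
    have "sig1 (\<lambda>e. \<exists>d. d + e 0 \<le> a \<and> (\<exists>y. Q y d))"
      by (intro sig1_ex sig1_conj sigma1I delta0_rules s00.definable_subst2[OF Q(1)])
    then show ?case by (simp add: Q(2))
  next
    case zero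
    show ?case using \<open>P a\<close> by (intro exI[of _ a]) simp
  next
    case (step c)
    then obtain d where d: "d + c \<le> a" "P d" by blast
    have "d \<le> d + c" by simp
    with d have "d \<le> a" by order
    with contr d obtain d' where "d' < d" "P d'" by blast
    moreover from this have "d' + 1 \<le> d" by (simp add: less_iff_add_one_le)
    then have "d' + 1 + c \<le> d + c" by (rule add_right_mono)
    then have "d' + (c + 1) \<le> d + c" by (simp add: ac_simps)
    then have "d' + (c + 1) \<le> a" using d(1) by order
    ultimately show ?case by blast
  qed
  then obtain d where "d + (a + 1) \<le> a" by blast
  moreover have "a < d + (a + 1)" by (simp add: add.assoc[symmetric] less_add_one_iff)
  ultimately show False by simp
qed

lemma delta0_least:
  fixes a :: "'a::rca0_model"
  assumes "delta0 (\<lambda>e. P (e 0))" and "P a"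
  shows "\<exists>d\<le>a. P d \<and> (\<forall>d'<d. \<not> P d')"
  using sig1_least[OF sig1_delta0[OF assms(1)] assms(2)] .

lemma delta1_comprehension:
  fixes P :: "'a::rca0_model \<Rightarrow> bool"
  shows "sig1 (\<lambda>e. P (e 0)) \<Longrightarrow> sig1 (\<lambda>e. \<not> P (e 0)) \<Longrightarrow> {x. P x} \<in> Sets"
  using mdl.delta1_comprehension[of P] by simp

lemma delta0_comprehension:
  fixes P :: "'a::rca0_model \<Rightarrow> bool"
  shows "delta0 (\<lambda>e. P (e 0)) \<Longrightarrow> {x. P x} \<in> Sets"
  by (intro delta1_comprehension sig1_delta0 s00.definable_not)


section \<open>Pairs, remainders and coprime moduli\<close>

text \<open>
  The value of the term \<open>pair\<close>. It is injective since \<open>x + y\<close> is the integer part of its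
  square root.
\<close>

definition pr :: "'a::rca0_model \<Rightarrow> 'a \<Rightarrow> 'a" where
  "pr x y = (x + y) * (x + y) + x"

lemma le_square: "n \<le> n * n" for n :: "'a::rca0_model"
proof (cases n rule: zero_or_add_one)
  case (2 y)
  then have "1 \<le> n" by simp
  then show ?thesis using mult_left_mono[of 1 n n] by simp
qed simp

lemma pr_ge: "x \<le> pr x y" "y \<le> pr x y"
proof -
  show "x \<le> pr x y" by (simp add: pr_def)
  have "y \<le> x + y" by simp
  also have "\<dots> \<le> (x + y) * (x + y)" by (rule le_square)
  also have "\<dots> \<le> pr x y" by (simp add: pr_def)
  finally show "y \<le> pr x y" .
qed

lemma pr_eq_iff [simp]: "pr x y = pr x' y' \<longleftrightarrow> x = x' \<and> y = y'"
proof
  have less: "pr x y < pr x' y'" if "x + y < x' + y'" for x y x' y' :: 'a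
  proof -
    have "x \<le> (x + y) + (x + y)" by (simp add: add.assoc)
    then have "pr x y < (x + y) * (x + y) + ((x + y) + (x + y)) + 1"
      unfolding less_add_one_iff pr_def by (rule add_left_mono)
    also have "\<dots> = (x + y + 1) * (x + y + 1)" by (simp add: algebra_simps)
    also have "\<dots> \<le> (x' + y') * (x' + y')"
      using that unfolding less_iff_add_one_le by (intro mult_mono) simp_all
    also have "\<dots> \<le> pr x' y'" by (simp add: pr_def)
    finally show ?thesis .
  qed
  assume eq: "pr x y = pr x' y'"
  then have sum: "x + y = x' + y'" using less[of x y x' y'] less[of x' y' x y] by (metis less_irrefl linorder_less_linear)
  with eq have "x = x'" by (simp add: pr_def)
  with sum show "x = x' \<and> y = y'" by simp
qed simp

lemma ex_division:
  fixes a m :: "'a::rca0_model"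
  assumes "0 < m"
  shows "\<exists>q r. r < m \<and> a = q * m + r"
proof (induction a rule: sig1_induct)
  case definable
  show ?case by (intro sig1_ex sig1_delta0 delta0_rules)
next
  case zero
  show ?case using assms by (intro exI[of _ 0]) simp
next
  case (step a)
  then obtain q r where qr: "r < m" "a = q * m + r" by blast
  then consider "r + 1 < m" | "r + 1 = m" using less_iff_add_one_le[of r m] by force
  then show ?case
  proof cases
    case 1
    with qr show ?thesis by (metis add.assoc)
  next
    case 2
    have "a + 1 = q * m + (r + 1)" using qr by (simp add: add.assoc)
    also have "\<dots> = (q + 1) * m + 0" unfolding 2 by (simp add: algebra_simps)
    finally have "a + 1 = (q + 1) * m + 0" .
    with assms show ?thesis by blast
  qed
qed

lemma division_unique:
  fixes m :: "'a::rca0_model"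
  assumes "r < m" "r' < m" "q * m + r = q' * m + r'"
  shows "r = r'"
proof -
  have less: "q * m + r < q' * m + r'" if "q < q'" "r < m" for q r q' r' :: 'a
  proof -
    have "q * m + r < (q + 1) * m" using that by (simp add: algebra_simps)
    also have "\<dots> \<le> q' * m" using that unfolding less_iff_add_one_le by (intro mult_right_mono) simp_all
    also have "\<dots> \<le> q' * m + r'" by simp
    finally show ?thesis .
  qed
  have "q = q'" using less[of q q' r r'] less[of q' q r' r] assms by (metis less_irrefl linorder_less_linear)
  with assms(3) show ?thesis by simp
qed

definition rem :: "'a::rca0_model \<Rightarrow> 'a \<Rightarrow> 'a" where
  "rem a m = (if m = 0 then 0 else THE r. r < m \<and> (\<exists>q. a = q * m + r))"

lemma rem_eq_iff:
  fixes a m v :: "'a::rca0_model"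
  assumes "0 < m"
  shows "rem a m = v \<longleftrightarrow> v < m \<and> (\<exists>q. a = q * m + v)"
proof -
  have ex1: "\<exists>!r. r < m \<and> (\<exists>q. a = q * m + r)"
    using ex_division[OF assms, of a] division_unique[of _ m] by blast
  from assms have "m \<noteq> 0" by auto
  then have "rem a m = (THE r. r < m \<and> (\<exists>q. a = q * m + r))" unfolding rem_def by (rule if_not_P)
  with theI'[OF ex1] ex1 show ?thesis by metis
qed

lemma rem_less: "0 < m \<Longrightarrow> rem a m < m"
  using rem_eq_iff[of m a "rem a m"] by simp

lemma le_multI: "0 < m \<Longrightarrow> q \<le> q * m" for q m :: "'a::rca0_model"
  using mult_left_mono[of 1 m q] by (simp add: less_iff_add_one_le)

lemma rem_eq_iff':
  fixes a m v :: "'a::rca0_model"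
  assumes "0 < m"
  shows "rem a m = v \<longleftrightarrow> v < m \<and> (\<exists>q\<le>a. a = q * m + v)"
proof -
  have "q \<le> q * m + v" for q using le_multI[OF assms, of q] by (simp add: add_increasing2)
  then show ?thesis unfolding rem_eq_iff[OF assms] by blast
qed

lemma rem_le: "rem a m \<le> a"
proof (cases "m = 0")
  case False
  then obtain q where "a = q * m + rem a m"
    using rem_eq_iff[of m a "rem a m"] by (auto simp: zero_less_iff_neq_zero)
  then show ?thesis by (metis add_increasing order_refl zero_le)
qed (simp add: rem_def)

lemma rem_eq_iff_bounded:
  "rem a m = v \<longleftrightarrow> (m = 0 \<and> v = 0) \<or> (v < m \<and> (\<exists>q\<le>a. a = q * m + v))"
  by (cases "m = 0") (auto simp: rem_eq_iff' zero_less_iff_neq_zero, simp_all add: rem_def)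

lemma rem_add_mult: "0 < m \<Longrightarrow> rem (a + q * m) m = rem a m" for a q m :: "'a::rca0_model"
  using rem_eq_iff[of m a "rem a m"] rem_eq_iff[of m "a + q * m" "rem a m"]
  by (metis add.assoc add.commute distrib_right)

lemma rem_rem_dvd:
  fixes a m P :: "'a::rca0_model"
  assumes "0 < m" "0 < P" "m dvd P"
  shows "rem (rem a P) m = rem a m"
proof -
  obtain q where "a = q * P + rem a P" using rem_eq_iff[OF assms(2), of a "rem a P"] by blast
  moreover obtain k where "P = m * k" using assms(3) by (auto elim: dvdE)
  ultimately have "a = rem a P + (q * k) * m" by (simp add: ac_simps)
  then show ?thesis using rem_add_mult[OF assms(1), of "rem a P" "q * k"] by simp
qed

lemma dvd_iff_bounded: "a dvd b \<longleftrightarrow> (\<exists>k\<le>b. b = a * k)" for a b :: "'a::rca0_model"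
proof
  assume "a dvd b"
  then obtain k where k: "b = a * k" by (auto elim: dvdE)
  show "\<exists>k\<le>b. b = a * k"
  proof (cases "a = 0")
    case True
    with k show ?thesis by auto
  next
    case False
    with k have "k \<le> b" using le_multI[of a k] by (simp add: mult.commute zero_less_iff_neq_zero)
    with k show ?thesis by blast
  qed
qed auto

lemma delta0_dvd: "poly S \<Longrightarrow> poly T \<Longrightarrow> delta0 (\<lambda>e. S e dvd T e)"
proof (rule s00.definable_subst2)
  show "delta0 (\<lambda>e. (e 0 :: 'a) dvd e 1)"
    unfolding dvd_iff_bounded by (intro delta0_rules)
qed

text \<open>
  Invertibility modulo \<open>m\<close> replaces coprimality: that a product is invertible if its factors
  are does not require common divisors or prime numbers.
\<close>

definition unit_mod :: "'a::rca0_model \<Rightarrow> 'a \<Rightarrow> bool" where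
  "unit_mod a m \<longleftrightarrow> (\<exists>u w. u * a = 1 + w * m)"

lemma unit_mod_mult:
  assumes "unit_mod a m" "unit_mod b m"
  shows "unit_mod (a * b) m"
proof -
  from assms obtain u w v z where "u * a = 1 + w * m" "v * b = 1 + z * m"
    unfolding unit_mod_def by blast
  then have "(u * v) * (a * b) = (1 + w * m) * (1 + z * m)" by (metis mult.assoc mult.left_commute)
  also have "\<dots> = 1 + (w + z + w * z * m) * m" by (simp add: algebra_simps)
  finally show ?thesis unfolding unit_mod_def by blast
qed

lemma unit_mod_factor: "unit_mod (a * b) m \<Longrightarrow> unit_mod a m"
  unfolding unit_mod_def by (metis mult.assoc mult.commute)

lemma unit_mod_add: "unit_mod a m \<Longrightarrow> unit_mod (m + a) m"
proof -
  assume "unit_mod a m"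
  then obtain u w where "u * a = 1 + w * m" unfolding unit_mod_def by blast
  then have "u * (m + a) = 1 + (w + u) * m" by (simp add: algebra_simps)
  then show ?thesis unfolding unit_mod_def by blast
qed

text \<open>
  From \<open>u a = 1 + w m\<close> one reads off that \<open>w\<close> is inverse to \<open>-m\<close> modulo \<open>a\<close>, so that
  \<open>w (a - 1)\<close> is inverse to \<open>m\<close>.
\<close>

lemma unit_mod_sym:
  assumes "unit_mod a m" "0 < m"
  shows "unit_mod m a"
proof -
  from assms(1) obtain u w where uw: "u * a = 1 + w * m" unfolding unit_mod_def by blast
  obtain k where k: "a = k + 1" using uw by (cases a rule: zero_or_add_one) auto
  show ?thesis
  proof (cases "k * u" rule: zero_or_add_one)
    case 1
    then have "k = 0" using uw by auto
    moreover obtain m' where "m = m' + 1" using assms(2) by (cases m rule: zero_or_add_one) auto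
    ultimately have "1 * m = 1 + m' * a" using k by (simp add: add.commute)
    then show ?thesis unfolding unit_mod_def by blast
  next
    case (2 j)
    have "k + (w * k) * m = k * (u * a)" unfolding uw by (simp add: algebra_simps)
    also have "\<dots> = (j + 1) * a" using 2 by (metis mult.assoc)
    also have "\<dots> = k + (1 + j * a)" by (simp add: k algebra_simps)
    finally have "(w * k) * m = 1 + j * a" by simp
    then show ?thesis unfolding unit_mod_def by blast
  qed
qed

lemma unit_mod_dvd_mult:
  assumes "unit_mod a m" "m dvd a * d"
  shows "m dvd d"
proof -
  from assms obtain u w k where uw: "u * a = 1 + w * m" and "a * d = m * k"
    unfolding unit_mod_def by (auto elim: dvdE)
  then have "u * (m * k) = (1 + w * m) * d" by (metis mult.assoc)
  then have eq: "m * (u * k) = d + m * (w * d)" by (simp add: algebra_simps)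
  have "w * d \<le> u * k \<or> m = 0"
  proof (rule disjCI)
    assume "m \<noteq> 0"
    show "w * d \<le> u * k"
    proof (rule ccontr)
      assume "\<not> w * d \<le> u * k"
      then have "m * (u * k) < m * (w * d)"
        using \<open>m \<noteq> 0\<close> by (intro mult_strict_left_mono) (simp_all add: zero_less_iff_neq_zero)
      also have "\<dots> \<le> d + m * (w * d)" by simp
      finally show False using eq by simp
    qed
  qed
  then show ?thesis
  proof
    assume "w * d \<le> u * k"
    then obtain z where "u * k = w * d + z" unfolding le_iff_add by blast
    with eq have "m * z + m * (w * d) = d + m * (w * d)" by (simp add: distrib_left add.commute)
    then have "d = m * z" by simp
    then show ?thesis by simp
  qed (use eq in simp)
qed

section \<open>Bounded definable functions\<close>

text \<open>
  Functions that are bounded by a term and have a graph that is definable by a bounded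
  formula. They can be used in place of terms in bounded formulas, even as bounds of
  quantifiers.
\<close>

definition bfun :: "((nat \<Rightarrow> 'a::rca0_model) \<Rightarrow> 'a) \<Rightarrow> bool" where
  "bfun T \<longleftrightarrow> (\<exists>B. poly B \<and> (\<forall>e. T e \<le> B e)) \<and> delta0 (\<lambda>e. T (\<lambda>n. e (Suc n)) = e 0)"

lemma bfun_graph:
  assumes "bfun T"
  shows "delta0 (\<lambda>e. T (\<lambda>n. e (g n)) = e k)"
  using s00.definable_reindex[of mdl "\<lambda>e. T (\<lambda>n. e (Suc n)) = e 0" "case_nat k g"] assms
  unfolding bfun_def by simp

lemma poly_reindex: "poly T \<Longrightarrow> poly (\<lambda>e. T (\<lambda>n. e (g n)))"
  for T :: "(nat \<Rightarrow> 'a::rca0_model) \<Rightarrow> 'a"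
proof -
  assume "poly T"
  then obtain t f where "\<And>e. T e = tval mdl (fill f e) t" unfolding term_definable_def by blast
  moreover have "fill f (\<lambda>n. e (g n)) = fill (\<lambda>n. map_sum id g (f n)) e" for e :: "nat \<Rightarrow> 'a"
    by (auto simp: fun_eq_iff fill_def split: sum.split)
  ultimately show ?thesis unfolding term_definable_def by metis
qed

lemma bfun_reindex: "bfun T \<Longrightarrow> bfun (\<lambda>e. T (\<lambda>n. e (g n)))"
  using bfun_graph[of T "\<lambda>n. Suc (g n)" 0] poly_reindex[of _ g] unfolding bfun_def by fast

lemma bfun_poly: "poly T \<Longrightarrow> bfun T"
  unfolding bfun_def by (intro conjI exI[of _ T] delta0_rules) (auto intro: poly_reindex)

text \<open>A bounded quantifier names the value of the function.\<close>

lemma delta0_bind: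
  assumes "bfun T" "delta0 (\<lambda>e. P (\<lambda>n. e (Suc n)) (e 0))"
  shows "delta0 (\<lambda>e. P e (T e))"
proof -
  obtain B where B: "poly B" "\<And>e. T e \<le> B e" using assms(1) unfolding bfun_def by blast
  have "delta0 (\<lambda>e. \<exists>t\<le>B e. T e = t \<and> P e t)"
    by (intro delta0_rules B(1) bfun_graph assms)
  moreover have "(\<exists>t\<le>B e. T e = t \<and> P e t) \<longleftrightarrow> P e (T e)" for e using B(2) by auto
  ultimately show ?thesis by simp
qed

lemma delta0_subst1:
  "delta0 (\<lambda>e. P (e 0)) \<Longrightarrow> bfun S \<Longrightarrow> delta0 (\<lambda>e. P (S e))"
  by (rule delta0_bind[where P = "\<lambda>e. P"])

lemma delta0_subst2:
  assumes P: "delta0 (\<lambda>e. P (e 0) (e 1))" and S: "bfun S" and T: "bfun T"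
  shows "delta0 (\<lambda>e. P (S e) (T e))"
proof (rule delta0_bind[OF T, where P = "\<lambda>e. P (S e)"])
  show "delta0 (\<lambda>e. P (S (\<lambda>n. e (Suc n))) (e 0))"
    by (rule delta0_bind[OF bfun_reindex[OF S], where P = "\<lambda>e s. P s (e 0)"])
      (rule s00.definable_subst2[OF P term_definable_var term_definable_var])
qed

lemma delta0_subst3:
  assumes P: "delta0 (\<lambda>e. P (e 0) (e 1) (e 2))" and S: "bfun S" and T: "bfun T" and U: "bfun U"
  shows "delta0 (\<lambda>e. P (S e) (T e) (U e))"
proof (rule delta0_bind[OF U, where P = "\<lambda>e. P (S e) (T e)"])
  show "delta0 (\<lambda>e. P (S (\<lambda>n. e (Suc n))) (T (\<lambda>n. e (Suc n))) (e 0))"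
  proof (rule delta0_bind[OF bfun_reindex[OF T], where P = "\<lambda>e t. P (S (\<lambda>n. e (Suc n))) t (e 0)"])
    show "delta0 (\<lambda>e. P (S (\<lambda>n. e (Suc (Suc n)))) (e 0) (e (Suc 0)))"
      by (rule delta0_bind[OF bfun_reindex[OF S], where P = "\<lambda>e s. P s (e 0) (e (Suc 0))"])
        (rule s00.definable_subst3[OF P term_definable_var term_definable_var term_definable_var])
  qed
qed

lemma bfun_eq: "bfun S \<Longrightarrow> bfun T \<Longrightarrow> delta0 (\<lambda>e. S e = T e)"
  by (rule delta0_subst2[where P = "(=)"], intro delta0_rules)

lemma bfun_less: "bfun S \<Longrightarrow> bfun T \<Longrightarrow> delta0 (\<lambda>e. S e < T e)"
  by (rule delta0_subst2[where P = "(<)"], intro delta0_rules)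

lemma bfun_le: "bfun S \<Longrightarrow> bfun T \<Longrightarrow> delta0 (\<lambda>e. S e \<le> T e)"
  by (rule delta0_subst2[where P = "(\<le>)"], intro delta0_rules)

lemma bfun_dvd: "bfun S \<Longrightarrow> bfun T \<Longrightarrow> delta0 (\<lambda>e. S e dvd T e)"
  by (rule delta0_subst2[where P = "(dvd)"], intro delta0_rules delta0_dvd)

lemma bfun_mem: "X \<in> Sets \<Longrightarrow> bfun T \<Longrightarrow> delta0 (\<lambda>e. T e \<in> X)"
  by (rule delta0_subst1[where P = "\<lambda>x. x \<in> X"], intro delta0_rules s00.def_mem)

lemma bfun_ball_less:
  "bfun T \<Longrightarrow> delta0 (\<lambda>e. R (\<lambda>n. e (Suc n)) (e 0)) \<Longrightarrow> delta0 (\<lambda>e. \<forall>x<T e. R e x)"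
  by (rule delta0_bind[where P = "\<lambda>e t. \<forall>x<t. R e x"], assumption, intro delta0_rules)
    (rule s00.definable_reindex[where g = "case_nat 0 (\<lambda>n. Suc (Suc n))" and R = "\<lambda>e. R (\<lambda>n. e (Suc n)) (e 0)", simplified])

lemma bfun_bex_less:
  "bfun T \<Longrightarrow> delta0 (\<lambda>e. R (\<lambda>n. e (Suc n)) (e 0)) \<Longrightarrow> delta0 (\<lambda>e. \<exists>x<T e. R e x)"
  by (rule delta0_bind[where P = "\<lambda>e t. \<exists>x<t. R e x"], assumption, intro delta0_rules)
    (rule s00.definable_reindex[where g = "case_nat 0 (\<lambda>n. Suc (Suc n))" and R = "\<lambda>e. R (\<lambda>n. e (Suc n)) (e 0)", simplified])

lemma bfun_ball_le:
  "bfun T \<Longrightarrow> delta0 (\<lambda>e. R (\<lambda>n. e (Suc n)) (e 0)) \<Longrightarrow> delta0 (\<lambda>e. \<forall>x\<le>T e. R e x)"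
  by (rule delta0_bind[where P = "\<lambda>e t. \<forall>x\<le>t. R e x"], assumption, intro delta0_rules)
    (rule s00.definable_reindex[where g = "case_nat 0 (\<lambda>n. Suc (Suc n))" and R = "\<lambda>e. R (\<lambda>n. e (Suc n)) (e 0)", simplified])

lemma bfun_bex_le:
  "bfun T \<Longrightarrow> delta0 (\<lambda>e. R (\<lambda>n. e (Suc n)) (e 0)) \<Longrightarrow> delta0 (\<lambda>e. \<exists>x\<le>T e. R e x)"
  by (rule delta0_bind[where P = "\<lambda>e t. \<exists>x\<le>t. R e x"], assumption, intro delta0_rules)
    (rule s00.definable_reindex[where g = "case_nat 0 (\<lambda>n. Suc (Suc n))" and R = "\<lambda>e. R (\<lambda>n. e (Suc n)) (e 0)", simplified])

lemma bfun_const: "bfun (\<lambda>e. c)"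
  by (intro bfun_poly poly_rules)

lemma bfun_var: "bfun (\<lambda>e. e k)"
  by (intro bfun_poly poly_rules)

lemma bfun_add:
  assumes "bfun S" "bfun T"
  shows "bfun (\<lambda>e. S e + T e)"
  unfolding bfun_def
proof
  obtain B C where "poly B" "\<And>e. S e \<le> B e" "poly C" "\<And>e. T e \<le> C e"
    using assms unfolding bfun_def by blast
  then show "\<exists>B. poly B \<and> (\<forall>e. S e + T e \<le> B e)"
    by (intro exI[of _ "\<lambda>e. B e + C e"]) (auto intro: poly_rules add_mono)
  show "delta0 (\<lambda>e. S (\<lambda>n. e (Suc n)) + T (\<lambda>n. e (Suc n)) = e 0)"
    by (rule delta0_subst3[where P = "\<lambda>x y z. x + y = z",
          OF _ bfun_reindex[OF assms(1)] bfun_reindex[OF assms(2)] bfun_var]) (intro delta0_rules)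
qed

lemma bfun_mult:
  assumes "bfun S" "bfun T"
  shows "bfun (\<lambda>e. S e * T e)"
  unfolding bfun_def
proof
  obtain B C where "poly B" "\<And>e. S e \<le> B e" "poly C" "\<And>e. T e \<le> C e"
    using assms unfolding bfun_def by blast
  then show "\<exists>B. poly B \<and> (\<forall>e. S e * T e \<le> B e)"
    by (intro exI[of _ "\<lambda>e. B e * C e"]) (auto intro: poly_rules mult_mono)
  show "delta0 (\<lambda>e. S (\<lambda>n. e (Suc n)) * T (\<lambda>n. e (Suc n)) = e 0)"
    by (rule delta0_subst3[where P = "\<lambda>x y z. x * y = z",
          OF _ bfun_reindex[OF assms(1)] bfun_reindex[OF assms(2)] bfun_var]) (intro delta0_rules)
qed

lemma bfun_pr: "bfun S \<Longrightarrow> bfun T \<Longrightarrow> bfun (\<lambda>e. pr (S e) (T e))"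
  unfolding pr_def by (intro bfun_add bfun_mult)

lemma bfun_fun1:
  assumes "delta0 (\<lambda>e. f (e 0) = e 1)" "\<And>x. f x \<le> x" "bfun S"
  shows "bfun (\<lambda>e. f (S e))"
  unfolding bfun_def
proof
  obtain B where "poly B" "\<And>e. S e \<le> B e" using assms unfolding bfun_def by blast
  then show "\<exists>B. poly B \<and> (\<forall>e. f (S e) \<le> B e)" using assms(2) order_trans by metis
  show "delta0 (\<lambda>e. f (S (\<lambda>n. e (Suc n))) = e 0)"
    by (rule delta0_subst2[where P = "\<lambda>x y. f x = y", OF assms(1) bfun_reindex[OF assms(3)] bfun_var])
qed

lemma bfun_fun_const:
  assumes "delta0 (\<lambda>e. f (e 0) = e 1)" "\<And>x. f x \<le> c" "bfun S"
  shows "bfun (\<lambda>e. f (S e))"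
  unfolding bfun_def
proof
  show "\<exists>B. poly B \<and> (\<forall>e. f (S e) \<le> B e)"
    using assms(2) by (intro exI[of _ "\<lambda>e. c"]) (auto intro: poly_rules)
  show "delta0 (\<lambda>e. f (S (\<lambda>n. e (Suc n))) = e 0)"
    by (rule delta0_subst2[where P = "\<lambda>x y. f x = y", OF assms(1) bfun_reindex[OF assms(3)] bfun_var])
qed

lemma bfun_fun2:
  assumes "delta0 (\<lambda>e. f (e 0) (e 1) = e 2)" "\<And>x y. f x y \<le> x" "bfun S" "bfun T"
  shows "bfun (\<lambda>e. f (S e) (T e))"
  unfolding bfun_def
proof
  obtain B where "poly B" "\<And>e. S e \<le> B e" using assms unfolding bfun_def by blast
  then show "\<exists>B. poly B \<and> (\<forall>e. f (S e) (T e) \<le> B e)" using assms(2) order_trans by metis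
  show "delta0 (\<lambda>e. f (S (\<lambda>n. e (Suc n))) (T (\<lambda>n. e (Suc n))) = e 0)"
    by (rule delta0_subst3[where P = "\<lambda>x y z. f x y = z",
          OF assms(1) bfun_reindex[OF assms(3)] bfun_reindex[OF assms(4)] bfun_var])
qed

lemma bfun_rem: "bfun S \<Longrightarrow> bfun T \<Longrightarrow> bfun (\<lambda>e. rem (S e) (T e))"
proof (rule bfun_fun2[where f = rem])
  show "delta0 (\<lambda>e. rem (e 0) (e 1) = (e 2 :: 'a))"
    unfolding rem_eq_iff_bounded by (intro delta0_rules)
qed (rule rem_le)

lemmas bounded_rules = bfun_const bfun_var bfun_add bfun_mult bfun_pr bfun_rem
  s00.def_const bfun_eq bfun_less bfun_le bfun_dvd
  bfun_ball_less bfun_bex_less bfun_ball_le bfun_bex_le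
  s00.definable_not s00.definable_conj s00.definable_disj s00.definable_imp s00.definable_iff


section \<open>Goedel's beta function\<close>

lemma ex_common_multiple:
  fixes n :: "'a::rca0_model"
  shows "\<exists>M. 0 < M \<and> (\<forall>d\<le>n. 0 < d \<longrightarrow> d dvd M)"
proof (induction n rule: sig1_induct)
  case definable
  show ?case by (intro sig1_ex sig1_delta0 bounded_rules)
next
  case zero
  show ?case by (intro exI[of _ 1]) auto
next
  case (step n)
  then obtain M where M: "0 < M" "\<And>d. d \<le> n \<Longrightarrow> 0 < d \<Longrightarrow> d dvd M" by blast
  have "0 < M * (n + 1)" using M(1) by (simp add: zero_less_iff_neq_zero)
  moreover have "d dvd M * (n + 1)" if "d \<le> n + 1" "0 < d" for d
  proof (cases "d \<le> n")
    case False
    with that have "d = n + 1" using less_iff_add_one_le[of n d] by (metis not_le order_antisym)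
    then show ?thesis by simp
  qed (use M(2) that in simp)
  ultimately show ?case by blast
qed

definition modulus :: "'a::rca0_model \<Rightarrow> 'a \<Rightarrow> 'a" where
  "modulus b i = 1 + (i + 1) * b"

lemma bfun_modulus: "bfun S \<Longrightarrow> bfun T \<Longrightarrow> bfun (\<lambda>e. modulus (S e) (T e))"
  unfolding modulus_def by (intro bounded_rules)

lemma modulus_pos [simp]: "0 < modulus b i"
  by (simp add: modulus_def zero_less_iff_neq_zero)

lemma less_modulus: "b < modulus b i"
proof -
  have "b \<le> (i + 1) * b" by (simp add: algebra_simps)
  then show ?thesis using less_add_one_iff[of b "(i + 1) * b"] by (simp add: modulus_def add.commute)
qed

text \<open>
  The moduli \<open>modulus b i\<close> with \<open>i \<le> n\<close> are pairwise coprime if \<open>b\<close> is divisible by the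
  differences of their indices.
\<close>

definition admissible :: "'a::rca0_model \<Rightarrow> 'a \<Rightarrow> bool" where
  "admissible b n \<longleftrightarrow> 0 < b \<and> (\<forall>d\<le>n. 0 < d \<longrightarrow> d dvd b)"

lemma ex_admissible:
  fixes n c :: "'a::rca0_model"
  shows "\<exists>b. admissible b n \<and> c \<le> b"
proof -
  obtain M where M: "0 < M" "\<And>d. d \<le> n \<Longrightarrow> 0 < d \<Longrightarrow> d dvd M" using ex_common_multiple by blast
  have "c + 1 \<le> (c + 1) * M" by (rule le_multI[OF M(1)])
  then have "c \<le> M * (c + 1)" by (metis add_increasing2 mult.commute order_trans zero_le order_refl le_add_same_cancel1)
  moreover have "admissible (M * (c + 1)) n"
    using M by (auto simp: admissible_def zero_less_iff_neq_zero)
  ultimately show ?thesis by blast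
qed

text \<open>
  For \<open>j = i + d\<close> the difference of the moduli is \<open>d b\<close>. Modulo \<open>modulus b i\<close>, the number \<open>b\<close>
  is invertible, since \<open>(i + 1) b\<close> is congruent to \<open>-1\<close>; and so is its divisor \<open>d\<close>.
\<close>

lemma unit_mod_modulus:
  fixes b n :: "'a::rca0_model"
  assumes "admissible b n" "i \<le> n" "j \<le> n" "i \<noteq> j"
  shows "unit_mod (modulus b j) (modulus b i)"
proof -
  have *: "unit_mod (modulus b j) (modulus b i)" if ij: "i < j" "j \<le> n" for i j
  proof -
    obtain d where d: "j = i + d" using ij(1) by (metis le_iff_add order_less_imp_le)
    have "0 < d" using ij d by (simp add: zero_less_iff_neq_zero)
    moreover have "d \<le> n" using ij d by (metis add_increasing order_refl order_trans zero_le add.commute add_increasing2)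
    ultimately obtain c where c: "b = d * c" using assms(1) unfolding admissible_def by (auto elim: dvdE)
    have "(i + 1) * b \<noteq> 0" using assms(1) by (simp add: admissible_def zero_less_iff_neq_zero)
    then obtain h where h: "(i + 1) * b = h + 1" by (cases "(i + 1) * b" rule: zero_or_add_one) auto
    have "((i + 1) * (h + 1)) * b = (h + 1) * (h + 1)" by (metis h mult.assoc mult.commute)
    also have "\<dots> = 1 + h * (1 + (h + 1))" by (simp add: algebra_simps)
    also have "\<dots> = 1 + h * modulus b i" by (simp only: modulus_def h)
    finally have b: "unit_mod b (modulus b i)" unfolding unit_mod_def by blast
    then have "unit_mod d (modulus b i)" unfolding c by (rule unit_mod_factor)
    from unit_mod_add[OF unit_mod_mult[OF this b]] show ?thesis
      by (simp add: modulus_def d algebra_simps)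
  qed
  consider "i < j" | "j < i" using assms(4) by force
  then show ?thesis
    by cases (use * assms unit_mod_sym modulus_pos in blast)+
qed

text \<open>
  The product of the preceding moduli is constructed by induction together with its inverse, so
  that the induction is for an existential formula.
\<close>

lemma ex_multiple_unit:
  fixes b n l :: "'a::rca0_model"
  assumes b: "admissible b n" and "l \<le> n"
  shows "\<exists>M. unit_mod M (modulus b l) \<and> (\<forall>i<l. modulus b i dvd M)"
proof -
  have "\<exists>M u w. j \<le> l \<longrightarrow> u * M = 1 + w * modulus b l \<and> (\<forall>i<j. modulus b i dvd M)" for j
  proof (induction j rule: sig1_induct)
    case definable
    show ?case by (intro sig1_ex sig1_delta0 bounded_rules bfun_modulus)
  next
    case zero
    show ?case by (intro exI[of _ 1] exI[of _ 1] exI[of _ 0]) auto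
  next
    case (step j)
    show ?case
    proof (cases "j + 1 \<le> l")
      case True
      then have "j < l" by (simp add: less_iff_add_one_le)
      with step obtain M u w where M: "u * M = 1 + w * modulus b l" "\<And>i. i < j \<Longrightarrow> modulus b i dvd M"
        by (meson order_less_imp_le)
      have "unit_mod (modulus b j) (modulus b l)"
        by (rule unit_mod_modulus[OF b]) (use \<open>j < l\<close> assms(2) in auto)
      moreover have "unit_mod M (modulus b l)" using M(1) unfolding unit_mod_def by blast
      ultimately obtain u' w' where "u' * (M * modulus b j) = 1 + w' * modulus b l"
        using unit_mod_mult unfolding unit_mod_def by blast
      moreover have "modulus b i dvd M * modulus b j" if "i < j + 1" for i
        using that M(2)[of i] by (cases "i = j") (auto simp: less_add_one_iff)
      ultimately show ?thesis by blast
    qed auto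
  qed
  then show ?thesis unfolding unit_mod_def by (meson order_refl)
qed

lemma ex_multiple:
  fixes b n :: "'a::rca0_model"
  assumes "admissible b n"
  shows "\<exists>P>0. \<forall>i<n. modulus b i dvd P"
proof -
  obtain P where P: "unit_mod P (modulus b n)" "\<forall>i<n. modulus b i dvd P"
    using ex_multiple_unit[OF assms order_refl] by blast
  then have "P \<noteq> 0" by (auto simp: unit_mod_def)
  with P show ?thesis by (auto simp: zero_less_iff_neq_zero)
qed

text \<open>
  By induction on \<open>l\<close>: adding a multiple of the preceding moduli corrects the remainder for
  the new modulus and does not disturb the others.
\<close>

lemma chinese_remainder:
  fixes b n :: "'a::rca0_model"
  assumes b: "admissible b n" and F: "delta0 (\<lambda>e. F (e 0) = e 1)" "\<And>i. F i \<le> b"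
    and "l \<le> n"
  shows "\<exists>a. \<forall>i<l. rem a (modulus b i) = F i"
proof -
  have "\<exists>a. l \<le> n \<longrightarrow> (\<forall>i<l. rem a (modulus b i) = F i)"
  proof (induction l rule: sig1_induct)
    case definable
    show ?case by (intro sig1_ex sig1_delta0 bounded_rules bfun_modulus bfun_fun_const[OF F])
  next
    case zero
    show ?case by auto
  next
    case (step l)
    show ?case
    proof (cases "l + 1 \<le> n")
      case True
      then have l: "l \<le> n" using less_iff_add_one_le[of l n] by simp
      with step obtain a where a: "\<And>i. i < l \<Longrightarrow> rem a (modulus b i) = F i" by blast
      obtain M u w where M: "u * M = 1 + w * modulus b l" "\<And>i. i < l \<Longrightarrow> modulus b i dvd M"
        using ex_multiple_unit[OF b l] unfolding unit_mod_def by blast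
      let ?m = "modulus b l"
      \<comment> \<open>\<open>h * a\<close> is minus \<open>a\<close> modulo \<open>?m\<close>.\<close>
      obtain h where h: "?m = h + 1" using modulus_pos[of b l] by (cases ?m rule: zero_or_add_one) auto
      define a' where "a' = a + (u * (F l + h * a)) * M"
      have "rem a' (modulus b i) = F i" if "i < l + 1" for i
      proof (cases "i = l")
        case True
        have "a' = a + (u * M) * (F l + h * a)" unfolding a'_def by (simp add: ac_simps)
        also have "\<dots> = F l + (a + w * (F l + h * a)) * ?m" unfolding M(1) by (simp add: h algebra_simps)
        finally have "rem a' ?m = rem (F l) ?m" by (simp add: rem_add_mult)
        also have "\<dots> = F l"
          using F(2)[of l] less_modulus[of b l] by (subst rem_eq_iff) (auto intro!: exI[of _ 0])
        finally show ?thesis using True by simp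
      next
        case False
        with that have i: "i < l" by (simp add: less_add_one_iff)
        obtain k where "M = modulus b i * k" using M(2)[OF i] by (auto elim: dvdE)
        then have "a' = a + (u * (F l + h * a) * k) * modulus b i"
          unfolding a'_def by (simp add: ac_simps)
        then show ?thesis using a[OF i] by (simp add: rem_add_mult)
      qed
      then show ?thesis by blast
    qed auto
  qed
  with assms(4) show ?thesis by blast
qed

text \<open>
  Only the remainder of \<open>a\<close> modulo a common multiple of the moduli matters, which bounds \<open>a\<close>
  independently of \<open>F\<close>. This keeps the codes of short strings with small entries bounded.
\<close>

lemma beta_bounded:
  fixes n c :: "'a::rca0_model"
  shows "\<exists>b C. \<forall>F l. delta0 (\<lambda>e. F (e 0) = e 1) \<longrightarrow> (\<forall>i. F i \<le> c) \<longrightarrow> l \<le> n \<longrightarrow>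
    (\<exists>a\<le>C. \<forall>i<l. rem a (modulus b i) = F i)"
proof -
  obtain b where b: "admissible b n" "c \<le> b" using ex_admissible by blast
  obtain P where P: "0 < P" "\<And>i. i < n \<Longrightarrow> modulus b i dvd P" using ex_multiple[OF b(1)] by blast
  have "\<exists>a\<le>P. \<forall>i<l. rem a (modulus b i) = F i"
    if "delta0 (\<lambda>e. F (e 0) = e 1)" "\<forall>i. F i \<le> c" "l \<le> n" for F l
  proof -
    have "F i \<le> b" for i using that(2) b(2) order_trans by blast
    from chinese_remainder[OF b(1) that(1) this that(3)]
    obtain a where a: "\<forall>i<l. rem a (modulus b i) = F i" by blast
    have "rem (rem a P) (modulus b i) = F i" if "i < l" for i
      using rem_rem_dvd[OF modulus_pos P(1) P(2)] a that \<open>l \<le> n\<close> by (metis order_less_le_trans)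
    moreover have "rem a P \<le> P" using rem_less[OF P(1)] by (rule order_less_imp_le)
    ultimately show ?thesis by blast
  qed
  then show ?thesis by blast
qed

text \<open>
  Among the numbers that are divisible by the modulus of each \<open>x < n\<close> for which no witness is
  below some bound, the least one is divisible by no other modulus: the modulus of an \<open>x\<close> with
  a witness could be divided out after enlarging the bound.
\<close>

lemma strong_bounding:
  fixes n :: "'a::rca0_model"
  assumes Q: "delta0 (\<lambda>e. Q (e 0) (e 1))"
  shows "\<exists>c. \<forall>x<n. (\<exists>y. Q x y) \<longrightarrow> (\<exists>y<c. Q x y)"
proof -
  obtain b where b: "admissible b n" using ex_admissible[of n 0] by blast
  obtain P where P: "0 < P" "\<And>i. i < n \<Longrightarrow> modulus b i dvd P" using ex_multiple[OF b] by blast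
  let ?\<phi> = "\<lambda>d. \<exists>c. 0 < d \<and> (\<forall>x<n. modulus b x dvd d \<or> (\<exists>y<c. Q x y))"
  have "sig1 (\<lambda>e. ?\<phi> (e 0))"
    by (intro sig1_ex sig1_delta0 bounded_rules bfun_modulus delta0_subst2[OF Q])
  moreover have "?\<phi> P" using P by blast
  ultimately obtain d where d: "?\<phi> d" "\<And>d'. d' < d \<Longrightarrow> \<not> ?\<phi> d'"
    using sig1_least[of ?\<phi> P] by blast
  then obtain c where c: "0 < d" "\<And>x. x < n \<Longrightarrow> modulus b x dvd d \<or> (\<exists>y<c. Q x y)" by blast
  have "\<exists>y<c. Q x y" if x: "x < n" "Q x y" for x y
  proof (rule ccontr)
    assume "\<not> ?thesis"
    with c x obtain d' where d': "d = modulus b x * d'" by (auto elim: dvdE)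
    have "d' \<noteq> 0" using c(1) d' by auto
    have "1 \<le> b" using b less_iff_add_one_le[of 0 b] by (simp add: admissible_def)
    then have "1 < modulus b x" using less_modulus[of b x] by order
    then have "1 * d' < modulus b x * d'"
      using \<open>d' \<noteq> 0\<close> by (intro mult_strict_right_mono) (simp_all add: zero_less_iff_neq_zero)
    then have "d' < d" by (simp add: d')
    define c' where "c' = c + (y + 1)"
    have "modulus b z dvd d' \<or> (\<exists>y<c'. Q z y)" if z: "z < n" for z
    proof (cases "z = x")
      case True
      have "y < c'" by (simp add: c'_def less_add_one_iff flip: add.assoc)
      with x True show ?thesis by blast
    next
      case False
      have "unit_mod (modulus b x) (modulus b z)"
        by (rule unit_mod_modulus[OF b]) (use x z False in auto)
      then have "modulus b z dvd d \<Longrightarrow> modulus b z dvd d'"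
        unfolding d' by (rule unit_mod_dvd_mult)
      moreover have "c \<le> c'" by (simp add: c'_def)
      ultimately show ?thesis using c(2)[OF z] by (meson order_less_le_trans)
    qed
    then have "?\<phi> d'" using \<open>d' \<noteq> 0\<close> by (auto simp: zero_less_iff_neq_zero)
    with d(2) \<open>d' < d\<close> show False by blast
  qed
  then show ?thesis by blast
qed

section \<open>Strings in a model\<close>

text \<open>
  Length and entries are made total by the value 0 on numbers that do not describe a string.
\<close>

definition desc :: "'a::rca0_model \<Rightarrow> bool" where
  "desc s \<longleftrightarrow> (\<exists>l a b. s = pr l (pr a b))"

definition slen :: "'a::rca0_model \<Rightarrow> 'a" where
  "slen s = (if desc s then THE l. \<exists>a b. s = pr l (pr a b) else 0)"

definition ent :: "'a::rca0_model \<Rightarrow> 'a \<Rightarrow> 'a" where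
  "ent s i = (if desc s then THE v. \<exists>l a b. s = pr l (pr a b) \<and> v = rem a (modulus b i) else 0)"

lemma desc_pr [simp]: "desc (pr l (pr a b))"
  unfolding desc_def by blast

lemma slen_pr [simp]: "slen (pr l (pr a b)) = l"
  unfolding slen_def by simp

lemma ent_pr [simp]: "ent (pr l (pr a b)) i = rem a (modulus b i)"
  unfolding ent_def by simp

lemma triple_ge: "l \<le> pr l (pr a b)" "a \<le> pr l (pr a b)" "b \<le> pr l (pr a b)"
  by (rule pr_ge, rule order_trans[OF pr_ge(1) pr_ge(2)], rule order_trans[OF pr_ge(2) pr_ge(2)])

lemma desc_bounded: "desc s \<longleftrightarrow> (\<exists>l\<le>s. \<exists>a\<le>s. \<exists>b\<le>s. s = pr l (pr a b))"
proof
  assume "desc s"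
  then obtain l a b where "s = pr l (pr a b)" unfolding desc_def by blast
  then show "\<exists>l\<le>s. \<exists>a\<le>s. \<exists>b\<le>s. s = pr l (pr a b)"
    by (intro exI[of _ l] exI[of _ a] exI[of _ b] conjI) (simp_all add: triple_ge)
qed auto

lemma slen_eq_iff:
  "slen s = l \<longleftrightarrow> (\<exists>a\<le>s. \<exists>b\<le>s. s = pr l (pr a b)) \<or> (\<not> desc s \<and> l = 0)"
proof (cases "desc s")
  case True
  then obtain l' a b where s: "s = pr l' (pr a b)" unfolding desc_def by blast
  then have "a \<le> s" "b \<le> s" by (simp_all add: triple_ge)
  with s show ?thesis by auto
qed (auto simp: slen_def)

lemma ent_eq_iff:
  "ent s i = v \<longleftrightarrow> (\<exists>l\<le>s. \<exists>a\<le>s. \<exists>b\<le>s. s = pr l (pr a b) \<and> rem a (modulus b i) = v)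
     \<or> (\<not> desc s \<and> v = 0)"
proof (cases "desc s")
  case True
  then obtain l a b where s: "s = pr l (pr a b)" unfolding desc_def by blast
  then have "l \<le> s" "a \<le> s" "b \<le> s" by (simp_all add: triple_ge)
  with s show ?thesis by auto
qed (auto simp: ent_def)

lemma slen_le: "slen s \<le> s"
proof (cases "desc s")
  case True
  then show ?thesis by (auto simp: desc_def pr_ge)
qed (simp add: slen_def)

lemma ent_le: "ent s i \<le> s"
proof (cases "desc s")
  case True
  then obtain l a b where s: "s = pr l (pr a b)" unfolding desc_def by blast
  then have "ent s i \<le> a" by (simp add: rem_le)
  also have "a \<le> s" using s by (simp add: triple_ge)
  finally show ?thesis .
qed (simp add: ent_def)

lemma delta0_desc: "bfun S \<Longrightarrow> delta0 (\<lambda>e. desc (S e))"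
proof (rule delta0_subst1)
  show "delta0 (\<lambda>e. desc (e 0 :: 'a))"
    unfolding desc_bounded by (intro bounded_rules)
qed

lemma bfun_slen: "bfun S \<Longrightarrow> bfun (\<lambda>e. slen (S e))"
proof (rule bfun_fun1[where f = slen])
  show "delta0 (\<lambda>e. slen (e 0) = (e 1 :: 'a))"
    unfolding slen_eq_iff by (intro bounded_rules delta0_desc)
qed (rule slen_le)

lemma bfun_ent: "bfun S \<Longrightarrow> bfun T \<Longrightarrow> bfun (\<lambda>e. ent (S e) (T e))"
proof (rule bfun_fun2[where f = ent])
  show "delta0 (\<lambda>e. ent (e 0) (e 1) = (e 2 :: 'a))"
    unfolding ent_eq_iff by (intro bounded_rules delta0_desc bfun_modulus)
qed (rule ent_le)

definition same_entries :: "'a::rca0_model \<Rightarrow> 'a \<Rightarrow> 'a \<Rightarrow> bool" where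
  "same_entries s t k \<longleftrightarrow> (\<forall>i<k. ent s i = ent t i)"

definition is_string :: "'a::rca0_model \<Rightarrow> bool" where
  "is_string s \<longleftrightarrow> desc s \<and> (\<forall>t<s. \<not> (desc t \<and> slen t = slen s \<and> same_entries t s (slen s)))"

definition initseg :: "'a::rca0_model \<Rightarrow> 'a \<Rightarrow> bool" where
  "initseg s t \<longleftrightarrow> is_string s \<and> is_string t \<and> slen s \<le> slen t \<and> same_entries s t (slen s)"

definition snoc :: "'a::rca0_model \<Rightarrow> 'a \<Rightarrow> 'a \<Rightarrow> bool" where
  "snoc s n t \<longleftrightarrow> is_string s \<and> is_string t \<and> slen t = slen s + 1 \<and> same_entries s t (slen s) \<and>
     ent t (slen s) = n"

lemma delta0_same_entries:
  "bfun S \<Longrightarrow> bfun T \<Longrightarrow> bfun U \<Longrightarrow> delta0 (\<lambda>e. same_entries (S e) (T e) (U e))"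
proof (rule delta0_subst3[where P = same_entries])
  show "delta0 (\<lambda>e. same_entries (e 0) (e 1) (e 2 :: 'a))"
    unfolding same_entries_def by (intro bounded_rules bfun_ent)
qed

lemma delta0_is_string: "bfun S \<Longrightarrow> delta0 (\<lambda>e. is_string (S e))"
proof (rule delta0_subst1[where P = is_string])
  show "delta0 (\<lambda>e. is_string (e 0 :: 'a))"
    unfolding is_string_def by (intro bounded_rules bfun_slen delta0_desc delta0_same_entries)
qed

lemma delta0_initseg: "bfun S \<Longrightarrow> bfun T \<Longrightarrow> delta0 (\<lambda>e. initseg (S e) (T e))"
proof (rule delta0_subst2[where P = initseg])
  show "delta0 (\<lambda>e. initseg (e 0) (e 1 :: 'a))"
    unfolding initseg_def by (intro bounded_rules bfun_slen delta0_is_string delta0_same_entries)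
qed

lemma delta0_snoc: "bfun S \<Longrightarrow> bfun T \<Longrightarrow> bfun U \<Longrightarrow> delta0 (\<lambda>e. snoc (S e) (T e) (U e))"
proof (rule delta0_subst3[where P = snoc])
  show "delta0 (\<lambda>e. snoc (e 0) (e 1) (e 2 :: 'a))"
    unfolding snoc_def by (intro bounded_rules bfun_slen bfun_ent delta0_is_string delta0_same_entries)
qed

lemmas string_rules = bounded_rules bfun_slen bfun_ent
  delta0_desc delta0_same_entries delta0_is_string delta0_initseg delta0_snoc

lemma same_entries_refl [simp]: "same_entries s s k"
  by (simp add: same_entries_def)

lemma same_entries_sym: "same_entries s t k \<Longrightarrow> same_entries t s k"
  by (simp add: same_entries_def)

lemma same_entries_trans: "same_entries s t k \<Longrightarrow> same_entries t u k \<Longrightarrow> same_entries s u k"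
  by (simp add: same_entries_def)

lemma same_entries_mono: "same_entries s t k \<Longrightarrow> j \<le> k \<Longrightarrow> same_entries s t j"
  by (auto simp: same_entries_def)

lemma string_eqI:
  assumes "is_string s" "is_string t" "slen s = slen t" "same_entries s t (slen s)"
  shows "s = t"
  using assms unfolding is_string_def same_entries_def by (metis linorder_less_linear)

lemma initseg_trans: "initseg s t \<Longrightarrow> initseg t u \<Longrightarrow> initseg s u"
  unfolding initseg_def by (meson order_trans same_entries_mono same_entries_trans)

lemma ex_string_le:
  fixes d :: "'a::rca0_model"
  assumes "desc d"
  shows "\<exists>s\<le>d. is_string s \<and> slen s = slen d \<and> same_entries s d (slen d)"
proof -
  have "delta0 (\<lambda>e. desc (e 0) \<and> slen (e 0) = slen d \<and> same_entries (e 0) d (slen d))"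
    by (intro string_rules)
  from delta0_least[of "\<lambda>s. desc s \<and> slen s = slen d \<and> same_entries s d (slen d)", OF this, of d] assms
  obtain s where s: "s \<le> d" "desc s" "slen s = slen d" "same_entries s d (slen d)"
    and least: "\<And>t. t < s \<Longrightarrow> \<not> (desc t \<and> slen t = slen d \<and> same_entries t d (slen d))"
    by auto
  have "is_string s"
    unfolding is_string_def using s least by (metis same_entries_trans)
  with s show ?thesis by blast
qed

text \<open>
  The beta function supplies a description, and the least number with the same length and
  entries is a code.
\<close>

lemma ex_string:
  fixes c :: "'a::rca0_model"
  assumes "delta0 (\<lambda>e. F (e 0) = e 1)" "\<And>i. F i \<le> c"
  shows "\<exists>s. is_string s \<and> slen s = l \<and> (\<forall>i<l. ent s i = F i)"
proof -
  obtain b a where "\<forall>i<l. rem a (modulus b i) = F i"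
    using beta_bounded[of c l] assms by (meson order_refl)
  then show ?thesis using ex_string_le[of "pr l (pr a b)"] by (auto simp: same_entries_def)
qed

lemma ex_restriction:
  fixes s :: "'a::rca0_model"
  shows "\<exists>t. is_string t \<and> slen t = k \<and> same_entries t s k"
  unfolding same_entries_def
  by (rule ex_string[of _ s]) (intro string_rules ent_le)+

lemma ex_initseg:
  assumes "is_string s" "k \<le> slen s"
  shows "\<exists>t. initseg t s \<and> slen t = k"
  using ex_restriction[of k s] assms unfolding initseg_def by blast

lemma ex_snoc:
  fixes s n :: "'a::rca0_model"
  assumes "is_string s"
  shows "\<exists>t. snoc s n t"
proof -
  let ?F = "\<lambda>i. if i = slen s then n else ent s i"
  have "?F i = v \<longleftrightarrow> (i = slen s \<and> n = v) \<or> (i \<noteq> slen s \<and> ent s i = v)" for i v by auto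
  moreover have "delta0 (\<lambda>e. (e 0 = slen s \<and> n = e 1) \<or> (e 0 \<noteq> slen s \<and> ent s (e 0) = e 1))"
    by (intro string_rules)
  ultimately have "delta0 (\<lambda>e. ?F (e 0) = e 1)" by (simp only:)
  moreover have "?F i \<le> s + n" for i using ent_le[of s i] by (auto intro: add_increasing2 add_increasing)
  ultimately obtain t where "is_string t" "slen t = slen s + 1" "\<forall>i<slen s + 1. ent t i = ?F i"
    using ex_string[of ?F "s + n" "slen s + 1"] by blast
  moreover have "slen s < slen s + 1" by (simp add: less_add_one_iff)
  ultimately have "snoc s n t"
    using assms by (auto simp: snoc_def same_entries_def less_add_one_iff)
  then show ?thesis by blast
qed

lemma pr_mono: "x \<le> x' \<Longrightarrow> y \<le> y' \<Longrightarrow> pr x y \<le> pr x' y'"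
  unfolding pr_def by (intro add_mono mult_mono) simp_all

text \<open>
  The code of a string is at most as large as any description of it, and one of those is
  bounded in terms of \<open>n\<close> and \<open>c\<close>.
\<close>

lemma strings_bounded:
  fixes n c :: "'a::rca0_model"
  shows "\<exists>C. \<forall>s. is_string s \<longrightarrow> slen s \<le> n \<longrightarrow> (\<forall>i<slen s. ent s i \<le> c) \<longrightarrow> s \<le> C"
proof -
  obtain b C where C: "\<And>F l. delta0 (\<lambda>e. F (e 0) = e 1) \<Longrightarrow> (\<And>i. F i \<le> c) \<Longrightarrow> l \<le> n \<Longrightarrow>
    \<exists>a\<le>C. \<forall>i<l. rem a (modulus b i) = F i"
    using beta_bounded[of c n] by blast
  have "s \<le> pr n (pr C b)" if s: "is_string s" "slen s \<le> n" "\<forall>i<slen s. ent s i \<le> c" for s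
  proof -
    let ?F = "\<lambda>i. if ent s i \<le> c then ent s i else c"
    have "?F i = v \<longleftrightarrow> (ent s i \<le> c \<and> ent s i = v) \<or> (\<not> ent s i \<le> c \<and> c = v)" for i v by auto
    moreover have "delta0 (\<lambda>e. (ent s (e 0) \<le> c \<and> ent s (e 0) = e 1) \<or> (\<not> ent s (e 0) \<le> c \<and> c = e 1))"
      by (intro string_rules)
    ultimately have "delta0 (\<lambda>e. ?F (e 0) = e 1)" by (simp only:)
    moreover have "?F i \<le> c" for i by simp
    ultimately obtain a where a: "a \<le> C" "\<forall>i<slen s. rem a (modulus b i) = ?F i"
      using C[of ?F "slen s"] s(2) by blast
    obtain t where t: "t \<le> pr (slen s) (pr a b)" "is_string t" "slen t = slen s"
      "same_entries t (pr (slen s) (pr a b)) (slen s)"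
      using ex_string_le[of "pr (slen s) (pr a b)"] by auto
    have "t = s" by (rule string_eqI) (use t a s in \<open>auto simp: same_entries_def\<close>)
    with t(1) have "s \<le> pr (slen s) (pr a b)" by simp
    also have "\<dots> \<le> pr n (pr C b)" using s(2) a(1) by (intro pr_mono) simp_all
    finally show ?thesis .
  qed
  then show ?thesis by blast
qed


section \<open>The meaning of Ramsey-type Koenig's lemma in a model\<close>

definition tree :: "'a::rca0_model set \<Rightarrow> bool" where
  "tree T \<longleftrightarrow> (\<forall>s\<in>T. is_string s \<and> (\<forall>t. initseg t s \<longrightarrow> t \<in> T))"

definition fin_branching :: "'a::rca0_model set \<Rightarrow> bool" where
  "fin_branching T \<longleftrightarrow> (\<forall>s\<in>T. \<exists>k. \<forall>n. (\<exists>t\<in>T. snoc s n t) \<longrightarrow> n < k)"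

text \<open>
  In a model, a set is infinite in the sense of \<open>infinitely_many\<close> iff it is unbounded.
\<close>

definition unbounded :: "'a::rca0_model set \<Rightarrow> bool" where
  "unbounded X \<longleftrightarrow> (\<forall>k. \<exists>x\<in>X. k \<le> x)"

definition partial_fun :: "'a::rca0_model set \<Rightarrow> 'a set \<Rightarrow> bool" where
  "partial_fun H D \<longleftrightarrow> (\<forall>h\<in>H. \<exists>x y. h = pr x y) \<and> (\<forall>x y z. pr x y \<in> H \<and> pr x z \<in> H \<longrightarrow> y = z) \<and>
     (\<forall>x. x \<in> D \<longleftrightarrow> (\<exists>y. pr x y \<in> H))"

definition hom :: "'a::rca0_model set \<Rightarrow> 'a set \<Rightarrow> 'a \<Rightarrow> bool" where
  "hom H D s \<longleftrightarrow> (\<forall>n\<in>D. desc s \<and> n < slen s \<longrightarrow> pr n (ent s n) \<in> H)"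

lemma tval_pair [simp]: "tval mdl e (pair t u) = pr (tval mdl e t) (tval mdl e u)"
  by (simp add: pair_def pr_def)

lemma eval_str_len [simp]:
  "eval mdl e s (str_len t u) \<longleftrightarrow> desc (tval mdl e t) \<and> slen (tval mdl e t) = tval mdl e u"
  unfolding str_len_def eval_abbreviations by (auto simp: desc_def)

lemma eval_str_nth [simp]:
  "eval mdl e s (str_nth t u v) \<longleftrightarrow>
     desc (tval mdl e t) \<and> ent (tval mdl e t) (tval mdl e u) = tval mdl e v"
  unfolding str_nth_def eval_abbreviations
  by (auto simp: desc_def numeral_eq_Suc rem_eq_iff modulus_def[symmetric])

text \<open>
  Rewrites only implications with an inequality as premise, and hence leaves defined
  connectives intact.
\<close>

lemma eval_imp_less: "eval M e s (t \<^bold>< u \<^bold>\<longrightarrow> p) \<longleftrightarrow> (eval M e s (t \<^bold>< u) \<longrightarrow> eval M e s p)"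
  by simp

lemma eval_agree:
  "eval mdl e s (agree t u k) \<longleftrightarrow>
     (\<forall>i<tval mdl e k. \<forall>v. (desc (tval mdl e t) \<and> ent (tval mdl e t) i = v) \<longleftrightarrow>
        (desc (tval mdl e u) \<and> ent (tval mdl e u) i = v))"
  unfolding agree_def eval.simps(6) eval_imp_less eval_abbreviations(3) by simp

lemma eval_agree_desc [simp]:
  "desc (tval mdl e t) \<Longrightarrow> desc (tval mdl e u) \<Longrightarrow>
   eval mdl e s (agree t u k) \<longleftrightarrow> same_entries (tval mdl e t) (tval mdl e u) (tval mdl e k)"
  unfolding eval_agree same_entries_def by auto

lemma eval_is_str [simp]: "eval mdl e s (is_str t) \<longleftrightarrow> is_string (tval mdl e t)"
  unfolding is_str_def eval_abbreviations
  by (auto simp: is_string_def)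

lemma eval_initial_segment [simp]:
  "eval mdl e s (initial_segment t u) \<longleftrightarrow> initseg (tval mdl e t) (tval mdl e u)"
  unfolding initial_segment_def eval_abbreviations
  by (auto simp: initseg_def is_string_def less_add_one_iff)

lemma eval_is_snoc [simp]:
  "eval mdl e s (is_snoc t n u) \<longleftrightarrow> snoc (tval mdl e t) (tval mdl e n) (tval mdl e u)"
  unfolding is_snoc_def eval_abbreviations
  by (auto simp: snoc_def is_string_def)

lemma eval_is_tree [simp]: "eval mdl e s (is_tree T) \<longleftrightarrow> tree (s T)"
  unfolding is_tree_def eval.simps eval_abbreviations by (auto simp: tree_def)

lemma eval_finitely_branching [simp]: "eval mdl e s (finitely_branching T) \<longleftrightarrow> fin_branching (s T)"
  unfolding finitely_branching_def eval.simps eval_finitely_many eval_abbreviations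
  by (simp add: fin_branching_def numeral_2_eq_2 Ball_def Bex_def)

lemma eval_is_partial_function [simp]:
  "eval mdl e s (is_partial_function H D) \<longleftrightarrow> partial_fun (s H) (s D)"
  unfolding is_partial_function_def eval_abbreviations eval.simps
  by (auto simp: partial_fun_def numeral_2_eq_2)

lemma eval_homogeneous_for_str [simp]:
  "eval mdl e s (homogeneous_for_str H D t) \<longleftrightarrow> hom (s H) (s D) (tval mdl e t)"
  unfolding homogeneous_for_str_def eval.simps eval_abbreviations
  by (auto simp: hom_def)

lemma eval_homogeneous_for_tree [simp]:
  "eval mdl e s (homogeneous_for_tree H D T) \<longleftrightarrow> unbounded {t \<in> s T. hom (s H) (s D) t}"
  unfolding homogeneous_for_tree_def eval_infinitely_many eval_abbreviations
  by (auto simp: unbounded_def not_less)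

lemma valid_RKL:
  "valid (mdl :: 'a::rca0_model interp) RKL \<longleftrightarrow>
    (\<forall>T::'a set\<in>Sets. tree T \<and> unbounded T \<and> fin_branching T \<longrightarrow>
      (\<exists>H\<in>Sets. \<exists>D\<in>Sets. partial_fun H D \<and> unbounded D \<and> unbounded {s \<in> T. hom H D s}))"
    (is "_ \<longleftrightarrow> ?R")
proof -
  have "eval (mdl :: 'a interp) e s RKL \<longleftrightarrow> ?R" for e s
    unfolding RKL_def eval.simps(7) eval_abbreviations(1) eval.simps(5)
    by (simp add: unbounded_def not_less eval_abbreviations numeral_2_eq_2 Bex_def conj_ac)
  moreover obtain X :: "'a set" where "X \<in> Sets" using mdl.sets_nonempty by auto
  then have "range (\<lambda>_::nat. X) \<subseteq> sets mdl" by auto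
  ultimately show ?thesis unfolding valid_def by blast
qed

section \<open>From arithmetical comprehension to Ramsey-type Koenig's lemma\<close>

lemma arith_delta0: "delta0 R \<Longrightarrow> definable arithmetical mdl R"
proof -
  have arith: "arithmetical p" if "Sigma00 p" for p using that by (induction rule: Sigma00.induct) simp_all
  assume "delta0 R"
  then obtain p f s where "Sigma00 p" "range s \<subseteq> sets mdl" "\<And>e. R e \<longleftrightarrow> eval mdl (fill f e) s p"
    unfolding definable_def by blast
  with arith show ?thesis unfolding definable_def by blast
qed

text \<open>The parameters of a comprehension axiom are the values of its free variables.\<close>

lemma valid_ACA0:
  "(\<forall>p\<in>ACA0. valid (mdl :: 'a::rca0_model interp) p) \<longleftrightarrow>
    (\<forall>P :: 'a \<Rightarrow> bool. definable arithmetical mdl (\<lambda>e. P (e 0)) \<longrightarrow> {x. P x} \<in> Sets)"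
proof (intro iffI allI impI ballI)
  fix P :: "'a \<Rightarrow> bool"
  assume aca: "\<forall>p\<in>ACA0. valid (mdl :: 'a interp) p" and P: "definable arithmetical mdl (\<lambda>e. P (e 0))"
  obtain q e s where q: "arithmetical q" "range s \<subseteq> sets mdl"
    "\<And>x y. eval mdl (case_nat x (case_nat y e)) s q \<longleftrightarrow> P x"
    using arith.definable_binary[of mdl "\<lambda>x y. P x" "\<lambda>x y. P x"] P by metis
  have "comprehension_axiom q \<in> ACA0" using q(1) unfolding ACA0_def by blast
  then have "eval mdl (case_nat undefined e) s (comprehension_axiom q)"
    using aca q(2) unfolding valid_def by blast
  then show "{x. P x} \<in> Sets" by (simp add: eval_comprehension_axiom q(3))
next
  fix p assume comp: "\<forall>P :: 'a \<Rightarrow> bool. definable arithmetical mdl (\<lambda>e. P (e 0)) \<longrightarrow> {x. P x} \<in> Sets"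
    and p: "p \<in> ACA0"
  show "valid (mdl :: 'a interp) p"
  proof (cases "p \<in> RCA0")
    case True
    then show ?thesis by (rule mdl.rca0)
  next
    case False
    with p obtain q where q: "p = comprehension_axiom q" "arithmetical q" unfolding ACA0_def by blast
    have "eval (mdl :: 'a interp) e s p" if s: "range s \<subseteq> sets mdl" for e s
    proof -
      have "fill (case_nat (Inr 0) (\<lambda>n. Inl (e n))) e' = case_nat (e' 0) e" for e'
        by (auto simp: fun_eq_iff fill_def split: nat.split)
      then have "definable arithmetical mdl (\<lambda>e'. eval mdl (case_nat (e' 0) e) s q)"
        using q(2) s unfolding definable_def by metis
      from comp[rule_format, OF this] show ?thesis by (simp add: q(1) eval_comprehension_axiom)
    qed
    then show ?thesis unfolding valid_def by blast
  qed
qed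

text \<open>
  Let \<open>E\<close> be the set of the strings of the tree with infinitely many extensions in it. The set
  \<open>G\<close> is the leftmost path through \<open>E\<close>: no string in \<open>E\<close> branches off from its elements to the
  left. Its elements are compatible with each other. By finite branching each string in \<open>E\<close>
  has a child in \<open>E\<close>, and the leftmost such child of a string in \<open>G\<close> is in \<open>G\<close>. So \<open>G\<close> has a
  string of each length. The union of these strings is a homogeneous function, as they belong
  to the tree.
\<close>

lemma RKL_of_arithmetical_comprehension:
  fixes T :: "'a::rca0_model set"
  assumes comp: "\<And>P :: 'a \<Rightarrow> bool. definable arithmetical mdl (\<lambda>e. P (e 0)) \<Longrightarrow> {x. P x} \<in> Sets"
    and T: "T \<in> Sets" "tree T" "unbounded T" "fin_branching T"
  shows "\<exists>H\<in>Sets. \<exists>D\<in>Sets. partial_fun H D \<and> unbounded D \<and> unbounded {s \<in> T. hom H D s}"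
proof -
  define E where "E = {s. s \<in> T \<and> (\<forall>k. \<exists>t. t \<in> T \<and> initseg s t \<and> k \<le> t)}"
  have E: "E \<in> Sets"
    unfolding E_def
    by (rule comp, rule arith.definable_conj, rule arith_delta0, intro bfun_mem T string_rules,
        rule definable_all, rule definable_ex, rule arith_delta0, intro bfun_mem T string_rules)
  define G where "G = {s. s \<in> E \<and> (\<forall>t. t \<in> E \<longrightarrow>
    (\<forall>i<slen s. slen t = i + 1 \<longrightarrow> same_entries t s i \<longrightarrow> ent s i \<le> ent t i))}"
  have G: "G \<in> Sets"
    unfolding G_def
    by (rule comp, rule arith.definable_conj, rule arith_delta0, intro bfun_mem E string_rules,
        rule definable_all, rule arith_delta0, intro bfun_mem E string_rules)
  have E_T: "s \<in> T" "is_string s" if "s \<in> E" for s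
    using that T(2) by (auto simp: E_def tree_def)
  have E_down: "t \<in> E" if "s \<in> E" "initseg t s" for s t
    using that T(2) initseg_trans unfolding E_def tree_def by blast

  \<comment> \<open>Two strings of the path cannot branch at \<open>i\<close>, since the right one would see the left one.\<close>
  have G_le: "ent t i \<le> ent s i" if s: "s \<in> G" and t: "t \<in> G" and i: "i < slen s" "i < slen t"
    and same: "same_entries s t i" for s t i
  proof -
    have "s \<in> E" using s by (simp add: G_def)
    moreover have "i + 1 \<le> slen s" using i(1) by (simp add: less_iff_add_one_le)
    ultimately obtain r where r: "initseg r s" "slen r = i + 1" using ex_initseg E_T by blast
    have "r \<in> E" using E_down \<open>s \<in> E\<close> r(1) by blast
    have rs: "same_entries r s (i + 1)" using r unfolding initseg_def by simp
    then have "same_entries r t i"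
      using same same_entries_trans same_entries_mono by (metis add_increasing2 order_refl zero_le)
    with t \<open>r \<in> E\<close> r(2) i(2) have "ent t i \<le> ent r i" unfolding G_def by blast
    also have "ent r i = ent s i" using rs by (simp add: same_entries_def less_add_one_iff)
    finally show ?thesis .
  qed
  have G_same: "ent s i = ent t i" if s: "s \<in> G" and t: "t \<in> G" and i: "i < slen s" "i < slen t" for s t i
  proof -
    have "i < slen s \<longrightarrow> i < slen t \<longrightarrow> same_entries s t (i + 1)"
    proof (induction i rule: delta0_induct)
      case definable
      show ?case by (intro string_rules)
    next
      case zero
      have "ent s 0 = ent t 0" if "0 < slen s" "0 < slen t"
        using G_le[OF s t that] G_le[OF t s that(2,1)] by (simp add: same_entries_def)
      then show ?case by (auto simp: same_entries_def less_one_iff)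
    next
      case (step i)
      show ?case
      proof (intro impI)
        assume i: "i + 1 < slen s" "i + 1 < slen t"
        then have "i < slen s" "i < slen t" using less_add_one_iff[of i i] by (meson order_refl order.strict_trans)+
        with step have same: "same_entries s t (i + 1)" by blast
        then have "ent s (i + 1) = ent t (i + 1)"
          using G_le[OF s t i] G_le[OF t s i(2,1)] same_entries_sym by (meson order_antisym)
        with same show "same_entries s t (i + 1 + 1)"
          by (auto simp: same_entries_def less_add_one_iff order_le_less)
      qed
    qed
    with i show ?thesis by (simp add: same_entries_def less_add_one_iff)
  qed

  have G_zero: "\<exists>s. s \<in> G \<and> slen s = 0"
  proof -
    obtain t where t: "t \<in> T" using T(3) unfolding unbounded_def by blast
    then have "is_string t" using T(2) unfolding tree_def by blast
    then obtain s where s: "initseg s t" "slen s = 0" using ex_initseg[of t 0] by auto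
    have "s \<in> T" using T(2) t s(1) unfolding tree_def by blast
    moreover have "initseg s u" if "u \<in> T" for u
    proof -
      have "is_string u" using that T(2) unfolding tree_def by blast
      moreover have "is_string s" using s(1) unfolding initseg_def by blast
      ultimately show ?thesis by (simp add: initseg_def s(2) same_entries_def)
    qed
    ultimately have "s \<in> E" using T(3) unfolding E_def unbounded_def by blast
    then have "s \<in> G" using s(2) by (simp add: G_def)
    with s(2) show ?thesis by blast
  qed

  have child: "\<exists>n r. snoc s n r \<and> r \<in> E" if s: "s \<in> E" for s
  proof (rule ccontr)
    assume none: "\<not> ?thesis"
    obtain k where k: "\<And>n r. r \<in> T \<Longrightarrow> snoc s n r \<Longrightarrow> n < k"
      using T(4) E_T(1)[OF s] unfolding fin_branching_def by blast
    \<comment> \<open>Each child has boundedly many extensions, so the children below \<open>v\<close> do as well.\<close>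
    have "\<exists>K. \<forall>n r t. n < v \<longrightarrow> snoc s n r \<longrightarrow> t \<in> T \<longrightarrow> initseg r t \<longrightarrow> t < K" for v
    proof -
      define A where "A = {v. \<exists>K. \<forall>n r t. n < v \<longrightarrow> snoc s n r \<longrightarrow> t \<in> T \<longrightarrow> initseg r t \<longrightarrow> t < K}"
      have "A \<in> Sets"
        unfolding A_def
        by (rule comp, rule definable_ex, rule definable_all, rule definable_all, rule definable_all,
            rule arith_delta0, intro bfun_mem T string_rules)
      have "v \<in> A" for v
      proof (induction v rule: delta0_induct)
        case definable
        show ?case by (intro bfun_mem \<open>A \<in> Sets\<close> string_rules)
      next
        case zero
        show ?case by (simp add: A_def)
      next
        case (step v)
        then obtain K where K: "\<And>n r t. n < v \<Longrightarrow> snoc s n r \<Longrightarrow> t \<in> T \<Longrightarrow> initseg r t \<Longrightarrow> t < K"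
          unfolding A_def by blast
        obtain r where r: "snoc s v r" using ex_snoc E_T(2)[OF s] by blast
        have "\<exists>L. \<forall>t. t \<in> T \<longrightarrow> initseg r t \<longrightarrow> t < L"
        proof (cases "r \<in> T")
          case True
          moreover have "r \<notin> E" using none r by blast
          ultimately obtain L where "\<And>t. t \<in> T \<Longrightarrow> initseg r t \<Longrightarrow> \<not> L \<le> t" unfolding E_def by blast
          then show ?thesis unfolding not_le by blast
        next
          case False
          then show ?thesis using T(2) unfolding tree_def by blast
        qed
        then obtain L where L: "\<And>t. t \<in> T \<Longrightarrow> initseg r t \<Longrightarrow> t < L" by blast
        have unique: "r' = r" if "snoc s v r'" for r'
        proof (rule string_eqI)
          show "same_entries r' r (slen r')"
            using that r by (auto simp: snoc_def same_entries_def less_add_one_iff order_le_less)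
        qed (use that r in \<open>auto simp: snoc_def\<close>)
        have "t < max K L" if "n < v + 1" "snoc s n r'" "t \<in> T" "initseg r' t" for n r' t
          using K[of n r' t] L[of t] unique[of r'] that
          by (cases "n = v") (auto simp: less_add_one_iff less_max_iff_disj)
        then show ?case unfolding A_def by blast
      qed
      then show ?thesis unfolding A_def by blast
    qed
    then obtain K where K: "\<And>n r t. n < k \<Longrightarrow> snoc s n r \<Longrightarrow> t \<in> T \<Longrightarrow> initseg r t \<Longrightarrow> t < K" by blast
    obtain t where t: "t \<in> T" "initseg s t" "max K (s + 1) \<le> t"
      using s unfolding E_def by blast
    have "s + 1 \<le> t" using t(3) by simp
    then have "s < t" by (simp add: less_iff_add_one_le)
    have "slen s \<noteq> slen t" using string_eqI[of s t] t(2) \<open>s < t\<close> by (auto simp: initseg_def)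
    then have "slen s < slen t" using t(2) by (simp add: initseg_def order_le_less)
    then have "slen s + 1 \<le> slen t" by (simp only: less_iff_add_one_le)
    then obtain r where r: "initseg r t" "slen r = slen s + 1"
      using ex_initseg t(2) unfolding initseg_def by blast
    have "snoc s (ent r (slen s)) r"
    proof -
      have "slen s \<le> slen s + 1" by simp
      then have "same_entries r t (slen s)" using r same_entries_mono unfolding initseg_def by metis
      then show ?thesis
        using r t(2) unfolding snoc_def initseg_def by (metis same_entries_sym same_entries_trans)
    qed
    moreover have "r \<in> T" using T(2) t(1) r(1) unfolding tree_def by blast
    ultimately have "t < K" using K k t(1) r(1) by blast
    then show False using t(3) by auto
  qed

  have G_step: "\<exists>r. r \<in> G \<and> slen r = slen s + 1" if s: "s \<in> G" for s
  proof -
    have sE: "s \<in> E" using s by (simp add: G_def)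
    define A where "A = {n. \<exists>r. snoc s n r \<and> r \<in> E}"
    have "A \<in> Sets"
      unfolding A_def
      by (rule comp, rule definable_ex, rule arith_delta0, intro bfun_mem E string_rules)
    moreover obtain n where "n \<in> A" using child[OF sE] unfolding A_def by blast
    ultimately obtain m where m: "m \<in> A" "\<And>n. n < m \<Longrightarrow> n \<notin> A"
      using delta0_least[of "\<lambda>n. n \<in> A" n] bfun_mem[OF _ bfun_var] by blast
    then obtain r where r: "snoc s m r" "r \<in> E" unfolding A_def by blast
    have "ent r i \<le> ent t i" if t: "t \<in> E" "slen t = i + 1" "same_entries t r i" and i: "i < slen r" for t i
    proof -
      consider "i < slen s" | "i = slen s" using i r(1) by (auto simp: snoc_def less_add_one_iff order_le_less)
      then show ?thesis
      proof cases
        case 1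
        then have "same_entries r s i" "ent r i = ent s i"
          using r(1) by (auto simp: snoc_def same_entries_def)
        moreover from this have "same_entries t s i" using t(3) same_entries_trans by blast
        ultimately show ?thesis using s t 1 unfolding G_def by auto
      next
        case 2
        then have "snoc s (ent t i) t"
          using r(1) t E_T(2) unfolding snoc_def by (metis same_entries_sym same_entries_trans)
        then have "ent t i \<in> A" using t(1) unfolding A_def by blast
        then have "m \<le> ent t i" using m(2) not_less by blast
        with 2 r(1) show ?thesis by (simp add: snoc_def)
      qed
    qed
    then have "r \<in> G" using r(2) unfolding G_def by blast
    then show ?thesis using r(1) unfolding snoc_def by blast
  qed

  have G_len: "\<exists>s. s \<in> G \<and> slen s = n" for n
  proof -
    define A where "A = {n. \<exists>s. s \<in> G \<and> slen s = n}"
    have "A \<in> Sets"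
      unfolding A_def
      by (rule comp, rule definable_ex, rule arith_delta0, intro bfun_mem G string_rules)
    have "n \<in> A" for n
    proof (induction n rule: delta0_induct)
      case definable
      show ?case by (intro bfun_mem \<open>A \<in> Sets\<close> string_rules)
    next
      case zero
      show ?case using G_zero by (simp add: A_def)
    next
      case (step n)
      then show ?case using G_step unfolding A_def by blast
    qed
    then show ?thesis unfolding A_def by blast
  qed

  define H where "H = {h. \<exists>s i. s \<in> G \<and> i < slen s \<and> h = pr i (ent s i)}"
  have H: "H \<in> Sets"
    unfolding H_def
    by (rule comp, rule definable_ex, rule definable_ex, rule arith_delta0, intro bfun_mem G string_rules)
  have "{x. True} \<in> Sets" by (rule delta0_comprehension) (intro string_rules)
  then have D: "(UNIV :: 'a set) \<in> Sets" by simp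
  have "partial_fun H UNIV"
    unfolding partial_fun_def
  proof (intro conjI allI ballI impI)
    show "\<exists>x y. h = pr x y" if "h \<in> H" for h using that unfolding H_def by blast
    show "y = z" if "pr x y \<in> H \<and> pr x z \<in> H" for x y z
      using that G_same unfolding H_def by auto
    show "x \<in> UNIV \<longleftrightarrow> (\<exists>y. pr x y \<in> H)" for x
    proof -
      obtain s where "s \<in> G" "slen s = x + 1" using G_len by blast
      moreover have "x < x + 1" by (simp add: less_add_one_iff)
      ultimately have "pr x (ent s x) \<in> H" unfolding H_def by (auto intro!: exI[of _ s])
      then show ?thesis by blast
    qed
  qed
  moreover have "unbounded (UNIV :: 'a set)" unfolding unbounded_def by blast
  moreover have "unbounded {s \<in> T. hom H UNIV s}"
    unfolding unbounded_def
  proof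
    fix k
    obtain s where s: "s \<in> G" "slen s = k" using G_len by blast
    have "hom H UNIV s" using s(1) unfolding hom_def H_def by blast
    moreover have "s \<in> T" using s(1) E_T(1) unfolding G_def by blast
    moreover have "k \<le> s" using slen_le[of s] s(2) by simp
    ultimately show "\<exists>s\<in>{s \<in> T. hom H UNIV s}. k \<le> s" by blast
  qed
  ultimately show ?thesis using H D by blast
qed

section \<open>From Ramsey-type Koenig's lemma to existential comprehension\<close>

text \<open>
  The entry at \<open>i\<close> of a string of the tree is a bound below which each \<open>x < i\<close> has a witness,
  if it has one below the length of the string. This condition is inherited by initial
  segments. The bound is also required to be the least one that bounds the least witnesses of
  those \<open>x < i\<close> which have a witness below it. Then it cannot exceed a bound on all least
  witnesses, so that the tree is finitely branching. Moreover, there are boundedly many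
  strings of bounded length; therefore a homogeneous function meets arbitrarily long strings
  and its values are bounds for witnesses of any size.
\<close>

lemma sigma1_comprehension_of_RKL:
  fixes Q :: "'a::rca0_model \<Rightarrow> 'a \<Rightarrow> bool"
  assumes RKL: "\<And>T :: 'a set. T \<in> Sets \<Longrightarrow> tree T \<Longrightarrow> unbounded T \<Longrightarrow> fin_branching T \<Longrightarrow>
      \<exists>H\<in>Sets. \<exists>D\<in>Sets. partial_fun H D \<and> unbounded D \<and> unbounded {s \<in> T. hom H D s}"
    and Q: "delta0 (\<lambda>e. Q (e 0) (e 1))"
  shows "{x. \<exists>y. Q x y} \<in> Sets"
proof -
  define ok where "ok s i \<longleftrightarrow>
      (\<forall>u<ent s i. \<exists>x<i. (\<exists>y<ent s i. Q x y) \<and> \<not> (\<exists>y<u. Q x y)) \<and>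
      (\<forall>x<i. (\<exists>y<slen s. Q x y) \<longrightarrow> (\<exists>y<ent s i. Q x y))" for s i
  define T where "T = {s. is_string s \<and> (\<forall>i<slen s. ok s i)}"
  have T: "T \<in> Sets"
    unfolding T_def ok_def
    by (rule delta0_comprehension) (intro string_rules delta0_subst2[OF Q])
  have "tree T"
    unfolding tree_def
  proof (intro ballI conjI allI impI)
    show "is_string s" if "s \<in> T" for s using that by (simp add: T_def)
    show "t \<in> T" if s: "s \<in> T" and t: "initseg t s" for s t
    proof -
      have "ok t i" if i: "i < slen t" for i
      proof -
        have eq: "ent t i = ent s i" and le: "slen t \<le> slen s"
          using t i by (auto simp: initseg_def same_entries_def)
        have "ok s i" using s i le by (auto simp: T_def)
        then show ?thesis using order_less_le_trans[OF _ le] unfolding ok_def eq by blast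
      qed
      then show ?thesis using t by (simp add: T_def initseg_def)
    qed
  qed

  have entries: "\<exists>c. \<forall>s i. s \<in> T \<longrightarrow> i < slen s \<longrightarrow> i \<le> n \<longrightarrow> ent s i \<le> c" for n
  proof -
    obtain c where c: "\<And>x y. x < n \<Longrightarrow> Q x y \<Longrightarrow> \<exists>y<c. Q x y"
      using strong_bounding[OF Q, of n] by blast
    have "ent s i \<le> c" if s: "s \<in> T" and i: "i < slen s" "i \<le> n" for s i
    proof (rule ccontr)
      assume "\<not> ent s i \<le> c"
      then have "c < ent s i" by simp
      moreover have "ok s i" using s i(1) by (simp add: T_def)
      ultimately obtain x where "x < i" "\<exists>y. Q x y" "\<not> (\<exists>y<c. Q x y)"
        unfolding ok_def by blast
      moreover from this have "x < n" using i(2) by simp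
      ultimately show False using c by blast
    qed
    then show ?thesis by blast
  qed

  have "fin_branching T"
    unfolding fin_branching_def
  proof
    fix s assume "s \<in> T"
    obtain c where c: "\<And>t. t \<in> T \<Longrightarrow> slen s < slen t \<Longrightarrow> ent t (slen s) \<le> c"
      using entries[of "slen s"] by blast
    have "n < c + 1" if "t \<in> T" "snoc s n t" for n t
      using c[of t] that by (simp add: snoc_def less_add_one_iff)
    then show "\<exists>k. \<forall>n. (\<exists>t\<in>T. snoc s n t) \<longrightarrow> n < k" by blast
  qed

  have "unbounded T"
    unfolding unbounded_def
  proof
    fix k
    define R where "R i w \<longleftrightarrow> (\<forall>x<i. (\<exists>y<k. Q x y) \<longrightarrow> (\<exists>y<w. Q x y))" for i w
    have R: "delta0 (\<lambda>e. R (e 0) (e 1))"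
      unfolding R_def by (intro string_rules delta0_subst2[OF Q])
    define F where "F i = (THE w. R i w \<and> (\<forall>w'<w. \<not> R i w'))" for i
    have ex: "\<exists>w\<le>k. R i w \<and> (\<forall>w'<w. \<not> R i w')" for i
      by (rule delta0_least) (intro delta0_subst2[OF R] string_rules, simp add: R_def)
    have uniq: "w = v" if "R i w" "\<forall>w'<w. \<not> R i w'" "R i v" "\<forall>w'<v. \<not> R i w'" for i v w
      using that by (metis linorder_less_linear)
    have F_iff: "F i = w \<longleftrightarrow> R i w \<and> (\<forall>w'<w. \<not> R i w')" for i w
    proof -
      have "\<exists>!w. R i w \<and> (\<forall>w'<w. \<not> R i w')" using ex uniq by blast
      from theI'[OF this] show ?thesis unfolding F_def using uniq by blast
    qed
    have "F i \<le> k" for i using ex[of i] F_iff[of i] by metis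
    moreover have "delta0 (\<lambda>e. F (e 0) = e 1)"
      unfolding F_iff by (intro string_rules delta0_subst2[OF R])
    ultimately obtain s where s: "is_string s" "slen s = k" "\<And>i. i < k \<Longrightarrow> ent s i = F i"
      using ex_string[of F k k] by blast
    have "ok s i" if "i < slen s" for i
    proof -
      have F: "R i (F i)" "\<And>u. u < F i \<Longrightarrow> \<not> R i u" using F_iff by blast+
      have eq: "ent s i = F i" using that s by simp
      show ?thesis unfolding ok_def s(2) eq using F unfolding R_def by blast
    qed
    then have "s \<in> T" using s by (simp add: T_def)
    then show "\<exists>s\<in>T. k \<le> s" using slen_le[of s] s(2) by auto
  qed

  then obtain H D where HD: "H \<in> Sets" "D \<in> Sets" "partial_fun H D" "unbounded D"
    "unbounded {s \<in> T. hom H D s}"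
    using RKL[OF T \<open>tree T\<close> _ \<open>fin_branching T\<close>] by blast

  \<comment> \<open>Strings of bounded length have bounded entries, hence bounded codes.\<close>
  have long: "\<exists>s\<in>T. hom H D s \<and> n < slen s" for n
  proof (rule ccontr)
    assume short: "\<not> ?thesis"
    obtain c where c: "\<And>s i. s \<in> T \<Longrightarrow> i < slen s \<Longrightarrow> i \<le> n \<Longrightarrow> ent s i \<le> c"
      using entries[of n] by blast
    obtain C where C: "\<And>s. is_string s \<Longrightarrow> slen s \<le> n \<Longrightarrow> (\<And>i. i < slen s \<Longrightarrow> ent s i \<le> c) \<Longrightarrow> s \<le> C"
      using strings_bounded[of n c] by blast
    obtain s where s: "s \<in> T" "hom H D s" "C + 1 \<le> s"
      using HD(5) unfolding unbounded_def by blast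
    have "slen s \<le> n" using short s by (auto simp: not_less)
    moreover from this have "ent s i \<le> c" if "i < slen s" for i
      using c[OF s(1) that] that by simp
    moreover have "is_string s" using s(1) by (simp add: T_def)
    ultimately have "s \<le> C" using C by blast
    with s(3) show False using less_iff_add_one_le[of C s] by simp
  qed

  have bound: "\<exists>y'<w. Q x y'" if n: "x < n" "n \<in> D" "pr n w \<in> H" and y: "Q x y" for x n w y
  proof -
    obtain s where s: "s \<in> T" "hom H D s" "max n y < slen s" using long by blast
    then have "pr n (ent s n) \<in> H" using n(2) by (simp add: hom_def T_def is_string_def)
    then have "ent s n = w" using n(3) HD(3) unfolding partial_fun_def by blast
    moreover have "ok s n" using s by (simp add: T_def)
    ultimately show ?thesis using n(1) y s(3) unfolding ok_def by auto
  qed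
  have total: "\<exists>n w. x < n \<and> n \<in> D \<and> pr n w \<in> H" for x
  proof -
    obtain n where "n \<in> D" "x + 1 \<le> n" using HD(4) unfolding unbounded_def by blast
    then show ?thesis using HD(3) unfolding partial_fun_def by (auto simp: less_iff_add_one_le)
  qed
  have "\<not> (\<exists>y. Q x y) \<longleftrightarrow> (\<exists>n w. x < n \<and> n \<in> D \<and> pr n w \<in> H \<and> \<not> (\<exists>y<w. Q x y))" for x
    using bound total by blast
  moreover have "sig1 (\<lambda>e. \<exists>n w. e 0 < n \<and> n \<in> D \<and> pr n w \<in> H \<and> \<not> (\<exists>y<w. Q (e 0) y))"
    by (intro sig1_ex sig1_delta0 bfun_mem HD string_rules delta0_subst2[OF Q])
  ultimately have "sig1 (\<lambda>e. \<not> (\<exists>y. Q (e 0) y))" by (simp only:)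
  moreover have "sig1 (\<lambda>e. \<exists>y. Q (e 0) y)"
    by (intro sig1_ex sig1_delta0 string_rules delta0_subst2[OF Q])
  ultimately show ?thesis by (intro delta1_comprehension)
qed


section \<open>From existential to arithmetical comprehension\<close>

text \<open>
  The value \<open>(0, 0)\<close> for numbers that are not pairs keeps both components bounded by the
  number.
\<close>

definition unpair :: "'a::rca0_model \<Rightarrow> 'a \<times> 'a" where
  "unpair z = (if \<exists>x y. z = pr x y then THE p. z = pr (fst p) (snd p) else (0, 0))"

lemma unpair_pr [simp]: "unpair (pr x y) = (x, y)"
proof -
  have "(THE p. pr x y = pr (fst p) (snd p)) = (x, y)" by (rule the_equality) (auto simp: prod_eq_iff)
  then show ?thesis unfolding unpair_def by auto
qed

lemma unpair_eq_iff:
  "fst (unpair z) = v \<longleftrightarrow> (\<exists>y\<le>z. z = pr v y) \<or> (\<not> (\<exists>x\<le>z. \<exists>y\<le>z. z = pr x y) \<and> v = 0)"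
  "snd (unpair z) = v \<longleftrightarrow> (\<exists>x\<le>z. z = pr x v) \<or> (\<not> (\<exists>x\<le>z. \<exists>y\<le>z. z = pr x y) \<and> v = 0)"
  using pr_ge by (cases "\<exists>x y. z = pr x y"; force simp: unpair_def[of z])+

lemma unpair_le: "fst (unpair z) \<le> z" "snd (unpair z) \<le> z"
  using unpair_eq_iff[of z "fst (unpair z)"] unpair_eq_iff(2)[of z "snd (unpair z)"]
  by (metis pr_ge zero_le)+

lemma bfun_unpair:
  assumes "bfun S"
  shows "bfun (\<lambda>e. fst (unpair (S e)))" "bfun (\<lambda>e. snd (unpair (S e)))"
proof -
  show "bfun (\<lambda>e. fst (unpair (S e)))"
    by (rule bfun_fun1[where f = "\<lambda>z. fst (unpair z)", OF _ unpair_le(1) assms])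
      (unfold unpair_eq_iff, intro bounded_rules)
  show "bfun (\<lambda>e. snd (unpair (S e)))"
    by (rule bfun_fun1[where f = "\<lambda>z. snd (unpair z)", OF _ unpair_le(2) assms])
      (unfold unpair_eq_iff, intro bounded_rules)
qed

text \<open>
  Nested pairs turn the first \<open>k\<close> variables of a formula into a single one, while the others
  remain parameters.
\<close>

definition decode :: "nat \<Rightarrow> (nat \<Rightarrow> 'a::rca0_model) \<Rightarrow> 'a \<Rightarrow> nat \<Rightarrow> 'a" where
  "decode k a t n = (if n < k then fst (unpair (((\<lambda>z. snd (unpair z)) ^^ n) t)) else a n)"

lemma decode_Suc: "decode (Suc k) (case_nat c a) (pr x t) = case_nat x (decode k a t)"
  by (auto simp: fun_eq_iff decode_def funpow_Suc_right simp del: funpow.simps(2) split: nat.split)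

lemma bfun_decode: "bfun (\<lambda>e. decode k a (e 0) n)"
proof -
  have "bfun (\<lambda>e. ((\<lambda>z. snd (unpair z)) ^^ n) (e 0 :: 'a))"
    by (induction n) (simp_all add: bounded_rules bfun_unpair)
  then show ?thesis by (cases "n < k") (simp_all add: decode_def bfun_unpair bounded_rules)
qed

lemma bfun_tval: "bfun (\<lambda>e. tval mdl (decode k a (e 0)) t)"
  by (induction t) (simp_all add: bfun_decode bounded_rules)

text \<open>
  By induction on the formula, the numbers that code satisfying environments form a set. A
  number quantifier is a projection along the pairing, up to complements.
\<close>

lemma arithmetical_comprehension_of_sigma1:
  fixes P :: "'a::rca0_model \<Rightarrow> bool"
  assumes sigma1: "\<And>Q :: 'a \<Rightarrow> 'a \<Rightarrow> bool. delta0 (\<lambda>e. Q (e 0) (e 1)) \<Longrightarrow> {x. \<exists>y. Q x y} \<in> Sets"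
    and P: "definable arithmetical mdl (\<lambda>e. P (e 0))"
  shows "{x. P x} \<in> Sets"
proof -
  have X: "{t. eval mdl (decode k a t) s p} \<in> Sets"
    if "arithmetical p" "range s \<subseteq> Sets" for p k s and a :: "nat \<Rightarrow> 'a"
    using that(1)
  proof (induction p arbitrary: k a)
    case (Eq t u)
    show ?case by simp (intro delta0_comprehension bfun_eq bfun_tval)
  next
    case (Less t u)
    show ?case by simp (intro delta0_comprehension bfun_less bfun_tval)
  next
    case (Mem t X)
    have "s X \<in> Sets" using that(2) by blast
    then show ?case by simp (intro delta0_comprehension bfun_mem bfun_tval)
  next
    case Falsum
    show ?case by simp (intro delta0_comprehension[of "\<lambda>_. False", simplified] string_rules)
  next
    case (Imp p q)
    then have "{t. eval mdl (decode k a t) s p} \<in> Sets" "{t. eval mdl (decode k a t) s q} \<in> Sets"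
      by simp_all
    then have "delta0 (\<lambda>e. e 0 \<in> {t. eval mdl (decode k a t) s p} \<longrightarrow> e 0 \<in> {t. eval mdl (decode k a t) s q})"
      by (intro string_rules bfun_mem)
    from delta0_comprehension[OF this] show ?case by simp
  next
    case (AllN p)
    let ?X = "{t. eval mdl (decode (Suc k) (case_nat 0 a) t) s p}"
    have X: "?X \<in> Sets" using AllN by simp
    have "{t. \<exists>x. pr x t \<notin> ?X} \<in> Sets"
      by (rule sigma1) (intro string_rules bfun_mem X)
    moreover have "{t. t \<notin> Y} \<in> Sets" if "Y \<in> Sets" for Y :: "'a set"
      by (intro delta0_comprehension string_rules bfun_mem that)
    ultimately have "{t. t \<notin> {t. \<exists>x. pr x t \<notin> ?X}} \<in> Sets" by blast
    then show ?case by (simp add: decode_Suc)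
  qed simp
  obtain q e s where q: "arithmetical q" "range s \<subseteq> sets mdl"
    "\<And>x y. eval mdl (case_nat x (case_nat y e)) s q \<longleftrightarrow> P x"
    using arith.definable_binary[of mdl "\<lambda>x y. P x" "\<lambda>x y. P x"] P by metis
  let ?X = "{t. eval mdl (decode 1 (case_nat 0 (case_nat 0 e)) t) s q}"
  have "?X \<in> Sets" using X q(1,2) by simp
  moreover have "{x. pr x 0 \<in> Y} \<in> Sets" if "Y \<in> Sets" for Y :: "'a set"
    by (intro delta0_comprehension string_rules bfun_mem that)
  ultimately have "{x. pr x 0 \<in> ?X} \<in> Sets" by blast
  moreover have "decode 1 (case_nat 0 (case_nat 0 e)) (pr x 0) = case_nat x (case_nat 0 e)" for x
    using decode_Suc[of 0 0 "case_nat 0 e" x 0] by (simp add: decode_def[abs_def])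
  ultimately show ?thesis by (simp add: q(3))
qed


section \<open>The equivalence\<close>

lemma not_separates_mdl: "\<not> separates ACA0 {RKL} (mdl :: 'a::rca0_model interp)"
proof -
  have "(\<forall>p\<in>ACA0. valid (mdl :: 'a interp) p) \<longleftrightarrow> valid (mdl :: 'a interp) RKL"
    unfolding valid_ACA0 valid_RKL
  proof (intro iffI ballI allI impI)
    fix T :: "'a set"
    assume "\<forall>P :: 'a \<Rightarrow> bool. definable arithmetical mdl (\<lambda>e. P (e 0)) \<longrightarrow> {x. P x} \<in> Sets"
      and "T \<in> Sets" "tree T \<and> unbounded T \<and> fin_branching T"
    then show "\<exists>H\<in>Sets. \<exists>D\<in>Sets. partial_fun H D \<and> unbounded D \<and> unbounded {s \<in> T. hom H D s}"
      by (intro RKL_of_arithmetical_comprehension) auto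
  next
    fix P :: "'a \<Rightarrow> bool"
    assume RKL: "\<forall>T::'a set\<in>Sets. tree T \<and> unbounded T \<and> fin_branching T \<longrightarrow>
        (\<exists>H\<in>Sets. \<exists>D\<in>Sets. partial_fun H D \<and> unbounded D \<and> unbounded {s \<in> T. hom H D s})"
      and P: "definable arithmetical mdl (\<lambda>e. P (e 0))"
    have "{x. \<exists>y. Q x y} \<in> Sets" if "delta0 (\<lambda>e. Q (e 0) (e 1))" for Q :: "'a \<Rightarrow> 'a \<Rightarrow> bool"
      by (rule sigma1_comprehension_of_RKL[OF _ that]) (use RKL in blast)
    from arithmetical_comprehension_of_sigma1[OF this P] show "{x. P x} \<in> Sets" .
  qed
  then show ?thesis by (simp add: separates_def)
qed

lemma valid_ACA0_iff_valid_RKL: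
  fixes M :: "generic interp"
  assumes "rca0_interp M"
  shows "(\<forall>p\<in>ACA0. valid M p) \<longleftrightarrow> valid M RKL"
proof -
  have "generic_model = mdl"
    by (intro interp.equality) (auto simp: fun_eq_iff generic_defs Sets_generic_def)
  then have "\<not> separates ACA0 {RKL} M"
    using generic_model(2)[OF assms] not_separates_mdl by metis
  then show ?thesis by (simp add: separates_def)
qed

theorem theorem3p17:
  shows "equivalent_over RCA0 ACA0 {RKL}"
proof -
  have complete: "RCA0 \<union> S \<turnstile> p"
    if "\<And>M :: generic interp. rca0_interp M \<Longrightarrow> (\<And>q. q \<in> S \<Longrightarrow> valid M q) \<Longrightarrow> valid M p" for S p
  proof (rule completeness[OF _ infinite_generic])
    show "basic_axioms \<subseteq> RCA0 \<union> S" unfolding RCA0_def by blast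
    show "valid M p" if "sets M \<noteq> {}" "\<And>q. q \<in> RCA0 \<union> S \<Longrightarrow> valid M q" for M :: "generic interp"
      using that \<open>\<And>M :: generic interp. rca0_interp M \<Longrightarrow> (\<And>q. q \<in> S \<Longrightarrow> valid M q) \<Longrightarrow> valid M p\<close>
      by (simp add: rca0_interp_def)
  qed
  show ?thesis
    unfolding equivalent_over_def
  proof (intro conjI ballI)
    fix p assume "p \<in> {RKL}"
    then show "RCA0 \<union> ACA0 \<turnstile> p"
      by (intro complete) (simp flip: valid_ACA0_iff_valid_RKL)
  next
    fix p assume "p \<in> ACA0"
    then show "RCA0 \<union> {RKL} \<turnstile> p"
      by (intro complete) (use valid_ACA0_iff_valid_RKL in blast)
  qed
qed

end
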